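(* Let $T$ be the self-adjoint multiplication operator $(Tf)(x)=xf(x)$, $\operatorname{dom}T=L^2_{r_+}(\mathbb R)$, in the Hilbert space $(L^2_{r_-}(\mathbb R),(\cdot,\cdot)_{r_-})$. Let the forms $\mathfrak t_\alpha[\cdot,\cdot]$ ($\alpha\in[0,2]$), $\mathfrak t[\cdot,\cdot]$ and the functions $f_\tau,g_\tau$ ($\tau\in[0,2]$) be as in the context. Then: (i) All forms $\mathfrak t_\alpha[\cdot,\cdot]$ with $\alpha\in[0,2]$ are closures of $(T\cdot,\cdot)_{r_-}$ in the Hilbert space $(L^2_{r_-}(\mathbb R),(\cdot,\cdot)_{r_-})$ with gap point $0$. (ii) The forms $\mathfrak t_\alpha[\cdot,\cdot]$ with $\alpha\in(0,2]$ are not regular. (iii) The form $\mathfrak t_0[\cdot,\cdot]\ (=\mathfrak t[\cdot,\cdot])$ is regular and is the regularization of all forms $\mathfrak t_\alpha[\cdot,\cdot]$ with $\alpha\in(0,2]$. (iv) For $\alpha\in(0,2]$ we have $f_\alpha\in\operatorname{dom}\mathfrak t_0\setminus\operatorname{dom}\mathfrak t_\alpha$ and $g_0\in\operatorname{dom}\mathfrak t_\alpha\setminus\operatorname{dom}\mathfrak t_0$ (where $g_0=g_\tau$ with $\tau=0$).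
   Context: Model spaces. Let the real function $r\in L^1_{loc}(\mathbb R)$ be odd ($r(-x)=-r(x)$ a.e.) and satisfy, for some $\varepsilon>0$, $r(x)=0$ a.e. on $[-\varepsilon,\varepsilon]$ and $x\,r(x)>0$ a.e. on $(-\infty,-\varepsilon)\cup(\varepsilon,\infty)$. Put $r_+(x):=x\,r(x)$, $r_-(x):=\frac1x r(x)$. For a weight $w$, $L^2_w(\mathbb R)$ is the space of (classes of) complex measurable $f$ with $\int|f|^2|w|\,dx<\infty$; for $w\ge0$ put $(f,g)_w:=\int_{-\infty}^\infty f\overline g\,w\,dx$. The form $\mathfrak t$ is $\mathfrak t[f,g]:=\int_{-\infty}^\infty f\overline g\,r\,dx$ on $\operatorname{dom}\mathfrak t:=L^2_r(\mathbb R)$. For $\alpha\in[0,2]$ put $$\eta_\alpha(x):=(\sqrt{|x|^\alpha+1}-\sqrt{|x|^\alpha})|r(x)|,\qquad\omega_\alpha(x):=\sqrt{|x|^\alpha}\,|r(x)|.$$ With $f_e(x)=\frac12(f(x)+f(-x))$, $f_o(x)=\frac12(f(x)-f(-x))$ put $$\operatorname{dom}\mathfrak t_\alpha:=\{f\in L^2_{r_-}(\mathbb R)\,|\,f_e\in L^2_{\eta_\alpha}(\mathbb R),\ f_o\in L^2_{\omega_\alpha}(\mathbb R)\},\qquad\mathfrak t_\alpha[f,g]:=\lim_{k\to\infty}\int_{-k}^kf\overline g\,r\,dx\quad(f,g\in\operatorname{dom}\mathfrak t_\alpha);$$ the limit always exists. For $\tau\in[0,2]$ put $$f_\tau(x):=\frac{\operatorname{sgn}(x)}{\sqrt{|r(x)|}\,|x|^{(\tau+2)/4}},\qquad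 g_\tau(x):=\frac1{\sqrt{|r(x)|}\,|x|^{(2-\tau)/4}}\qquad(x\in\mathbb R\setminus[-\varepsilon,\varepsilon])$$ and $f_\tau(x):=g_\tau(x):=0$ on $[-\varepsilon,\varepsilon]$. Forms. $(K,[\cdot,\cdot])$ is a Krein space if $K=K^+\oplus K^-$ (direct, $[\cdot,\cdot]$-orthogonal) with $(K^+,[\cdot,\cdot])$ and $(K^-,-[\cdot,\cdot])$ Hilbert spaces; its topology is that of the Hilbert space inner product $[J\cdot,\cdot]$, $J=P^+-P^-$, with $P^\pm$ the projections onto $K^\pm$. A form is a densely defined symmetric sesquilinear form $\mathfrak s[\cdot,\cdot]$ in a Hilbert space $(H,(\cdot,\cdot))$; put $\mathfrak s_\lambda[\cdot,\cdot]:=\mathfrak s[\cdot,\cdot]-\lambda(\cdot,\cdot)$ for the shifted form (in this paragraph the subscript $\lambda$ denotes this shift). $\mathfrak s$ is closed if for some $\lambda\in\mathbb R$ (a gap point) $(\operatorname{dom}\mathfrak s,\mathfrak s_\lambda[\cdot,\cdot])$ is a Krein space continuously embedded in $H$. A closed extension $\mathfrak s$ of a form $\tilde{\mathfrak s}$ is a closure of $\tilde{\mathfrak s}$ if $\operatorname{dom}\tilde{\mathfrak s}$ is dense in $(\operatorname{dom}\mathfrak s,\mathfrak s_\lambda[\cdot,\cdot])$ for some gap point $\lambda$. A closed form $\mathfrak s$ has a unique self-adjoint representing operator $T_{\mathfrak s}$ with $\operatorname{dom}T_{\mathfrak s}\subset\operatorname{dom}\mathfrak s$ and $\mathfrak s[u,v]=(T_{\mathfrak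 s}u,v)$ for $u\in\operatorname{dom}T_{\mathfrak s}$, $v\in\operatorname{dom}\mathfrak s$; $\mathfrak s$ is regular if $\operatorname{dom}\mathfrak s=\operatorname{dom}|T_{\mathfrak s}|^{1/2}$. For a self-adjoint boundedly invertible $T$ (i.e. $0\in\rho(T)$) there is exactly one regular closure of $(T\cdot,\cdot)$; it is called the regularization of each closure of $(T\cdot,\cdot)$. *)

theory Defs
  imports "HOL-Analysis.Analysis"
begin

section \<open>Sesquilinear forms, Hilbert spaces and Krein spaces\<close>

class complex_space = ab_group_add +
  fixes scaleC :: "complex \<Rightarrow> 'a \<Rightarrow> 'a"  (infixr "*\<^sub>C" 75)
  assumes scaleC_add_right: "a *\<^sub>C (x + y) = a *\<^sub>C x + a *\<^sub>C y"
    and scaleC_add_left: "(a + b) *\<^sub>C x = a *\<^sub>C x + b *\<^sub>C x"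
    and scaleC_scaleC: "a *\<^sub>C b *\<^sub>C x = (a * b) *\<^sub>C x"
    and scaleC_one: "1 *\<^sub>C x = x"

text \<open>
  A \<open>form\<close> is a linear manifold of an ambient complex vector space together with a function of
  two arguments, whose values matter only on that manifold.  Inner product spaces (Hilbert or
  Krein) and (unbounded) forms in a Hilbert space are all represented in this way.  Forms are
  linear in the first and conjugate linear in the second argument.
\<close>

datatype 'v form = Form (form_dom: "'v set") (form_val: "'v \<Rightarrow> 'v \<Rightarrow> complex")

definition form_eq :: "'v form \<Rightarrow> 'v form \<Rightarrow> bool" where
  "form_eq s t \<longleftrightarrow> form_dom s = form_dom t \<and>
     (\<forall>u\<in>form_dom s. \<forall>v\<in>form_dom s. form_val s u v = form_val t u v)"

definition form_extends :: "'v form \<Rightarrow> 'v form \<Rightarrow> bool" where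
  "form_extends s t \<longleftrightarrow> form_dom t \<subseteq> form_dom s \<and>
     (\<forall>u\<in>form_dom t. \<forall>v\<in>form_dom t. form_val s u v = form_val t u v)"

definition csubspace :: "'v::complex_space set \<Rightarrow> bool" where
  "csubspace S \<longleftrightarrow> 0 \<in> S \<and> (\<forall>u\<in>S. \<forall>v\<in>S. u + v \<in> S) \<and> (\<forall>c. \<forall>u\<in>S. c *\<^sub>C u \<in> S)"

definition symmetric_sesquilinear :: "'v::complex_space form \<Rightarrow> bool" where
  "symmetric_sesquilinear s \<longleftrightarrow> csubspace (form_dom s) \<and>
     (\<forall>u\<in>form_dom s. \<forall>v\<in>form_dom s. \<forall>w\<in>form_dom s.
        form_val s (u + v) w = form_val s u w + form_val s v w) \<and>
     (\<forall>c. \<forall>u\<in>form_dom s. \<forall>v\<in>form_dom s. form_val s (c *\<^sub>C u) v = c * form_val s u v) \<and>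
     (\<forall>u\<in>form_dom s. \<forall>v\<in>form_dom s. form_val s v u = cnj (form_val s u v))"

definition hnorm :: "'v form \<Rightarrow> 'v \<Rightarrow> real" where
  "hnorm H u = sqrt (Re (form_val H u u))"

definition hilbert_space :: "'v::complex_space form \<Rightarrow> bool" where
  "hilbert_space H \<longleftrightarrow> symmetric_sesquilinear H \<and>
     (\<forall>u\<in>form_dom H. u \<noteq> 0 \<longrightarrow> 0 < Re (form_val H u u)) \<and>
     (\<forall>X. (\<forall>n. X n \<in> form_dom H) \<and>
           (\<forall>e>0. \<exists>N::nat. \<forall>m\<ge>N. \<forall>n\<ge>N. hnorm H (X m - X n) < e) \<longrightarrow>
           (\<exists>u\<in>form_dom H. (\<lambda>n. hnorm H (X n - u)) \<longlonglongrightarrow> 0))"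

definition dense_wrt :: "('v::complex_space \<Rightarrow> real) \<Rightarrow> 'v set \<Rightarrow> 'v set \<Rightarrow> bool" where
  "dense_wrt N D S \<longleftrightarrow> D \<subseteq> S \<and> (\<forall>u\<in>S. \<forall>e>0. \<exists>v\<in>D. N (u - v) < e)"

definition krein_decomposition ::
    "'v::complex_space form \<Rightarrow> 'v set \<Rightarrow> 'v set \<Rightarrow> bool" where
  "krein_decomposition K P M \<longleftrightarrow>
     P \<subseteq> form_dom K \<and> M \<subseteq> form_dom K \<and> csubspace P \<and> csubspace M \<and>
     P \<inter> M = {0} \<and> (\<forall>u\<in>form_dom K. \<exists>p\<in>P. \<exists>m\<in>M. u = p + m) \<and>
     (\<forall>p\<in>P. \<forall>m\<in>M. form_val K p m = 0) \<and>
     hilbert_space (Form P (form_val K)) \<and>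
     hilbert_space (Form M (\<lambda>u v. - form_val K u v))"

definition krein_space :: "'v::complex_space form \<Rightarrow> bool" where
  "krein_space K \<longleftrightarrow> symmetric_sesquilinear K \<and> (\<exists>P M. krein_decomposition K P M)"

definition fundamental_symmetry :: "'v::complex_space set \<Rightarrow> 'v set \<Rightarrow> 'v \<Rightarrow> 'v" where
  "fundamental_symmetry P M u = (THE w. \<exists>p\<in>P. \<exists>m\<in>M. u = p + m \<and> w = p - m)"

definition krein_norm :: "'v::complex_space form \<Rightarrow> 'v set \<Rightarrow> 'v set \<Rightarrow> 'v \<Rightarrow> real" where
  "krein_norm K P M u = sqrt (Re (form_val K (fundamental_symmetry P M u) u))"

text \<open>
  The norms \<open>krein_norm K P M\<close> belonging to different decompositions of a Krein space are
  equivalent, so in the next two definitions the choice of the decomposition is immaterial.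
\<close>

definition krein_continuously_embedded ::
    "'v::complex_space form \<Rightarrow> 'v form \<Rightarrow> bool" where
  "krein_continuously_embedded K H \<longleftrightarrow> form_dom K \<subseteq> form_dom H \<and>
     (\<exists>P M. krein_decomposition K P M \<and>
        (\<exists>C. \<forall>u\<in>form_dom K. hnorm H u \<le> C * krein_norm K P M u))"

definition krein_dense :: "'v::complex_space set \<Rightarrow> 'v form \<Rightarrow> bool" where
  "krein_dense D K \<longleftrightarrow>
     (\<exists>P M. krein_decomposition K P M \<and> dense_wrt (krein_norm K P M) D (form_dom K))"


section \<open>Forms in a Hilbert space, closedness and closures\<close>

definition form_in :: "'v::complex_space form \<Rightarrow> 'v form \<Rightarrow> bool" where
  "form_in H s \<longleftrightarrow> hilbert_space H \<and> symmetric_sesquilinear s \<and>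
     dense_wrt (hnorm H) (form_dom s) (form_dom H)"

definition shifted_form :: "'v form \<Rightarrow> 'v form \<Rightarrow> real \<Rightarrow> 'v form" where
  "shifted_form H s lam =
     Form (form_dom s) (\<lambda>u v. form_val s u v - complex_of_real lam * form_val H u v)"

definition gap_point :: "'v::complex_space form \<Rightarrow> 'v form \<Rightarrow> real \<Rightarrow> bool" where
  "gap_point H s lam \<longleftrightarrow> krein_space (shifted_form H s lam) \<and>
     krein_continuously_embedded (shifted_form H s lam) H"

definition closed_form :: "'v::complex_space form \<Rightarrow> 'v form \<Rightarrow> bool" where
  "closed_form H s \<longleftrightarrow> form_in H s \<and> (\<exists>lam. gap_point H s lam)"

definition closure_with_gap_point ::
    "'v::complex_space form \<Rightarrow> 'v form \<Rightarrow> 'v form \<Rightarrow> real \<Rightarrow> bool" where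
  "closure_with_gap_point H s s0 lam \<longleftrightarrow>
     form_in H s0 \<and> closed_form H s \<and> form_extends s s0 \<and>
     gap_point H s lam \<and> krein_dense (form_dom s0) (shifted_form H s lam)"

definition closure_of_form ::
    "'v::complex_space form \<Rightarrow> 'v form \<Rightarrow> 'v form \<Rightarrow> bool" where
  "closure_of_form H s s0 \<longleftrightarrow> (\<exists>lam. closure_with_gap_point H s s0 lam)"


section \<open>Self-adjoint operators and regular forms\<close>

text \<open>An operator is an explicit domain and a map, whose values matter only on that domain.\<close>

datatype 'v operator = Operator (op_dom: "'v set") (op_app: "'v \<Rightarrow> 'v")

definition op_eq :: "'v operator \<Rightarrow> 'v operator \<Rightarrow> bool" where
  "op_eq S T \<longleftrightarrow> op_dom S = op_dom T \<and> (\<forall>u\<in>op_dom S. op_app S u = op_app T u)"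

definition op_square :: "'v operator \<Rightarrow> 'v operator" where
  "op_square T = Operator {u \<in> op_dom T. op_app T u \<in> op_dom T} (\<lambda>u. op_app T (op_app T u))"

definition linear_operator :: "'v::complex_space form \<Rightarrow> 'v operator \<Rightarrow> bool" where
  "linear_operator H T \<longleftrightarrow> csubspace (op_dom T) \<and> op_dom T \<subseteq> form_dom H \<and>
     op_app T ` op_dom T \<subseteq> form_dom H \<and>
     (\<forall>u\<in>op_dom T. \<forall>v\<in>op_dom T. op_app T (u + v) = op_app T u + op_app T v) \<and>
     (\<forall>c. \<forall>u\<in>op_dom T. op_app T (c *\<^sub>C u) = c *\<^sub>C op_app T u)"

text \<open>The last conjunct says that the graph of the adjoint of \<open>T\<close> is the graph of \<open>T\<close>.\<close>

definition self_adjoint :: "'v::complex_space form \<Rightarrow> 'v operator \<Rightarrow> bool" where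
  "self_adjoint H T \<longleftrightarrow> linear_operator H T \<and> dense_wrt (hnorm H) (op_dom T) (form_dom H) \<and>
     (\<forall>v\<in>form_dom H. \<forall>w\<in>form_dom H.
        (\<forall>u\<in>op_dom T. form_val H (op_app T u) v = form_val H u w) \<longleftrightarrow>
        v \<in> op_dom T \<and> w = op_app T v)"

definition boundedly_invertible :: "'v::complex_space form \<Rightarrow> 'v operator \<Rightarrow> bool" where
  "boundedly_invertible H T \<longleftrightarrow> bij_betw (op_app T) (op_dom T) (form_dom H) \<and>
     (\<exists>C. \<forall>u\<in>op_dom T. hnorm H u \<le> C * hnorm H (op_app T u))"

definition nonneg_sqrt ::
    "'v::complex_space form \<Rightarrow> 'v operator \<Rightarrow> 'v operator \<Rightarrow> bool" where
  "nonneg_sqrt H A B \<longleftrightarrow> self_adjoint H B \<and>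
     (\<forall>u\<in>op_dom B. 0 \<le> Re (form_val H (op_app B u) u)) \<and> op_eq (op_square B) A"

text \<open>
  For self-adjoint \<open>T\<close> the absolute value is \<open>(T\<^sup>* T)\<^bsup>1/2\<^esup> = (T\<^sup>2)\<^bsup>1/2\<^esup>\<close>.
  The nonnegative self-adjoint square root of a nonnegative self-adjoint operator exists and is
  unique.
\<close>

definition abs_of_self_adjoint ::
    "'v::complex_space form \<Rightarrow> 'v operator \<Rightarrow> 'v operator \<Rightarrow> bool" where
  "abs_of_self_adjoint H T A \<longleftrightarrow> nonneg_sqrt H (op_square T) A"

definition represents :: "'v::complex_space form \<Rightarrow> 'v form \<Rightarrow> 'v operator \<Rightarrow> bool" where
  "represents H s T \<longleftrightarrow> self_adjoint H T \<and> op_dom T \<subseteq> form_dom s \<and>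
     (\<forall>u\<in>op_dom T. \<forall>v\<in>form_dom s. form_val s u v = form_val H (op_app T u) v)"

definition regular_form :: "'v::complex_space form \<Rightarrow> 'v form \<Rightarrow> bool" where
  "regular_form H s \<longleftrightarrow> closed_form H s \<and>
     (\<exists>T A B. represents H s T \<and> abs_of_self_adjoint H T A \<and> nonneg_sqrt H A B \<and>
        form_dom s = op_dom B)"

definition operator_form :: "'v form \<Rightarrow> 'v operator \<Rightarrow> 'v form" where
  "operator_form H T = Form (op_dom T) (\<lambda>u v. form_val H (op_app T u) v)"

text \<open>
  The form \<open>s0\<close> is the regularization of \<open>s\<close>.  A self-adjoint boundedly invertible operator
  induces exactly one regular closure, so uniqueness is not part of the definition.
\<close>

definition regularization_of :: "'v::complex_space form \<Rightarrow> 'v form \<Rightarrow> 'v form \<Rightarrow> bool" where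
  "regularization_of H s0 s \<longleftrightarrow>
     (\<exists>T. self_adjoint H T \<and> boundedly_invertible H T \<and>
        closure_of_form H s (operator_form H T) \<and>
        closure_of_form H s0 (operator_form H T) \<and> regular_form H s0)"


section \<open>Classes of measurable functions\<close>

definition ae_equal :: "(real \<Rightarrow> complex) \<Rightarrow> (real \<Rightarrow> complex) \<Rightarrow> bool" where
  "ae_equal f g \<longleftrightarrow> f \<in> borel_measurable lebesgue \<and> g \<in> borel_measurable lebesgue \<and>
     (AE x in lebesgue. f x = g x)"

lemma ae_equal_pointwise:
  assumes "ae_equal f f'"
    and "\<And>h. h \<in> borel_measurable lebesgue \<Longrightarrow> (\<lambda>x. F x (h x)) \<in> borel_measurable lebesgue"
  shows "ae_equal (\<lambda>x. F x (f x)) (\<lambda>x. F x (f' x))"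
proof -
  have "AE x in lebesgue. f x = f' x"
    using assms(1) by (simp add: ae_equal_def)
  then have "AE x in lebesgue. F x (f x) = F x (f' x)"
    by (rule eventually_mono) simp
  with assms show ?thesis by (simp add: ae_equal_def)
qed

lemma ae_equal_pointwise2:
  assumes "ae_equal f f'" and "ae_equal g g'"
    and "\<And>h k :: real \<Rightarrow> complex. h \<in> borel_measurable lebesgue \<Longrightarrow> k \<in> borel_measurable lebesgue \<Longrightarrow>
           (\<lambda>x. F (h x) (k x)) \<in> borel_measurable lebesgue"
  shows "ae_equal (\<lambda>x. F (f x) (g x)) (\<lambda>x. F (f' x) (g' x))"
proof -
  have "AE x in lebesgue. f x = f' x" "AE x in lebesgue. g x = g' x"
    using assms(1,2) by (simp_all add: ae_equal_def)
  then have "AE x in lebesgue. F (f x) (g x) = F (f' x) (g' x)"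
    by eventually_elim simp
  with assms show ?thesis unfolding ae_equal_def by blast
qed

quotient_type fclass = "real \<Rightarrow> complex" / partial: ae_equal
  morphisms fclass_rep fclass_of
proof (rule part_equivpI)
  show "\<exists>f. ae_equal f f"
    by (rule exI[of _ "\<lambda>_. 0"]) (simp add: ae_equal_def)
  show "symp ae_equal"
    by (rule sympI) (simp add: ae_equal_def eq_commute)
  show "transp ae_equal"
  proof (rule transpI)
    fix f g h
    assume *: "ae_equal f g" "ae_equal g h"
    then have "AE x in lebesgue. f x = g x" "AE x in lebesgue. g x = h x"
      by (simp_all add: ae_equal_def)
    then have "AE x in lebesgue. f x = h x"
      by eventually_elim simp
    with * show "ae_equal f h" by (simp add: ae_equal_def)
  qed
qed

instantiation fclass :: complex_space
begin

lift_definition zero_fclass :: fclass is "\<lambda>x. 0"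
  by (simp add: ae_equal_def)

lift_definition plus_fclass :: "fclass \<Rightarrow> fclass \<Rightarrow> fclass" is "\<lambda>f g x. f x + g x"
  by (rule ae_equal_pointwise2[where F = "(+)"]) (assumption | rule borel_measurable_add)+

lift_definition minus_fclass :: "fclass \<Rightarrow> fclass \<Rightarrow> fclass" is "\<lambda>f g x. f x - g x"
  by (rule ae_equal_pointwise2[where F = "(-)"]) (assumption | rule borel_measurable_diff)+

lift_definition uminus_fclass :: "fclass \<Rightarrow> fclass" is "\<lambda>f x. - f x"
  by (rule ae_equal_pointwise[where F = "\<lambda>x. uminus"]) (simp_all add: borel_measurable_uminus)

lift_definition scaleC_fclass :: "complex \<Rightarrow> fclass \<Rightarrow> fclass" is "\<lambda>c f x. c * f x"
  by (rule ae_equal_pointwise) (simp_all add: borel_measurable_times)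

instance
proof
  fix a b :: complex and x y z :: fclass
  show "x + y + z = x + (y + z)"
    by transfer (simp add: ae_equal_def add.assoc borel_measurable_add)
  show "x + y = y + x"
    by transfer (simp add: ae_equal_def add.commute borel_measurable_add)
  show "0 + x = x"
    by transfer (simp add: ae_equal_def)
  show "- x + x = 0"
    by transfer (simp add: ae_equal_def)
  show "x - y = x + - y"
    by transfer (simp add: ae_equal_def borel_measurable_diff)
  show "a *\<^sub>C (x + y) = a *\<^sub>C x + a *\<^sub>C y"
    by transfer (simp add: ae_equal_def distrib_left borel_measurable_add borel_measurable_times)
  show "(a + b) *\<^sub>C x = a *\<^sub>C x + b *\<^sub>C x"
    by transfer (simp add: ae_equal_def distrib_right borel_measurable_add borel_measurable_times)
  show "a *\<^sub>C b *\<^sub>C x = (a * b) *\<^sub>C x"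
    by transfer (simp add: ae_equal_def mult.assoc borel_measurable_times)
  show "1 *\<^sub>C x = x"
    by transfer (simp add: ae_equal_def)
qed

end

lemma measurable_reflect_lebesgue:
  fixes f :: "real \<Rightarrow> complex"
  assumes "f \<in> borel_measurable lebesgue"
  shows "(\<lambda>x. f (- x)) \<in> borel_measurable lebesgue"
  using measurable_compose[OF lebesgue_measurable_scaling[of "-1 :: real"] assms] by simp

lemma AE_reflect_lebesgue:
  assumes "AE x::real in lebesgue. P x"
  shows "AE x::real in lebesgue. P (- x)"
proof -
  have "AE x in (lborel :: real measure). P x"
    using assms by (simp add: AE_completion_iff)
  then have "AE x in distr lborel borel (uminus :: real \<Rightarrow> real). P x"
    by (subst lborel_distr_uminus)
  then have "AE x in (lborel :: real measure). P (- x)"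
    by (rule AE_distrD[rotated]) simp
  then show ?thesis by (rule AE_completion)
qed

lemma ae_equal_reflect:
  assumes "ae_equal f g"
  shows "ae_equal (\<lambda>x. f (- x)) (\<lambda>x. g (- x))"
  using assms AE_reflect_lebesgue[of "\<lambda>x. f x = g x"]
  by (simp add: ae_equal_def measurable_reflect_lebesgue)

lemma AE_eq_integrable_lebesgue:
  fixes f g :: "real \<Rightarrow> 'b::euclidean_space"
  assumes "AE x in lebesgue. f x = g x"
  shows "integrable lebesgue f \<longleftrightarrow> integrable lebesgue g"
    and "integral\<^sup>L lebesgue f = integral\<^sup>L lebesgue g"
proof -
  have *: "integrable lebesgue k"
    if "integrable lebesgue h" "AE x in lebesgue. h x = k x" for h k :: "real \<Rightarrow> 'b"
  proof -
    have "h \<in> borel_measurable lebesgue"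
      using that(1) by (rule borel_measurable_integrable)
    then have "k \<in> borel_measurable lebesgue"
      using that(2) by (rule borel_measurable_AE)
    with that show ?thesis by (blast intro: integrable_cong_AE_imp)
  qed
  have sym: "AE x in lebesgue. g x = f x"
    using assms by (simp add: eq_commute)
  show iff: "integrable lebesgue f \<longleftrightarrow> integrable lebesgue g"
    using *[OF _ assms] *[OF _ sym] by blast
  show "integral\<^sup>L lebesgue f = integral\<^sup>L lebesgue g"
  proof (cases "integrable lebesgue f")
    case True
    with iff have "integrable lebesgue g" by simp
    with True show ?thesis
      by (intro integral_cong_AE borel_measurable_integrable assms)
  next
    case False
    with iff show ?thesis by (simp add: not_integrable_integral_eq)
  qed
qed

text \<open>
  The elements of \<open>fclass\<close> are classes modulo Lebesgue-a.e. equality.  For a weight \<open>w\<close> that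
  vanishes on a set of positive measure, the elements of \<open>L\<^sup>2\<^sub>w\<close> are classes modulo the coarser
  relation of \<open>|w| dx\<close>-a.e. equality.  Each such class has, up to Lebesgue-a.e. equality, exactly
  one representative that vanishes a.e. on the set where \<open>w = 0\<close>; the space \<open>L\<^sup>2\<^sub>w\<close> is realized
  by these representatives.
\<close>

lift_definition in_L2w :: "(real \<Rightarrow> real) \<Rightarrow> fclass \<Rightarrow> bool" is
  "\<lambda>w f. integrable lebesgue (\<lambda>x. (cmod (f x))\<^sup>2 * \<bar>w x\<bar>) \<and>
         (AE x in lebesgue. w x = 0 \<longrightarrow> f x = 0)"
proof -
  fix w :: "real \<Rightarrow> real" and f g
  assume "ae_equal f g"
  then have ae: "AE x in lebesgue. f x = g x" by (simp add: ae_equal_def)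
  have "AE x in lebesgue. (cmod (f x))\<^sup>2 * \<bar>w x\<bar> = (cmod (g x))\<^sup>2 * \<bar>w x\<bar>"
    using ae by eventually_elim simp
  then have "integrable lebesgue (\<lambda>x. (cmod (f x))\<^sup>2 * \<bar>w x\<bar>) \<longleftrightarrow>
      integrable lebesgue (\<lambda>x. (cmod (g x))\<^sup>2 * \<bar>w x\<bar>)"
    by (rule AE_eq_integrable_lebesgue(1))
  moreover have "AE x in lebesgue. (w x = 0 \<longrightarrow> f x = 0) \<longleftrightarrow> (w x = 0 \<longrightarrow> g x = 0)"
    using ae by eventually_elim simp
  then have "(AE x in lebesgue. w x = 0 \<longrightarrow> f x = 0) \<longleftrightarrow>
      (AE x in lebesgue. w x = 0 \<longrightarrow> g x = 0)"
    by (rule eventually_subst)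
  ultimately show "(integrable lebesgue (\<lambda>x. (cmod (f x))\<^sup>2 * \<bar>w x\<bar>) \<and>
         (AE x in lebesgue. w x = 0 \<longrightarrow> f x = 0)) \<longleftrightarrow>
      (integrable lebesgue (\<lambda>x. (cmod (g x))\<^sup>2 * \<bar>w x\<bar>) \<and>
         (AE x in lebesgue. w x = 0 \<longrightarrow> g x = 0))"
    by simp
qed

definition L2w :: "(real \<Rightarrow> real) \<Rightarrow> fclass set" where
  "L2w w = {F. in_L2w w F}"

lift_definition wprod_on :: "real set \<Rightarrow> (real \<Rightarrow> real) \<Rightarrow> fclass \<Rightarrow> fclass \<Rightarrow> complex" is
  "\<lambda>A w f g. LINT x:A|lebesgue. f x * cnj (g x) * complex_of_real (w x)"
proof -
  fix A :: "real set" and w :: "real \<Rightarrow> real" and f f' g g'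
  assume "ae_equal f f'" "ae_equal g g'"
  then have "AE x in lebesgue. f x = f' x" "AE x in lebesgue. g x = g' x"
    by (simp_all add: ae_equal_def)
  then have "AE x in lebesgue.
      indicator A x *\<^sub>R (f x * cnj (g x) * complex_of_real (w x)) =
      indicator A x *\<^sub>R (f' x * cnj (g' x) * complex_of_real (w x))"
    by eventually_elim simp
  then show "(LINT x:A|lebesgue. f x * cnj (g x) * complex_of_real (w x)) =
      (LINT x:A|lebesgue. f' x * cnj (g' x) * complex_of_real (w x))"
    unfolding set_lebesgue_integral_def by (rule AE_eq_integrable_lebesgue(2))
qed

abbreviation wprod :: "(real \<Rightarrow> real) \<Rightarrow> fclass \<Rightarrow> fclass \<Rightarrow> complex" where
  "wprod w \<equiv> wprod_on UNIV w"

lift_definition even_part :: "fclass \<Rightarrow> fclass" is "\<lambda>f x. (f x + f (- x)) / 2"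
  by (rule ae_equal_pointwise2[where F = "\<lambda>a b. (a + b) / 2"])
    (assumption | rule ae_equal_reflect borel_measurable_divide borel_measurable_add
       borel_measurable_const)+

lift_definition odd_part :: "fclass \<Rightarrow> fclass" is "\<lambda>f x. (f x - f (- x)) / 2"
  by (rule ae_equal_pointwise2[where F = "\<lambda>a b. (a - b) / 2"])
    (assumption | rule ae_equal_reflect borel_measurable_divide borel_measurable_diff
       borel_measurable_const)+

lift_definition mult_x :: "fclass \<Rightarrow> fclass" is "\<lambda>f x. complex_of_real x * f x"
proof (rule ae_equal_pointwise[where F = "\<lambda>x z. complex_of_real x * z"])
  fix h :: "real \<Rightarrow> complex"
  assume h: "h \<in> borel_measurable lebesgue"
  have "complex_of_real \<in> borel_measurable lebesgue"
    by (rule measurable_completion) simp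
  from borel_measurable_times[OF this h]
  show "(\<lambda>x. complex_of_real x * h x) \<in> borel_measurable lebesgue" .
qed


section \<open>The model space and its forms\<close>

definition admissible_weight :: "(real \<Rightarrow> real) \<Rightarrow> real \<Rightarrow> bool" where
  "admissible_weight r eps \<longleftrightarrow>
     (\<forall>K. compact K \<longrightarrow> r absolutely_integrable_on K) \<and>
     (AE x in lebesgue. r (- x) = - r x) \<and>
     0 < eps \<and>
     (AE x in lebesgue. \<bar>x\<bar> \<le> eps \<longrightarrow> r x = 0) \<and>
     (AE x in lebesgue. eps < \<bar>x\<bar> \<longrightarrow> 0 < x * r x)"

definition r_plus :: "(real \<Rightarrow> real) \<Rightarrow> real \<Rightarrow> real" where
  "r_plus r x = x * r x"

definition r_minus :: "(real \<Rightarrow> real) \<Rightarrow> real \<Rightarrow> real" where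
  "r_minus r x = r x / x"

text \<open>
  In the following formulas \<open>0 powr 0 = 0\<close> and division by zero only concern null sets.
\<close>

definition eta :: "(real \<Rightarrow> real) \<Rightarrow> real \<Rightarrow> real \<Rightarrow> real" where
  "eta r \<alpha> x = (sqrt (\<bar>x\<bar> powr \<alpha> + 1) - sqrt (\<bar>x\<bar> powr \<alpha>)) * \<bar>r x\<bar>"

definition omega :: "(real \<Rightarrow> real) \<Rightarrow> real \<Rightarrow> real \<Rightarrow> real" where
  "omega r \<alpha> x = sqrt (\<bar>x\<bar> powr \<alpha>) * \<bar>r x\<bar>"

definition model_space :: "(real \<Rightarrow> real) \<Rightarrow> fclass form" where
  "model_space r = Form (L2w (r_minus r)) (wprod (r_minus r))"

definition model_operator :: "(real \<Rightarrow> real) \<Rightarrow> fclass operator" where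
  "model_operator r = Operator (L2w (r_plus r)) mult_x"

definition form_t :: "(real \<Rightarrow> real) \<Rightarrow> fclass form" where
  "form_t r = Form (L2w r) (wprod r)"

definition form_t_alpha :: "(real \<Rightarrow> real) \<Rightarrow> real \<Rightarrow> fclass form" where
  "form_t_alpha r \<alpha> =
     Form {f \<in> L2w (r_minus r). even_part f \<in> L2w (eta r \<alpha>) \<and> odd_part f \<in> L2w (omega r \<alpha>)}
          (\<lambda>f g. lim (\<lambda>k::nat. wprod_on {- real k..real k} r f g))"

definition f_fun :: "(real \<Rightarrow> real) \<Rightarrow> real \<Rightarrow> real \<Rightarrow> real \<Rightarrow> complex" where
  "f_fun r eps \<tau> x =
     (if \<bar>x\<bar> \<le> eps then 0
      else complex_of_real (sgn x / (sqrt \<bar>r x\<bar> * \<bar>x\<bar> powr ((\<tau> + 2) / 4))))"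

definition g_fun :: "(real \<Rightarrow> real) \<Rightarrow> real \<Rightarrow> real \<Rightarrow> real \<Rightarrow> complex" where
  "g_fun r eps \<tau> x =
     (if \<bar>x\<bar> \<le> eps then 0
      else complex_of_real (1 / (sqrt \<bar>r x\<bar> * \<bar>x\<bar> powr ((2 - \<tau>) / 4))))"

end

theory Submission
  imports Defs
begin

text \<open>
  Write \<open>g\<^sup>*\<close> for the complex conjugate of \<open>g\<close>.  Since \<open>r\<close> is odd, the integral of \<open>f g\<^sup>* r\<close> over
  \<open>[-k,k]\<close> sees only the products of an even part with an odd part.  Such a product does not change if all even parts are multiplied by \<open>|x|\<^sup>-\<^sup>s\<close> and all odd
  parts by \<open>|x|\<^sup>s\<close>.  For \<open>s = \<alpha>/4\<close> this map, called \<open>balance\<close>, is an isomorphism of the domain of \<open>t\<^sub>\<alpha>\<close> onto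
  \<open>L\<^sup>2\<^sub>r\<close> and carries \<open>t\<^sub>\<alpha>\<close> into \<open>t\<close> (\<open>dom_t_alpha\<close>, \<open>t_alpha_val\<close>): off the gap of \<open>r\<close> the weight \<open>\<eta>\<^sub>\<alpha>\<close> of the
  even parts is comparable to \<open>|x|\<^sup>-\<^sup>\<alpha>\<^sup>/\<^sup>2 |r|\<close>, and the weight \<open>\<omega>\<^sub>\<alpha>\<close> of the odd parts is \<open>|x|\<^sup>\<alpha>\<^sup>/\<^sup>2 |r|\<close>.  In
  \<open>L\<^sup>2\<^sub>r\<close> multiplication by \<open>sgn\<close> is a fundamental symmetry, so each \<open>t\<^sub>\<alpha>\<close> is a Krein space
  (\<open>krein_t_alpha\<close>), and the bounds \<open>0 \<le> \<alpha>/2 \<le> 1\<close> on the exponents give the continuous embedding.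
  Balancing commutes with cutting off at \<open>|x| = n\<close>, and cutoffs lie in the domain of \<open>T\<close>; this is the
  density that makes every \<open>t\<^sub>\<alpha>\<close> a closure of \<open>(T\<cdot>,\<cdot>)\<close> (\<open>closure_t_alpha\<close>).

  All \<open>t\<^sub>\<alpha>\<close> are represented by \<open>T\<close>, so regularity asks whether their domain is that of \<open>|T|\<^sup>1\<^sup>/\<^sup>2\<close>.  For \<open>\<alpha> = 0\<close>
  the roots are multiplications by \<open>|x|\<close> and \<open>|x|\<^sup>1\<^sup>/\<^sup>2\<close>, and the domain \<open>L\<^sup>2\<^sub>r\<close> is the right one.  For
  \<open>\<alpha> > 0\<close> regularity provides some nonnegative self-adjoint roots \<open>A\<close> of \<open>T\<^sup>2\<close> and \<open>B\<close> of \<open>A\<close> such that \<open>t\<^sub>\<alpha>\<close>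
  has the domain of \<open>B\<close>.  This is refuted by showing that the domain of every such \<open>B\<close> contains \<open>L\<^sup>2\<^sub>r\<close>
  (\<open>L2w_r_subset_sqrt_abs\<close>), because \<open>f\<^sub>\<alpha>\<close> is in \<open>L\<^sup>2\<^sub>r\<close> and not in the domain of \<open>t\<^sub>\<alpha>\<close>.  This
  inclusion comes from an inequality of Heinz type, \<open>\<parallel>B u\<parallel> \<le> \<parallel>|x|\<^sup>1\<^sup>/\<^sup>2 u\<parallel>\<close> (\<open>sqrt_abs_norm_le\<close>), whose proof
  iterates a symmetric operator and uses that a bounded log-convex sequence cannot increase.
\<close>

section \<open>Sesquilinear forms and Hilbert spaces\<close>

lemma scaleC_zero_left [simp]: "0 *\<^sub>C (x::'a::complex_space) = 0"
  using scaleC_add_left[of 0 0 x] by simp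

lemma scaleC_zero_right [simp]: "c *\<^sub>C (0::'a::complex_space) = 0"
  using scaleC_add_right[of c 0 "0::'a"] by simp

lemma scaleC_minus_one [simp]: "(-1) *\<^sub>C (x::'a::complex_space) = - x"
  using scaleC_add_left[of 1 "-1" x] by (simp add: scaleC_one eq_neg_iff_add_eq_0 add.commute)

lemma scaleC_minus_right: "c *\<^sub>C (- x) = - (c *\<^sub>C (x::'a::complex_space))"
  using scaleC_scaleC[of c "-1" x] scaleC_scaleC[of "-1" c x] by simp

lemma scaleC_diff_right: "c *\<^sub>C (x - y) = c *\<^sub>C x - c *\<^sub>C (y::'a::complex_space)"
  using scaleC_add_right[of c x "-y"] by (simp add: scaleC_minus_right)

lemma scaleC_half: "(1/2) *\<^sub>C (x::'a::complex_space) + (1/2) *\<^sub>C x = x"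
  using scaleC_add_left[of "1/2" "1/2" x] by (simp add: scaleC_one)

lemma csubspaceD:
  assumes "csubspace S"
  shows "0 \<in> S" "u \<in> S \<Longrightarrow> v \<in> S \<Longrightarrow> u + v \<in> S" "u \<in> S \<Longrightarrow> c *\<^sub>C u \<in> S"
    "u \<in> S \<Longrightarrow> - u \<in> S" "u \<in> S \<Longrightarrow> v \<in> S \<Longrightarrow> u - v \<in> S"
proof -
  show *: "0 \<in> S" "\<And>u v. u \<in> S \<Longrightarrow> v \<in> S \<Longrightarrow> u + v \<in> S" "\<And>c u. u \<in> S \<Longrightarrow> c *\<^sub>C u \<in> S"
    using assms by (auto simp: csubspace_def)
  show m: "- u \<in> S" if "u \<in> S" for u using *(3)[of u "-1"] that by simp
  show "u - v \<in> S" if "u \<in> S" "v \<in> S" using *(2)[OF that(1) m[OF that(2)]] by simp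
qed

lemma symmetric_sesquilinearD:
  assumes "symmetric_sesquilinear s"
  shows "csubspace (form_dom s)"
    "u \<in> form_dom s \<Longrightarrow> v \<in> form_dom s \<Longrightarrow> w \<in> form_dom s \<Longrightarrow>
      form_val s (u + v) w = form_val s u w + form_val s v w"
    "u \<in> form_dom s \<Longrightarrow> v \<in> form_dom s \<Longrightarrow> form_val s (c *\<^sub>C u) v = c * form_val s u v"
    "u \<in> form_dom s \<Longrightarrow> v \<in> form_dom s \<Longrightarrow> form_val s v u = cnj (form_val s u v)"
proof -
  from assms have s: "csubspace (form_dom s)"
    "\<forall>u\<in>form_dom s. \<forall>v\<in>form_dom s. \<forall>w\<in>form_dom s.
        form_val s (u + v) w = form_val s u w + form_val s v w"
    "\<forall>c. \<forall>u\<in>form_dom s. \<forall>v\<in>form_dom s. form_val s (c *\<^sub>C u) v = c * form_val s u v"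
    "\<forall>u\<in>form_dom s. \<forall>v\<in>form_dom s. form_val s v u = cnj (form_val s u v)"
    unfolding symmetric_sesquilinear_def by - (elim conjE, assumption)+
  show "csubspace (form_dom s)" by (fact s)
  show "form_val s (u + v) w = form_val s u w + form_val s v w"
    if "u \<in> form_dom s" "v \<in> form_dom s" "w \<in> form_dom s"
    using s(2) that by blast
  show "form_val s (c *\<^sub>C u) v = c * form_val s u v" if "u \<in> form_dom s" "v \<in> form_dom s"
    using s(3) that by blast
  show "form_val s v u = cnj (form_val s u v)" if "u \<in> form_dom s" "v \<in> form_dom s"
    using s(4) that by blast
qed

lemma sesquilinear_simps:
  assumes "symmetric_sesquilinear s" and "u \<in> form_dom s" "v \<in> form_dom s" "w \<in> form_dom s"
  shows "form_val s (u - v) w = form_val s u w - form_val s v w"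
    "form_val s u (v + w) = form_val s u v + form_val s u w"
    "form_val s u (v - w) = form_val s u v - form_val s u w"
    "form_val s u (c *\<^sub>C v) = cnj c * form_val s u v"
    "form_val s (- u) v = - form_val s u v"
    "form_val s u (- v) = - form_val s u v"
    "form_val s 0 u = 0"
    "Im (form_val s u u) = 0"
proof -
  note D = symmetric_sesquilinearD[OF assms(1)] and C = csubspaceD[OF symmetric_sesquilinearD(1)[OF assms(1)]]
  show m: "form_val s (- u) v = - form_val s u v"
    using D(3)[OF assms(2,3), of "-1"] by simp
  have m': "form_val s (- v) w = - form_val s v w"
    using D(3)[OF assms(3,4), of "-1"] by simp
  show "form_val s (u - v) w = form_val s u w - form_val s v w"
    using D(2)[OF assms(2) C(4)[OF assms(3)] assms(4)] m' by simp
  have flip: "form_val s a b = cnj (form_val s b a)" if "a \<in> form_dom s" "b \<in> form_dom s" for a b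
    using D(4)[OF that(2,1)] .
  show "form_val s u (v + w) = form_val s u v + form_val s u w"
    using flip[OF assms(2) C(2)[OF assms(3,4)]] flip[OF assms(2,3)] flip[OF assms(2,4)]
      D(2)[OF assms(3,4,2)] by simp
  have r: "form_val s u (c *\<^sub>C y) = cnj c * form_val s u y" if "y \<in> form_dom s" for c y
    using flip[OF assms(2) C(3)[OF that]] flip[OF assms(2) that] D(3)[OF that assms(2)] by simp
  show "form_val s u (c *\<^sub>C v) = cnj c * form_val s u v" by (rule r[OF assms(3)])
  show n: "form_val s u (- v) = - form_val s u v"
    using r[OF assms(3), of "-1"] by simp
  have n': "form_val s u (- w) = - form_val s u w"
    using r[OF assms(4), of "-1"] by simp
  have "form_val s u (v + (- w)) = form_val s u v + form_val s u (- w)"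
    using flip[OF assms(2) C(2)[OF assms(3) C(4)[OF assms(4)]]] flip[OF assms(2,3)] 
      flip[OF assms(2) C(4)[OF assms(4)]] D(2)[OF assms(3) C(4)[OF assms(4)] assms(2)] by simp
  with n' show "form_val s u (v - w) = form_val s u v - form_val s u w" by simp
  show "form_val s 0 u = 0"
    using D(3)[OF assms(2,2), of 0] by simp
  have "Im (form_val s u u) = Im (cnj (form_val s u u))"
    using D(4)[OF assms(2,2)] by metis
  then show "Im (form_val s u u) = 0" by simp
qed

lemma symmetric_sesquilinear_pullback:
  assumes s: "symmetric_sesquilinear s" and D: "csubspace D"
    and maps: "\<And>u. u \<in> D \<Longrightarrow> U u \<in> form_dom s"
    and add: "\<And>u v. u \<in> D \<Longrightarrow> v \<in> D \<Longrightarrow> U (u + v) = U u + U v"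
    and scale: "\<And>c u. u \<in> D \<Longrightarrow> U (c *\<^sub>C u) = c *\<^sub>C U u"
    and val: "\<And>u v. u \<in> D \<Longrightarrow> v \<in> D \<Longrightarrow> f u v = form_val s (U u) (U v)"
  shows "symmetric_sesquilinear (Form D f)"
  unfolding symmetric_sesquilinear_def form.sel
proof (intro conjI ballI allI)
  show "csubspace D" by fact
next
  fix u v w assume "u \<in> D" "v \<in> D" "w \<in> D"
  then show "f (u + v) w = f u w + f v w"
    using csubspaceD[OF D] symmetric_sesquilinearD(2)[OF s] by (simp add: val add maps)
next
  fix c u v assume "u \<in> D" "v \<in> D"
  then show "f (c *\<^sub>C u) v = c * f u v"
    using csubspaceD[OF D] symmetric_sesquilinearD(3)[OF s] by (simp add: val scale maps)
next
  fix u v assume "u \<in> D" "v \<in> D"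
  then show "f v u = cnj (f u v)"
    using symmetric_sesquilinearD(4)[OF s maps maps, of u v] by (simp only: val)
qed

lemma hilbert_spaceD:
  assumes "hilbert_space H"
  shows "symmetric_sesquilinear H" "csubspace (form_dom H)"
    "u \<in> form_dom H \<Longrightarrow> u \<noteq> 0 \<Longrightarrow> 0 < Re (form_val H u u)"
    "u \<in> form_dom H \<Longrightarrow> 0 \<le> Re (form_val H u u)"
proof -
  show *: "symmetric_sesquilinear H" using assms by (simp add: hilbert_space_def)
  then show "csubspace (form_dom H)" by (rule symmetric_sesquilinearD)
  show pos: "0 < Re (form_val H u u)" if "u \<in> form_dom H" "u \<noteq> 0" for u
    using assms that by (simp add: hilbert_space_def)
  show "0 \<le> Re (form_val H u u)" if "u \<in> form_dom H"
    using pos[OF that] sesquilinear_simps(7)[OF * that that that] by (cases "u = 0") auto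
qed

lemma hilbert_complete:
  assumes "hilbert_space H" "\<And>n. X n \<in> form_dom H"
    and "\<And>e. e > 0 \<Longrightarrow> \<exists>N::nat. \<forall>m\<ge>N. \<forall>n\<ge>N. hnorm H (X m - X n) < e"
  obtains u where "u \<in> form_dom H" "(\<lambda>n. hnorm H (X n - u)) \<longlonglongrightarrow> 0"
proof -
  from assms(1) have "\<forall>X. (\<forall>n. X n \<in> form_dom H) \<and>
           (\<forall>e>0. \<exists>N::nat. \<forall>m\<ge>N. \<forall>n\<ge>N. hnorm H (X m - X n) < e) \<longrightarrow>
           (\<exists>u\<in>form_dom H. (\<lambda>n. hnorm H (X n - u)) \<longlonglongrightarrow> 0)"
    unfolding hilbert_space_def by (elim conjE)
  from spec[OF this, of X] assms(2,3) that show thesis by auto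
qed

lemma hnorm_square:
  assumes "hilbert_space H" "u \<in> form_dom H"
  shows "(hnorm H u)\<^sup>2 = Re (form_val H u u)" "0 \<le> hnorm H u"
  using hilbert_spaceD(4)[OF assms] sesquilinear_simps(8)[OF hilbert_spaceD(1)[OF assms(1)] assms(2,2,2)]
  by (simp_all add: hnorm_def complex_eq_iff)

lemma hilbert_Cauchy_Schwarz:
  assumes H: "hilbert_space H" and u: "u \<in> form_dom H" and v: "v \<in> form_dom H"
  shows "cmod (form_val H u v) \<le> hnorm H u * hnorm H v"
proof (cases "v = 0")
  case True
  have "form_val H u 0 = cnj (form_val H 0 u)"
    by (rule symmetric_sesquilinearD(4)[OF hilbert_spaceD(1)[OF H] csubspaceD(1)[OF hilbert_spaceD(2)[OF H]] u])
  also have "form_val H 0 u = 0"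
    by (rule sesquilinear_simps(7)[OF hilbert_spaceD(1)[OF H] u u u])
  finally have "form_val H u v = 0" by (simp add: True)
  then show ?thesis
    using mult_nonneg_nonneg[OF hnorm_square(2)[OF H u] hnorm_square(2)[OF H v]] by simp
next
  case False
  note S = hilbert_spaceD(1)[OF H] and C = csubspaceD[OF hilbert_spaceD(2)[OF H]]
  define b where "b = Re (form_val H v v)"
  have b: "b > 0" "form_val H v v = of_real b"
    using hilbert_spaceD(3)[OF H v False] sesquilinear_simps(8)[OF S v v v]
    by (simp_all add: b_def complex_eq_iff)
  define z where "z = form_val H u v"
  have zv: "form_val H v u = cnj z"
    unfolding z_def by (rule symmetric_sesquilinearD(4)[OF S u v])
  define c where "c = z / of_real b"
  have cv: "c *\<^sub>C v \<in> form_dom H" by (rule C(3)[OF v])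
  let ?w = "u - c *\<^sub>C v"
  have w: "?w \<in> form_dom H" by (rule C(5)[OF u cv])
  have "form_val H ?w ?w = form_val H u u - cnj c * z - c * (cnj z - cnj c * of_real b)"
    using sesquilinear_simps(1)[OF S u cv w] sesquilinear_simps(3)[OF S u u cv]
      sesquilinear_simps(4)[OF S u v v] symmetric_sesquilinearD(3)[OF S v w]
      sesquilinear_simps(3)[OF S v u cv] sesquilinear_simps(4)[OF S v v v]
    by (simp add: z_def[symmetric] zv b)
  also have "\<dots> = form_val H u u - of_real ((cmod z)\<^sup>2 / b)"
    using b by (simp add: c_def field_simps complex_norm_square[symmetric])
  finally have "0 \<le> Re (form_val H u u) - (cmod z)\<^sup>2 / b"
    using hilbert_spaceD(4)[OF H w] by (metis Re_complex_of_real minus_complex.simps(1))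
  then have "(cmod z)\<^sup>2 \<le> Re (form_val H u u) * b"
    using b by (simp add: field_simps)
  also have "\<dots> = (hnorm H u * hnorm H v)\<^sup>2"
    by (simp add: b_def power_mult_distrib hnorm_square(1)[OF H u] hnorm_square(1)[OF H v])
  finally have "(cmod z)\<^sup>2 \<le> (hnorm H u * hnorm H v)\<^sup>2" .
  then have "cmod z \<le> hnorm H u * hnorm H v"
    by (rule power2_le_imp_le) (intro mult_nonneg_nonneg hnorm_square(2)[OF H u] hnorm_square(2)[OF H v])
  then show ?thesis by (simp only: z_def)
qed

text \<open>
  A linear bijection that preserves the values of a form carries over Hilbert space structure, and
  with it the norm.  This is how completeness of the weighted spaces reaches the domains of the
  forms \<open>t\<^sub>\<alpha>\<close>.
\<close>
lemma hilbert_space_pullback: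
  assumes H: "hilbert_space H" and D: "csubspace D"
    and bij: "bij_betw U D (form_dom H)"
    and add: "\<And>u v. u \<in> D \<Longrightarrow> v \<in> D \<Longrightarrow> U (u + v) = U u + U v"
    and scale: "\<And>c u. u \<in> D \<Longrightarrow> U (c *\<^sub>C u) = c *\<^sub>C U u"
    and val: "\<And>u v. u \<in> D \<Longrightarrow> v \<in> D \<Longrightarrow> f u v = form_val H (U u) (U v)"
  shows "hilbert_space (Form D f)"
    and "\<And>u. u \<in> D \<Longrightarrow> hnorm (Form D f) u = hnorm H (U u)"
proof -
  note C = csubspaceD[OF D]
  have maps: "U u \<in> form_dom H" if "u \<in> D" for u
    using bij that by (auto simp: bij_betw_def)
  have U0: "U 0 = 0" using scale[OF C(1), of 0] by simp
  have diff: "U (u - v) = U u - U v" if "u \<in> D" "v \<in> D" for u v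
    using add[OF that(1) C(4)[OF that(2)]] scale[OF that(2), of "-1"] by simp
  show nrm: "hnorm (Form D f) u = hnorm H (U u)" if "u \<in> D" for u
    using that by (simp add: hnorm_def val)
  show "hilbert_space (Form D f)"
    unfolding hilbert_space_def
  proof (intro conjI ballI impI allI)
    show "symmetric_sesquilinear (Form D f)"
      by (rule symmetric_sesquilinear_pullback[where U = U, OF hilbert_spaceD(1)[OF H] D maps add scale val])
  next
    fix u assume u: "u \<in> form_dom (Form D f)" "u \<noteq> 0"
    then have "U u \<noteq> 0"
      using bij C(1) U0 by (auto simp: bij_betw_def inj_on_def)
    with u show "0 < Re (form_val (Form D f) u u)"
      using hilbert_spaceD(3)[OF H maps[of u]] by (simp add: val)
  next
    fix X :: "nat \<Rightarrow> _"
    assume X: "(\<forall>n. X n \<in> form_dom (Form D f)) \<and>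
      (\<forall>e>0. \<exists>N. \<forall>m\<ge>N. \<forall>n\<ge>N. hnorm (Form D f) (X m - X n) < e)"
    then have XD: "X n \<in> D" for n by simp
    have nX: "hnorm (Form D f) (X m - X n) = hnorm H (U (X m) - U (X n))" for m n
      by (simp add: nrm C(5) XD diff)
    obtain y where y: "y \<in> form_dom H" "(\<lambda>n. hnorm H (U (X n) - y)) \<longlonglongrightarrow> 0"
      by (rule hilbert_complete[OF H, of "\<lambda>n. U (X n)"]) (use X XD maps nX in auto)
    then obtain x where x: "x \<in> D" "y = U x"
      using bij by (auto simp: bij_betw_def)
    have "hnorm (Form D f) (X n - x) = hnorm H (U (X n) - y)" for n
      by (simp add: nrm C(5) XD x diff)
    with y have "(\<lambda>n. hnorm (Form D f) (X n - x)) \<longlonglongrightarrow> 0" by simp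
    with x show "\<exists>u\<in>form_dom (Form D f). (\<lambda>n. hnorm (Form D f) (X n - u)) \<longlonglongrightarrow> 0"
      by auto
  qed
qed

section \<open>Krein spaces from a fundamental symmetry\<close>

text \<open>
  A limit in \<open>G\<close> of a sequence in \<open>P\<close> may be replaced by its component in \<open>P\<close>: by
  orthogonality the distance does not increase.  Hence \<open>P\<close> is complete.
\<close>
lemma hilbert_space_orthogonal_summand:
  assumes G: "hilbert_space G" and P: "csubspace P" "P \<subseteq> form_dom G"
    and M: "csubspace M" "M \<subseteq> form_dom G"
    and split: "\<And>u. u \<in> form_dom G \<Longrightarrow> \<exists>p\<in>P. \<exists>m\<in>M. u = p + m"
    and orth: "\<And>p m. p \<in> P \<Longrightarrow> m \<in> M \<Longrightarrow> form_val G p m = 0"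
  shows "hilbert_space (Form P (form_val G))"
  unfolding hilbert_space_def
proof (intro conjI ballI impI allI)
  show "symmetric_sesquilinear (Form P (form_val G))"
    by (rule symmetric_sesquilinear_pullback[where U = "\<lambda>u. u", OF hilbert_spaceD(1)[OF G] P(1)])
      (use P(2) in auto)
next
  fix u assume "u \<in> form_dom (Form P (form_val G))" "u \<noteq> 0"
  then show "0 < Re (form_val (Form P (form_val G)) u u)"
    using hilbert_spaceD(3)[OF G, of u] P(2) by auto
next
  let ?N = "Form P (form_val G)"
  fix X :: "nat \<Rightarrow> _"
  assume X: "(\<forall>n. X n \<in> form_dom ?N) \<and>
    (\<forall>e>0. \<exists>N. \<forall>m\<ge>N. \<forall>n\<ge>N. hnorm ?N (X m - X n) < e)"
  then have XP: "X n \<in> P" for n by simp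
  have nP: "hnorm ?N p = hnorm G p" for p by (simp add: hnorm_def)
  obtain u where u: "u \<in> form_dom G" "(\<lambda>n. hnorm G (X n - u)) \<longlonglongrightarrow> 0"
    by (rule hilbert_complete[OF G, of X]) (use X P(2) XP nP in auto)
  obtain p m where pm: "p \<in> P" "m \<in> M" "u = p + m" using split[OF u(1)] by blast
  note S = hilbert_spaceD(1)[OF G]
  have "hnorm ?N (X n - p) \<le> hnorm G (X n - u)" for n
  proof -
    define q where "q = X n - p"
    have q: "q \<in> P" using csubspaceD(5)[OF P(1) XP pm(1)] by (simp add: q_def)
    have d: "q \<in> form_dom G" "m \<in> form_dom G" "q - m \<in> form_dom G"
      using q pm(2) P(2) M(2) csubspaceD(5)[OF hilbert_spaceD(2)[OF G]] by blast+
    have e: "X n - u = q - m" by (simp add: q_def pm(3) algebra_simps)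
    have z: "form_val G q m = 0" "form_val G m q = 0"
      using orth[OF q pm(2)] symmetric_sesquilinearD(4)[OF S d(1,2)] by simp_all
    have "form_val G (q - m) (q - m) = form_val G q q + form_val G m m"
      using sesquilinear_simps(1)[OF S d(1,2,3)] sesquilinear_simps(3)[OF S d(1,1,2)]
        sesquilinear_simps(3)[OF S d(2,1,2)] z by simp
    then have "Re (form_val G q q) \<le> Re (form_val G (q - m) (q - m))"
      using hilbert_spaceD(4)[OF G d(2)] by simp
    then show ?thesis by (simp add: nP e q_def[symmetric]) (simp add: hnorm_def)
  qed
  moreover have "0 \<le> hnorm ?N (X n - p)" for n
    using hnorm_square(2)[OF G] csubspaceD(5)[OF P(1) XP pm(1), of n] P(2) by (auto simp: nP)
  ultimately have "(\<lambda>n. hnorm ?N (X n - p)) \<longlonglongrightarrow> 0"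
    by (intro tendsto_sandwich[OF _ _ tendsto_const u(2)]) auto
  then show "\<exists>u\<in>form_dom ?N. (\<lambda>n. hnorm ?N (X n - u)) \<longlonglongrightarrow> 0"
    using pm(1) by auto
qed

text \<open>
  A linear involution \<open>J\<close> for which \<open>[J\<cdot>,\<cdot>]\<close> is a Hilbert space inner product is the fundamental
  symmetry of a Krein space: its eigenspaces for \<open>1\<close> and \<open>-1\<close> form the decomposition, where
  \<open>u = (u + Ju)/2 + (u - Ju)/2\<close>, and the topology is that of \<open>[J\<cdot>,\<cdot>]\<close>.  The symmetry of
  \<open>[J\<cdot>,\<cdot>]\<close> says that \<open>J\<close> is symmetric for \<open>[\<cdot>,\<cdot>]\<close>, which makes the eigenspaces orthogonal.
\<close>
lemma krein_of_symmetry: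
  assumes K: "symmetric_sesquilinear K"
    and maps: "\<And>u. u \<in> form_dom K \<Longrightarrow> J u \<in> form_dom K"
    and add: "\<And>u v. u \<in> form_dom K \<Longrightarrow> v \<in> form_dom K \<Longrightarrow> J (u + v) = J u + J v"
    and scale: "\<And>c u. u \<in> form_dom K \<Longrightarrow> J (c *\<^sub>C u) = c *\<^sub>C J u"
    and inv: "\<And>u. u \<in> form_dom K \<Longrightarrow> J (J u) = u"
    and G: "hilbert_space (Form (form_dom K) (\<lambda>u v. form_val K (J u) v))"
  defines "P \<equiv> {u \<in> form_dom K. J u = u}" and "M \<equiv> {u \<in> form_dom K. J u = - u}"
  shows "krein_decomposition K P M"
    and "\<And>u. u \<in> form_dom K \<Longrightarrow> krein_norm K P M u = hnorm (Form (form_dom K) (\<lambda>u v. form_val K (J u) v)) u"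
proof -
  let ?D = "form_dom K"
  let ?G = "Form ?D (\<lambda>u v. form_val K (J u) v)"
  note C = csubspaceD[OF symmetric_sesquilinearD(1)[OF K]]
  note KS = sesquilinear_simps[OF K] and KD = symmetric_sesquilinearD[OF K]
  have J0: "J 0 = 0" using scale[OF C(1), of 0] by simp
  have Jm: "J (- u) = - J u" if "u \<in> ?D" for u using scale[OF that, of "-1"] by simp
  have Jd: "J (u - v) = J u - J v" if "u \<in> ?D" "v \<in> ?D" for u v
    using add[OF that(1) C(4)[OF that(2)]] Jm[OF that(2)] by simp
  have Jsym: "form_val K (J u) v = form_val K u (J v)" if "u \<in> ?D" "v \<in> ?D" for u v
    using symmetric_sesquilinearD(4)[OF hilbert_spaceD(1)[OF G], of v u] KD(4)[OF maps[OF that(2)] that(1)] that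
    by simp
  have csP: "csubspace P"
    unfolding csubspace_def P_def using C J0 add scale by auto
  have csM: "csubspace M"
    unfolding csubspace_def M_def using C J0 add scale by (auto simp: scaleC_minus_right)
  have orth: "form_val K p m = 0" if "p \<in> P" "m \<in> M" for p m
  proof -
    have "form_val K p m = form_val K p (- m)"
      using Jsym[of p m] that by (auto simp: P_def M_def)
    also have "\<dots> = - form_val K p m" using KS(6)[of p m m] that by (auto simp: P_def M_def)
    finally show ?thesis by simp
  qed
  have orth': "form_val K m p = 0" if "p \<in> P" "m \<in> M" for p m
    using orth[OF that] KD(4)[of p m] that by (auto simp: P_def M_def)
  have inter: "P \<inter> M = {0}"
  proof -
    have "u = 0" if "u \<in> ?D" "J u = u" "J u = - u" for u
    proof (rule ccontr)
      assume "u \<noteq> 0"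
      moreover have "Re (form_val K u u) = - Re (form_val K u u)"
        using KS(5)[OF that(1,1,1)] that by (metis uminus_complex.sel(1))
      ultimately show False using hilbert_spaceD(3)[OF G, of u] that(1,2) by simp
    qed
    then show ?thesis using C(1) J0 by (auto simp: P_def M_def)
  qed
  have split: "(1/2) *\<^sub>C (u + J u) \<in> P" "(1/2) *\<^sub>C (u - J u) \<in> M"
    "u = (1/2) *\<^sub>C (u + J u) + (1/2) *\<^sub>C (u - J u)"
    "J u = (1/2) *\<^sub>C (u + J u) - (1/2) *\<^sub>C (u - J u)" if "u \<in> ?D" for u
  proof -
    note Ju = maps[OF that]
    show "(1/2) *\<^sub>C (u + J u) \<in> P"
      unfolding P_def using C(2)[OF that Ju] C(3) scale add[OF that Ju] inv[OF that] by (auto simp: add.commute)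
    have "J (u - J u) = - (u - J u)" using Jd[OF that Ju] inv[OF that] by simp
    then show "(1/2) *\<^sub>C (u - J u) \<in> M"
      unfolding M_def using C(5)[OF that Ju] C(3) scale[of "u - J u"] by (simp only: mem_Collect_eq scaleC_minus_right)
    have "(1/2) *\<^sub>C (u + J u) + (1/2) *\<^sub>C (u - J u) = (1/2) *\<^sub>C u + (1/2) *\<^sub>C u"
      by (simp only: scaleC_add_right scaleC_diff_right) simp
    then show "u = (1/2) *\<^sub>C (u + J u) + (1/2) *\<^sub>C (u - J u)" by (simp add: scaleC_half)
    have "(1/2) *\<^sub>C (u + J u) - (1/2) *\<^sub>C (u - J u) = (1/2) *\<^sub>C J u + (1/2) *\<^sub>C J u"
      by (simp only: scaleC_add_right scaleC_diff_right) simp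
    then show "J u = (1/2) *\<^sub>C (u + J u) - (1/2) *\<^sub>C (u - J u)" by (simp add: scaleC_half)
  qed
  have split': "\<exists>p\<in>P. \<exists>m\<in>M. u = p + m" "\<exists>m\<in>M. \<exists>p\<in>P. u = m + p" if "u \<in> form_dom ?G" for u
  proof -
    have u: "u \<in> ?D" using that by simp
    show "\<exists>p\<in>P. \<exists>m\<in>M. u = p + m" by (intro bexI[OF _ split(1)[OF u]] bexI[OF _ split(2)[OF u]] split(3)[OF u])
    show "\<exists>m\<in>M. \<exists>p\<in>P. u = m + p"
      by (intro bexI[OF _ split(1)[OF u]] bexI[OF _ split(2)[OF u]]) (subst add.commute, rule split(3)[OF u])
  qed
  have sub: "P \<subseteq> form_dom ?G" "M \<subseteq> form_dom ?G" by (auto simp: P_def M_def)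
  have oG: "form_val ?G p m = 0" "form_val ?G m p = 0" if "p \<in> P" "m \<in> M" for p m
  proof -
    have "J p = p" "J m = - m" "m \<in> ?D" "p \<in> ?D" using that by (auto simp: P_def M_def)
    then show "form_val ?G p m = 0" "form_val ?G m p = 0"
      using orth[OF that] orth'[OF that] KS(5)[of m p p] by simp_all
  qed
  have hP: "hilbert_space (Form P (form_val K))"
  proof (rule hilbert_space_pullback(1)[where U = "\<lambda>u. u", OF _ csP])
    show "hilbert_space (Form P (form_val ?G))"
      by (rule hilbert_space_orthogonal_summand[OF G csP sub(1) csM sub(2) split'(1) oG(1)])
  qed (simp_all add: P_def bij_betw_def inj_on_def)
  have hM: "hilbert_space (Form M (\<lambda>u v. - form_val K u v))"
  proof (rule hilbert_space_pullback(1)[where U = "\<lambda>u. u", OF _ csM])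
    show "hilbert_space (Form M (form_val ?G))"
      by (rule hilbert_space_orthogonal_summand[OF G csM sub(2) csP sub(1) split'(2) oG(2)])
    show "- form_val K u v = form_val (Form M (form_val ?G)) u v" if "u \<in> M" "v \<in> M" for u v
      using KS(5)[of u v v] that by (simp add: M_def)
  qed (simp_all add: bij_betw_def inj_on_def)
  show "krein_decomposition K P M"
    unfolding krein_decomposition_def
    using csP csM inter split'(1) orth hP hM sub by auto
  show "krein_norm K P M u = hnorm ?G u" if u: "u \<in> ?D" for u
  proof -
    have "fundamental_symmetry P M u = J u"
      unfolding fundamental_symmetry_def
    proof (rule the_equality)
      show "\<exists>p\<in>P. \<exists>m\<in>M. u = p + m \<and> J u = p - m"
        by (intro bexI[OF _ split(1)[OF u]] bexI[OF _ split(2)[OF u]] conjI split(3,4)[OF u])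
      show "w = J u" if "\<exists>p\<in>P. \<exists>m\<in>M. u = p + m \<and> w = p - m" for w
        using that add by (auto simp: P_def M_def)
    qed
    then show ?thesis by (simp add: krein_norm_def hnorm_def)
  qed
qed

section \<open>Self-adjoint operators\<close>

lemma linear_operatorD:
  assumes "linear_operator H T"
  shows "csubspace (op_dom T)" "u \<in> op_dom T \<Longrightarrow> u \<in> form_dom H" "u \<in> op_dom T \<Longrightarrow> op_app T u \<in> form_dom H"
    "u \<in> op_dom T \<Longrightarrow> v \<in> op_dom T \<Longrightarrow> op_app T (u + v) = op_app T u + op_app T v"
    "u \<in> op_dom T \<Longrightarrow> op_app T (c *\<^sub>C u) = c *\<^sub>C op_app T u"
    "u \<in> op_dom T \<Longrightarrow> v \<in> op_dom T \<Longrightarrow> op_app T (u - v) = op_app T u - op_app T v"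
proof -
  show L: "csubspace (op_dom T)" "\<And>u. u \<in> op_dom T \<Longrightarrow> u \<in> form_dom H"
    "\<And>u. u \<in> op_dom T \<Longrightarrow> op_app T u \<in> form_dom H"
    "\<And>u v. u \<in> op_dom T \<Longrightarrow> v \<in> op_dom T \<Longrightarrow> op_app T (u + v) = op_app T u + op_app T v"
    "\<And>c u. u \<in> op_dom T \<Longrightarrow> op_app T (c *\<^sub>C u) = c *\<^sub>C op_app T u"
    using assms unfolding linear_operator_def by blast+
  show "op_app T (u - v) = op_app T u - op_app T v" if "u \<in> op_dom T" "v \<in> op_dom T"
    using L(4)[OF that(1) csubspaceD(4)[OF L(1) that(2)]] L(5)[OF that(2), of "-1"] by simp
qed

lemma self_adjoint_linear: "self_adjoint H T \<Longrightarrow> linear_operator H T"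
  by (simp add: self_adjoint_def)

lemma self_adjoint_iff:
  assumes "self_adjoint H T" "v \<in> form_dom H" "w \<in> form_dom H"
  shows "(\<forall>u\<in>op_dom T. form_val H (op_app T u) v = form_val H u w) \<longleftrightarrow> v \<in> op_dom T \<and> w = op_app T v"
  using assms unfolding self_adjoint_def by blast

lemma self_adjoint_symmetric:
  assumes T: "self_adjoint H T" and u: "u \<in> op_dom T" and v: "v \<in> op_dom T"
  shows "form_val H (op_app T u) v = form_val H u (op_app T v)"
  using self_adjoint_iff[OF T linear_operatorD(2,3)[OF self_adjoint_linear[OF T] v]] u v by blast

text \<open>
  If \<open>S\<close> and \<open>T\<close> represent the same form, then \<open>(Tv,u) = (v,Su)\<close> for \<open>v\<close> in the domain of \<open>T\<close> and \<open>u\<close>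
  in that of \<open>S\<close>, so \<open>S\<close> is contained in the adjoint of \<open>T\<close>, which is \<open>T\<close>; the roles are symmetric.
\<close>
lemma represents_op_eq:
  assumes H: "symmetric_sesquilinear H" and s: "symmetric_sesquilinear s"
    and S: "represents H s S" and T: "represents H s T"
  shows "op_eq S T"
proof -
  have *: "u \<in> op_dom T \<and> op_app S u = op_app T u"
    if S: "represents H s S" and T: "represents H s T" and u: "u \<in> op_dom S" for S T u
  proof -
    have sa: "self_adjoint H S" "self_adjoint H T"
      and dom: "op_dom S \<subseteq> form_dom s" "op_dom T \<subseteq> form_dom s"
      and valS: "\<And>v. v \<in> form_dom s \<Longrightarrow> form_val s u v = form_val H (op_app S u) v"
      and valT: "\<And>v w. v \<in> op_dom T \<Longrightarrow> w \<in> form_dom s \<Longrightarrow> form_val s v w = form_val H (op_app T v) w"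
      using S T u unfolding represents_def by blast+
    note LS = linear_operatorD[OF self_adjoint_linear[OF sa(1)]]
    note LT = linear_operatorD[OF self_adjoint_linear[OF sa(2)]]
    have "form_val H (op_app T v) u = form_val H v (op_app S u)" if v: "v \<in> op_dom T" for v
    proof -
      have us: "u \<in> form_dom s" and vs: "v \<in> form_dom s" using u v dom by blast+
      have "form_val H (op_app T v) u = form_val s v u" using valT[OF v us] by simp
      also have "\<dots> = cnj (form_val s u v)" by (rule symmetric_sesquilinearD(4)[OF s us vs])
      also have "\<dots> = cnj (form_val H (op_app S u) v)" using valS[OF vs] by simp
      also have "\<dots> = form_val H v (op_app S u)"
        by (rule symmetric_sesquilinearD(4)[OF H LS(3)[OF u] LT(2)[OF v], symmetric])
      finally show ?thesis .
    qed
    then show ?thesis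
      using self_adjoint_iff[OF sa(2) LS(2,3)[OF u]] by blast
  qed
  show ?thesis
    unfolding op_eq_def using *[OF S T] *[OF T S] by blast
qed

lemma self_adjoint_closed:
  assumes H: "hilbert_space H" and B: "self_adjoint H B"
    and X: "\<And>n. X n \<in> op_dom B" and u: "u \<in> form_dom H"
    and lim: "(\<lambda>n. hnorm H (X n - u)) \<longlonglongrightarrow> 0"
    and Cauchy: "\<And>e. e > 0 \<Longrightarrow> \<exists>N::nat. \<forall>m\<ge>N. \<forall>n\<ge>N. hnorm H (op_app B (X m) - op_app B (X n)) < e"
  shows "u \<in> op_dom B"
proof -
  note L = linear_operatorD[OF self_adjoint_linear[OF B]]
  note S = hilbert_spaceD(1)[OF H] and C = csubspaceD[OF hilbert_spaceD(2)[OF H]]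
  obtain w where w: "w \<in> form_dom H" "(\<lambda>n. hnorm H (op_app B (X n) - w)) \<longlonglongrightarrow> 0"
    by (rule hilbert_complete[OF H, of "\<lambda>n. op_app B (X n)"]) (use L(3)[OF X] Cauchy in auto)
  have inner_lim: "(\<lambda>n. form_val H z (Y n)) \<longlonglongrightarrow> form_val H z y"
    if z: "z \<in> form_dom H" and Y: "\<And>n. Y n \<in> form_dom H" and y: "y \<in> form_dom H"
      and l: "(\<lambda>n. hnorm H (Y n - y)) \<longlonglongrightarrow> 0" for z y and Y :: "nat \<Rightarrow> 'a"
  proof -
    have "(\<lambda>n. hnorm H z * hnorm H (Y n - y)) \<longlonglongrightarrow> 0"
      using tendsto_mult[OF tendsto_const l, of "hnorm H z"] by simp
    then have "(\<lambda>n. form_val H z (Y n) - form_val H z y) \<longlonglongrightarrow> 0"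
    proof (rule Lim_null_comparison[rotated], intro always_eventually allI)
      fix n
      show "norm (form_val H z (Y n) - form_val H z y) \<le> hnorm H z * hnorm H (Y n - y)"
        using hilbert_Cauchy_Schwarz[OF H z C(5)[OF Y y]] sesquilinear_simps(3)[OF S z Y y] by simp
    qed
    then show ?thesis by (simp add: LIM_zero_iff)
  qed
  have "form_val H (op_app B z) u = form_val H z w" if z: "z \<in> op_dom B" for z
  proof (rule LIMSEQ_unique)
    show "(\<lambda>n. form_val H (op_app B z) (X n)) \<longlonglongrightarrow> form_val H (op_app B z) u"
      by (rule inner_lim[OF L(3)[OF z] L(2)[OF X] u lim])
    show "(\<lambda>n. form_val H (op_app B z) (X n)) \<longlonglongrightarrow> form_val H z w"
      using inner_lim[OF L(2)[OF z] L(3)[OF X] w] self_adjoint_symmetric[OF B z X] by simp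
  qed
  then show ?thesis using self_adjoint_iff[OF B u w(1)] by blast
qed

section \<open>Square roots of the absolute value\<close>

text \<open>
  The vectors in the domains of all powers of \<open>T\<close>.  On them \<open>|T|\<close> can be composed with itself and
  with powers of \<open>T\<close> without domain questions.
\<close>
definition smooth_vectors :: "'v operator \<Rightarrow> 'v set" where
  "smooth_vectors T = {u. \<forall>n. (op_app T ^^ n) u \<in> op_dom T}"

lemma smooth_vectorsD:
  assumes "u \<in> smooth_vectors T"
  shows "u \<in> op_dom T" "op_app T u \<in> smooth_vectors T"
proof -
  have "(op_app T ^^ n) u \<in> op_dom T" for n
    using assms by (simp add: smooth_vectors_def)
  from this[of 0] this[of "Suc _"] show "u \<in> op_dom T" "op_app T u \<in> smooth_vectors T"
    by (simp_all add: smooth_vectors_def funpow_Suc_right del: funpow.simps)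
qed

text \<open>
  From \<open>A\<^sup>2 = T\<^sup>2\<close> alone, \<open>A\<close> commutes with \<open>T\<^sup>2\<close>, since both \<open>A T\<^sup>2\<close> and \<open>T\<^sup>2 A\<close> are \<open>A\<^sup>3\<close>; therefore it
  leaves the smooth vectors invariant.  The norm identity is \<open>(A\<^sup>2 u, u) = (T\<^sup>2 u, u)\<close>.
\<close>
lemma abs_on_smooth_vectors:
  assumes H: "hilbert_space H" and T: "self_adjoint H T" and A: "abs_of_self_adjoint H T A"
    and u: "u \<in> smooth_vectors T"
  shows "u \<in> op_dom A" "op_app A u \<in> smooth_vectors T" "hnorm H (op_app A u) = hnorm H (op_app T u)"
proof -
  have sa: "self_adjoint H A" and sq: "op_eq (op_square A) (op_square T)"
    using A by (simp_all add: abs_of_self_adjoint_def nonneg_sqrt_def)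
  have sq_dom: "(x \<in> op_dom A \<and> op_app A x \<in> op_dom A) \<longleftrightarrow> (x \<in> op_dom T \<and> op_app T x \<in> op_dom T)" for x
    using sq unfolding op_eq_def op_square_def by auto
  have sq_app: "op_app A (op_app A x) = op_app T (op_app T x)"
    if "x \<in> op_dom T" "op_app T x \<in> op_dom T" for x
    using sq that unfolding op_eq_def op_square_def by auto
  have dom: "x \<in> op_dom A" "op_app A x \<in> op_dom A" "op_app A (op_app A x) = op_app T (op_app T x)"
    if "x \<in> smooth_vectors T" for x
    using sq_dom[of x] sq_app[of x] smooth_vectorsD(1)[OF that] smooth_vectorsD(1)[OF smooth_vectorsD(2)[OF that]]
    by auto
  have commute: "op_app A x \<in> op_dom T" "op_app T (op_app A x) \<in> op_dom T"
    "op_app T (op_app T (op_app A x)) = op_app A (op_app T (op_app T x))"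
    if x: "x \<in> smooth_vectors T" for x
  proof -
    have "op_app T (op_app T x) \<in> smooth_vectors T"
      by (intro smooth_vectorsD(2) x)
    then have "op_app A (op_app A x) \<in> op_dom A"
      using dom(1,3)[OF x] dom(1)[of "op_app T (op_app T x)"] by simp
    then show 1: "op_app A x \<in> op_dom T" "op_app T (op_app A x) \<in> op_dom T"
      using sq_dom[of "op_app A x"] dom(2)[OF x] by auto
    show "op_app T (op_app T (op_app A x)) = op_app A (op_app T (op_app T x))"
      using sq_app[OF 1] dom(3)[OF x] by simp
  qed
  show "u \<in> op_dom A" by (rule dom(1)[OF u])
  \<comment> \<open>\<open>A\<close> is only known to commute with \<open>T\<^sup>2\<close>, so the induction has to carry two consecutive powers.\<close>
  have powers: "(op_app T ^^ n) (op_app A x) \<in> op_dom T \<and> (op_app T ^^ Suc n) (op_app A x) \<in> op_dom T"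
    if "x \<in> smooth_vectors T" for n x
    using that
  proof (induction n arbitrary: x)
    case 0
    then show ?case using commute(1,2) by simp
  next
    case (Suc n)
    note IH = Suc.IH[OF smooth_vectorsD(2)[OF smooth_vectorsD(2)[OF Suc.prems]]]
    have "(op_app T ^^ Suc (Suc n)) (op_app A x) = (op_app T ^^ n) (op_app A (op_app T (op_app T x)))"
      using commute(3)[OF Suc.prems] by (simp add: funpow_Suc_right del: funpow.simps)
    then show ?case using IH Suc.IH[OF Suc.prems] by simp
  qed
  then show "op_app A u \<in> smooth_vectors T"
    using u by (simp add: smooth_vectors_def)
  have "form_val H (op_app A u) (op_app A u) = form_val H (op_app A (op_app A u)) u"
    using self_adjoint_symmetric[OF sa dom(2,1)[OF u]] by simp
  also have "\<dots> = form_val H (op_app T (op_app T u)) u" using dom(3)[OF u] by simp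
  also have "\<dots> = form_val H (op_app T u) (op_app T u)"
    by (rule self_adjoint_symmetric[OF T smooth_vectorsD(1)[OF smooth_vectorsD(2)[OF u]] smooth_vectorsD(1)[OF u]])
  finally show "hnorm H (op_app A u) = hnorm H (op_app T u)" by (simp add: hnorm_def)
qed

text \<open>
  The quotients of consecutive terms of a log-convex sequence increase.  Were the first one greater
  than \<open>1\<close>, the sequence would grow geometrically.
\<close>
lemma bounded_log_convex_decreasing:
  fixes a :: "nat \<Rightarrow> real"
  assumes nonneg: "\<And>n. 0 \<le> a n" and convex: "\<And>n. (a (Suc n))\<^sup>2 \<le> a n * a (Suc (Suc n))"
    and bounded: "\<And>n. a n \<le> C"
  shows "a (Suc 0) \<le> a 0"
proof (rule ccontr)
  assume "\<not> a (Suc 0) \<le> a 0"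
  then have lt: "a 0 < a (Suc 0)" by simp
  with nonneg[of 0] have "0 < (a (Suc 0))\<^sup>2" by simp
  with convex[of 0] have "a 0 \<noteq> 0" by auto
  with nonneg[of 0] have a0: "0 < a 0" by simp
  define q where "q = a (Suc 0) / a 0"
  have q: "1 < q" using lt a0 by (simp add: q_def)
  have ratio: "0 < a n \<and> q * a n \<le> a (Suc n)" for n
  proof (induction n)
    case 0
    then show ?case using a0 by (simp add: q_def)
  next
    case (Suc n)
    then have pos: "0 < a n" "0 < a (Suc n)" using q by (auto intro: less_le_trans[of 0 "q * a n"])
    have "q * a n * a (Suc n) \<le> a (Suc n) * a (Suc n)"
      using Suc pos by (intro mult_right_mono) auto
    also have "\<dots> \<le> a n * a (Suc (Suc n))" using convex[of n] by (simp add: power2_eq_square)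
    finally have "a n * (q * a (Suc n)) \<le> a n * a (Suc (Suc n))" by (simp add: mult_ac)
    with pos show ?case by simp
  qed
  have "q ^ n * a 0 \<le> a n" for n
  proof (induction n)
    case (Suc n)
    have "q ^ Suc n * a 0 \<le> q * a n" using Suc q by (simp add: mult_ac)
    with ratio[of n] show ?case by linarith
  qed simp
  moreover obtain n where "C / a 0 < q ^ n" using real_arch_pow[OF q] by blast
  ultimately show False using bounded[of n] a0 by (simp add: field_simps) (meson leD order_trans)
qed

text \<open>
  An inequality of Heinz type, for operators that need not commute.  Here \<open>R\<close> plays the role of an
  explicitly known square root of an operator \<open>R\<^sup>2\<close> with \<open>\<parallel>R\<^sup>2 u\<parallel> = \<parallel>T u\<parallel> = \<parallel>A u\<parallel>\<close>, where \<open>A = |T|\<close>; the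
  claim is \<open>(Au,u) \<le> \<parallel>R u\<parallel>\<^sup>2\<close>.  The operator \<open>K = R\<^sup>-\<^sup>1 A R\<^sup>-\<^sup>1\<close> is symmetric and satisfies
  \<open>\<parallel>R K v\<parallel> = \<parallel>R v\<parallel>\<close>.  So the norms \<open>\<parallel>K\<^sup>n v\<parallel>\<close> stay bounded in \<open>n\<close>, while
  \<open>\<parallel>K\<^sup>n\<^sup>+\<^sup>1 v\<parallel>\<^sup>2 = (K\<^sup>n v, K\<^sup>n\<^sup>+\<^sup>2 v)\<close> makes them log-convex; hence \<open>\<parallel>K v\<parallel> \<le> \<parallel>v\<parallel>\<close>, and \<open>v = R u\<close> gives
  the claim.
\<close>
lemma sqrt_abs_norm_le:
  assumes H: "hilbert_space H" and T: "self_adjoint H T"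
    and A: "abs_of_self_adjoint H T A" and B: "nonneg_sqrt H A B"
    and R: "\<And>u. u \<in> smooth_vectors T \<Longrightarrow> R u \<in> smooth_vectors T"
    and R': "\<And>u. u \<in> smooth_vectors T \<Longrightarrow> R' u \<in> smooth_vectors T"
    and RR': "\<And>u. u \<in> smooth_vectors T \<Longrightarrow> R (R' u) = u"
    and R'R: "\<And>u. u \<in> smooth_vectors T \<Longrightarrow> R' (R u) = u"
    and R_sym: "\<And>u v. u \<in> smooth_vectors T \<Longrightarrow> v \<in> smooth_vectors T \<Longrightarrow>
      form_val H (R u) v = form_val H u (R v)"
    and R_square: "\<And>u. u \<in> smooth_vectors T \<Longrightarrow> hnorm H (R (R u)) = hnorm H (op_app T u)"
    and R_below: "\<And>u. u \<in> smooth_vectors T \<Longrightarrow> hnorm H u \<le> c * hnorm H (R u)"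
    and u: "u \<in> smooth_vectors T"
  shows "u \<in> op_dom B" "hnorm H (op_app B u) \<le> hnorm H (R u)"
proof -
  let ?D = "smooth_vectors T"
  note abs = abs_on_smooth_vectors[OF H T A]
  note LT = linear_operatorD[OF self_adjoint_linear[OF T]]
  have saA: "self_adjoint H A" using A by (simp add: abs_of_self_adjoint_def nonneg_sqrt_def)
  have saB: "self_adjoint H B" and sq: "op_eq (op_square B) A" using B by (simp_all add: nonneg_sqrt_def)
  have DH: "x \<in> form_dom H" if "x \<in> ?D" for x by (rule LT(2)[OF smooth_vectorsD(1)[OF that]])
  \<comment> \<open>\<open>R'\<close> is the inverse of \<open>R\<close>, so this is \<open>R\<^sup>-\<^sup>1 A R\<^sup>-\<^sup>1\<close>.\<close>
  define K where "K x = R' (op_app A (R' x))" for x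
  have KD: "K x \<in> ?D" if "x \<in> ?D" for x
    unfolding K_def by (intro R' abs(2) that)
  have R'_sym: "form_val H (R' x) y = form_val H x (R' y)" if "x \<in> ?D" "y \<in> ?D" for x y
    using R_sym[OF R'[OF that(1)] R'[OF that(2)]] RR' that by simp
  have A_sym: "form_val H (op_app A x) y = form_val H x (op_app A y)" if "x \<in> ?D" "y \<in> ?D" for x y
    by (rule self_adjoint_symmetric[OF saA abs(1)[OF that(1)] abs(1)[OF that(2)]])
  have K_sym: "form_val H (K x) y = form_val H x (K y)" if "x \<in> ?D" "y \<in> ?D" for x y
    unfolding K_def using that R' abs(2) by (simp add: R'_sym A_sym)
  have RK: "hnorm H (R (K x)) = hnorm H (R x)" if "x \<in> ?D" for x
  proof -
    have "R (K x) = op_app A (R' x)" unfolding K_def by (intro RR' abs(2) R' that)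
    then have "hnorm H (R (K x)) = hnorm H (R (R (R' x)))"
      using abs(3)[OF R'[OF that]] R_square[OF R'[OF that]] by simp
    then show ?thesis using RR'[OF that] by simp
  qed
  define v where "v = R u"
  have v: "v \<in> ?D" unfolding v_def by (rule R[OF u])
  define V where "V n = (K ^^ n) v" for n
  have VD: "V n \<in> ?D" for n unfolding V_def by (induction n) (auto simp: v KD)
  have VS: "V (Suc n) = K (V n)" for n by (simp add: V_def)
  have RV: "hnorm H (R (V n)) = hnorm H (R v)" for n
    by (induction n) (simp add: V_def, simp add: VS RK VD)
  have c0: "hnorm H (V (Suc 0)) \<le> hnorm H (V 0)"
  proof (rule bounded_log_convex_decreasing[where a = "\<lambda>n. hnorm H (V n)"])
    show "0 \<le> hnorm H (V n)" for n by (rule hnorm_square(2)[OF H DH[OF VD]])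
    show "hnorm H (V n) \<le> c * hnorm H (R v)" for n using R_below[OF VD] RV by simp
    show "(hnorm H (V (Suc n)))\<^sup>2 \<le> hnorm H (V n) * hnorm H (V (Suc (Suc n)))" for n
    proof -
      have "(hnorm H (V (Suc n)))\<^sup>2 = Re (form_val H (V n) (V (Suc (Suc n))))"
        using hnorm_square(1)[OF H DH[OF VD], of "Suc n"] K_sym[OF VD[of n] VD[of "Suc n"]] by (simp add: VS)
      also have "\<dots> \<le> cmod (form_val H (V n) (V (Suc (Suc n))))" by (rule complex_Re_le_cmod)
      also have "\<dots> \<le> hnorm H (V n) * hnorm H (V (Suc (Suc n)))"
        by (rule hilbert_Cauchy_Schwarz[OF H DH[OF VD] DH[OF VD]])
      finally show ?thesis .
    qed
  qed
  have uB: "u \<in> op_dom B" "op_app B u \<in> op_dom B" "op_app B (op_app B u) = op_app A u"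
    using sq abs(1)[OF u] unfolding op_eq_def op_square_def by auto
  show "u \<in> op_dom B" by (rule uB(1))
  have Ru: "R' v = u" unfolding v_def by (rule R'R[OF u])
  have "(hnorm H (op_app B u))\<^sup>2 = Re (form_val H (op_app B u) (op_app B u))"
    by (rule hnorm_square(1)[OF H linear_operatorD(3)[OF self_adjoint_linear[OF saB] uB(1)]])
  also have "\<dots> = Re (form_val H (op_app A u) u)"
    using self_adjoint_symmetric[OF saB uB(2,1)] uB(3) by simp
  also have "\<dots> = Re (form_val H (K v) v)"
    using R'_sym[OF abs(2)[OF u] v] by (simp add: K_def Ru)
  also have "\<dots> \<le> cmod (form_val H (K v) v)" by (rule complex_Re_le_cmod)
  also have "\<dots> \<le> hnorm H (K v) * hnorm H v"
    by (rule hilbert_Cauchy_Schwarz[OF H DH[OF KD[OF v]] DH[OF v]])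
  also have "\<dots> \<le> hnorm H v * hnorm H v"
    using c0 hnorm_square(2)[OF H DH[OF v]] by (intro mult_right_mono) (simp_all add: V_def)
  finally have "(hnorm H (op_app B u))\<^sup>2 \<le> (hnorm H (R u))\<^sup>2"
    by (simp add: v_def power2_eq_square)
  then show "hnorm H (op_app B u) \<le> hnorm H (R u)"
    by (rule power2_le_imp_le) (rule hnorm_square(2)[OF H DH[OF R[OF u]]])
qed

section \<open>Weighted spaces of square integrable functions\<close>

abbreviation lmeas :: "(real \<Rightarrow> 'b::topological_space) \<Rightarrow> bool" where
  "lmeas f \<equiv> f \<in> borel_measurable lebesgue"

lemma borel_measurable_cnj [measurable (raw)]:
  assumes "f \<in> borel_measurable M"
  shows "(\<lambda>x. cnj (f x)) \<in> borel_measurable M"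
  using measurable_compose[OF assms borel_measurable_continuous_onI[of cnj]]
  by (simp add: continuous_on_cnj)

lemma borel_measurable_complex_of_real [measurable (raw)]:
  assumes "f \<in> borel_measurable M"
  shows "(\<lambda>x. complex_of_real (f x)) \<in> borel_measurable M"
  using measurable_compose[OF assms borel_measurable_of_real] .

lemma ae_equal_refl_iff: "ae_equal f f \<longleftrightarrow> lmeas f"
  by (simp add: ae_equal_def)

lemma fclass_cases:
  obtains f where "lmeas f" "F = fclass_of f"
  using Quotient_abs_rep[OF Quotient_fclass, of F] Quotient_rep_reflp[OF Quotient_fclass, of F]
  by (metis ae_equal_refl_iff)

lemma fclass_of_eq_iff:
  assumes "lmeas f" "lmeas g"
  shows "fclass_of f = fclass_of g \<longleftrightarrow> (AE x in lebesgue. f x = g x)"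
  using Quotient_rel[OF Quotient_fclass, of f g] assms by (auto simp: ae_equal_def)

text \<open>
  Multiplication by a function that is not measurable is not a map of classes; the value \<open>0\<close> makes
  the operation total.
\<close>
lift_definition mult_by :: "(real \<Rightarrow> real) \<Rightarrow> fclass \<Rightarrow> fclass" is
  "\<lambda>m f x. if m \<in> borel_measurable lebesgue then complex_of_real (m x) * f x else 0"
proof -
  fix m :: "real \<Rightarrow> real" and f g :: "real \<Rightarrow> complex"
  assume fg: "ae_equal f g"
  show "ae_equal (\<lambda>x. if lmeas m then complex_of_real (m x) * f x else 0)
      (\<lambda>x. if lmeas m then complex_of_real (m x) * g x else 0)"
  proof (rule ae_equal_pointwise[OF fg])
    fix h :: "real \<Rightarrow> complex"
    assume "lmeas h"
    then show "lmeas (\<lambda>x. if lmeas m then complex_of_real (m x) * h x else 0)"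
      by (cases "lmeas m") simp_all
  qed
qed

lift_definition reflect :: "fclass \<Rightarrow> fclass" is "\<lambda>f x. f (- x)"
  by (rule ae_equal_reflect)

lemma fclass_of_ops:
  assumes "lmeas f" "lmeas g"
  shows "fclass_of f + fclass_of g = fclass_of (\<lambda>x. f x + g x)"
    "fclass_of f - fclass_of g = fclass_of (\<lambda>x. f x - g x)"
  using assms by (simp_all add: plus_fclass.abs_eq minus_fclass.abs_eq ae_equal_refl_iff)

lemma fclass_of_maps:
  assumes "lmeas f"
  shows "c *\<^sub>C fclass_of f = fclass_of (\<lambda>x. c * f x)"
    "reflect (fclass_of f) = fclass_of (\<lambda>x. f (- x))"
    "lmeas m \<Longrightarrow> mult_by m (fclass_of f) = fclass_of (\<lambda>x. complex_of_real (m x) * f x)"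
    "mult_x (fclass_of f) = fclass_of (\<lambda>x. complex_of_real x * f x)"
    "even_part (fclass_of f) = fclass_of (\<lambda>x. (f x + f (- x)) / 2)"
    "odd_part (fclass_of f) = fclass_of (\<lambda>x. (f x - f (- x)) / 2)"
  using assms by (simp_all add: scaleC_fclass.abs_eq reflect.abs_eq mult_by.abs_eq mult_x.abs_eq
      even_part.abs_eq odd_part.abs_eq ae_equal_refl_iff)

lemma zero_fclass_eq: "(0 :: fclass) = fclass_of (\<lambda>x. 0)"
  by (simp add: zero_fclass_def)

lemma mem_L2w_iff:
  assumes "lmeas f"
  shows "fclass_of f \<in> L2w w \<longleftrightarrow> integrable lebesgue (\<lambda>x. (cmod (f x))\<^sup>2 * \<bar>w x\<bar>) \<and>
    (AE x in lebesgue. w x = 0 \<longrightarrow> f x = 0)"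
  using assms by (simp add: L2w_def in_L2w.abs_eq ae_equal_refl_iff)

lemma wprod_on_of:
  assumes "lmeas f" "lmeas g"
  shows "wprod_on A w (fclass_of f) (fclass_of g) =
    (LINT x:A|lebesgue. f x * cnj (g x) * complex_of_real (w x))"
  using assms by (simp add: wprod_on.abs_eq ae_equal_refl_iff)

lemma wprod_of:
  assumes "lmeas f" "lmeas g"
  shows "wprod w (fclass_of f) (fclass_of g) = (LINT x|lebesgue. f x * cnj (g x) * complex_of_real (w x))"
  using assms by (simp add: wprod_on_of set_lebesgue_integral_def)

definition sqnorm :: "(real \<Rightarrow> real) \<Rightarrow> fclass \<Rightarrow> real" where
  "sqnorm w F = Re (wprod (\<lambda>x. \<bar>w x\<bar>) F F)"

lemma sqnorm_of:
  assumes "lmeas f"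
  shows "sqnorm w (fclass_of f) = (LINT x|lebesgue. (cmod (f x))\<^sup>2 * \<bar>w x\<bar>)"
proof -
  have "f x * cnj (f x) * complex_of_real \<bar>w x\<bar> = complex_of_real ((cmod (f x))\<^sup>2 * \<bar>w x\<bar>)" for x
    by (simp only: of_real_mult complex_norm_square)
  then show ?thesis
    by (simp add: sqnorm_def wprod_of assms del: of_real_mult)
qed

lemma sqnorm_nonneg: "0 \<le> sqnorm w F"
  by (cases F rule: fclass_cases) (simp add: sqnorm_of)

text \<open>
  The comparison of densities behind the estimates for multiplication operators and for changes of
  the weight.
\<close>
lemma L2w_dominated:
  assumes f: "lmeas f" and g: "lmeas g" and w': "lmeas w'"
    and F: "fclass_of f \<in> L2w w"
    and le: "AE x in lebesgue. (cmod (g x))\<^sup>2 * \<bar>w' x\<bar> \<le> C * ((cmod (f x))\<^sup>2 * \<bar>w x\<bar>)"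
    and zero: "AE x in lebesgue. w' x = 0 \<longrightarrow> g x = 0"
  shows "fclass_of g \<in> L2w w'" "sqnorm w' (fclass_of g) \<le> C * sqnorm w (fclass_of f)"
proof -
  have i: "integrable lebesgue (\<lambda>x. C * ((cmod (f x))\<^sup>2 * \<bar>w x\<bar>))"
    using F f by (simp add: mem_L2w_iff)
  have j: "integrable lebesgue (\<lambda>x. (cmod (g x))\<^sup>2 * \<bar>w' x\<bar>)"
  proof (rule Bochner_Integration.integrable_bound[OF i])
    show "lmeas (\<lambda>x. (cmod (g x))\<^sup>2 * \<bar>w' x\<bar>)" using g w' by measurable
    show "AE x in lebesgue. norm ((cmod (g x))\<^sup>2 * \<bar>w' x\<bar>) \<le> norm (C * ((cmod (f x))\<^sup>2 * \<bar>w x\<bar>))"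
      using le by eventually_elim (auto intro: order_trans[OF _ abs_ge_self])
  qed
  with zero show "fclass_of g \<in> L2w w'" by (simp add: mem_L2w_iff g)
  have "(LINT x|lebesgue. (cmod (g x))\<^sup>2 * \<bar>w' x\<bar>) \<le> (LINT x|lebesgue. C * ((cmod (f x))\<^sup>2 * \<bar>w x\<bar>))"
    by (rule integral_mono_AE[OF j i le])
  then show "sqnorm w' (fclass_of g) \<le> C * sqnorm w (fclass_of f)" by (simp add: sqnorm_of f g)
qed

lemma mult_by_L2w:
  assumes m: "lmeas m" and w': "lmeas w'" and F: "F \<in> L2w w"
    and le: "AE x in lebesgue. (m x)\<^sup>2 * \<bar>w' x\<bar> \<le> C * \<bar>w x\<bar>"
    and zero: "AE x in lebesgue. w' x = 0 \<longrightarrow> w x = 0 \<or> m x = 0"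
  shows "mult_by m F \<in> L2w w'" "sqnorm w' (mult_by m F) \<le> C * sqnorm w F"
proof -
  obtain f where f: "lmeas f" "F = fclass_of f" by (rule fclass_cases)
  have g: "lmeas (\<lambda>x. complex_of_real (m x) * f x)" using m f(1) by measurable
  have fz: "AE x in lebesgue. w x = 0 \<longrightarrow> f x = 0" using F f by (simp add: mem_L2w_iff)
  have le': "AE x in lebesgue. (cmod (complex_of_real (m x) * f x))\<^sup>2 * \<bar>w' x\<bar> \<le> C * ((cmod (f x))\<^sup>2 * \<bar>w x\<bar>)"
    using le
  proof eventually_elim
    case (elim x)
    then have "(cmod (f x))\<^sup>2 * ((m x)\<^sup>2 * \<bar>w' x\<bar>) \<le> (cmod (f x))\<^sup>2 * (C * \<bar>w x\<bar>)"
      by (intro mult_left_mono) auto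
    then show ?case by (simp add: norm_mult power_mult_distrib mult_ac)
  qed
  have zero': "AE x in lebesgue. w' x = 0 \<longrightarrow> complex_of_real (m x) * f x = 0"
    using zero fz by eventually_elim auto
  note * = L2w_dominated[OF f(1) g w' F[unfolded f(2)] le' zero']
  show "mult_by m F \<in> L2w w'" "sqnorm w' (mult_by m F) \<le> C * sqnorm w F"
    using * by (simp_all add: f fclass_of_maps m)
qed

lemma add_L2w:
  assumes w: "lmeas w" and F: "F \<in> L2w w" and G: "G \<in> L2w w"
  shows "F + G \<in> L2w w" "sqnorm w (F + G) \<le> 2 * sqnorm w F + 2 * sqnorm w G"
proof -
  obtain f where f: "lmeas f" "F = fclass_of f" by (rule fclass_cases)
  obtain g where g: "lmeas g" "G = fclass_of g" by (rule fclass_cases)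
  have fg: "lmeas (\<lambda>x. f x + g x)" using f g by measurable
  have le: "(cmod (f x + g x))\<^sup>2 * \<bar>w x\<bar> \<le> 2 * ((cmod (f x))\<^sup>2 * \<bar>w x\<bar>) + 2 * ((cmod (g x))\<^sup>2 * \<bar>w x\<bar>)" for x
  proof -
    have "(cmod (f x + g x))\<^sup>2 \<le> (cmod (f x) + cmod (g x))\<^sup>2"
      by (intro power_mono norm_triangle_ineq) simp
    also have "\<dots> \<le> 2 * (cmod (f x))\<^sup>2 + 2 * (cmod (g x))\<^sup>2"
      using sum_squares_bound[of "cmod (f x)" "cmod (g x)"] by (simp add: power2_sum)
    finally have "(cmod (f x + g x))\<^sup>2 * \<bar>w x\<bar> \<le> (2 * (cmod (f x))\<^sup>2 + 2 * (cmod (g x))\<^sup>2) * \<bar>w x\<bar>"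
      by (rule mult_right_mono) simp
    then show ?thesis by (simp add: algebra_simps)
  qed
  have iF: "integrable lebesgue (\<lambda>x. (cmod (f x))\<^sup>2 * \<bar>w x\<bar>)" "AE x in lebesgue. w x = 0 \<longrightarrow> f x = 0"
    and iG: "integrable lebesgue (\<lambda>x. (cmod (g x))\<^sup>2 * \<bar>w x\<bar>)" "AE x in lebesgue. w x = 0 \<longrightarrow> g x = 0"
    using F G f g by (simp_all add: mem_L2w_iff)
  have i: "integrable lebesgue (\<lambda>x. 2 * ((cmod (f x))\<^sup>2 * \<bar>w x\<bar>) + 2 * ((cmod (g x))\<^sup>2 * \<bar>w x\<bar>))"
    using iF iG by simp
  have j: "integrable lebesgue (\<lambda>x. (cmod (f x + g x))\<^sup>2 * \<bar>w x\<bar>)"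
  proof (rule Bochner_Integration.integrable_bound[OF i])
    show "lmeas (\<lambda>x. (cmod (f x + g x))\<^sup>2 * \<bar>w x\<bar>)" using fg w by measurable
  qed (use le in auto)
  have "AE x in lebesgue. w x = 0 \<longrightarrow> f x + g x = 0" using iF(2) iG(2) by eventually_elim auto
  with j show "F + G \<in> L2w w" by (simp add: f g fclass_of_ops mem_L2w_iff fg)
  have "(LINT x|lebesgue. (cmod (f x + g x))\<^sup>2 * \<bar>w x\<bar>) \<le>
      (LINT x|lebesgue. 2 * ((cmod (f x))\<^sup>2 * \<bar>w x\<bar>) + 2 * ((cmod (g x))\<^sup>2 * \<bar>w x\<bar>))"
    by (rule integral_mono[OF j i le])
  then show "sqnorm w (F + G) \<le> 2 * sqnorm w F + 2 * sqnorm w G"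
    using iF iG by (simp add: f g fclass_of_ops sqnorm_of fg)
qed

lemma scaleC_L2w:
  assumes "F \<in> L2w w"
  shows "c *\<^sub>C F \<in> L2w w" "sqnorm w (c *\<^sub>C F) = (cmod c)\<^sup>2 * sqnorm w F"
proof -
  obtain f where f: "lmeas f" "F = fclass_of f" by (rule fclass_cases)
  have cf: "lmeas (\<lambda>x. c * f x)" using f by measurable
  have i: "integrable lebesgue (\<lambda>x. (cmod (f x))\<^sup>2 * \<bar>w x\<bar>)" "AE x in lebesgue. w x = 0 \<longrightarrow> f x = 0"
    using assms f by (simp_all add: mem_L2w_iff)
  have e: "(cmod (c * f x))\<^sup>2 * \<bar>w x\<bar> = (cmod c)\<^sup>2 * ((cmod (f x))\<^sup>2 * \<bar>w x\<bar>)" for x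
    by (simp add: norm_mult power_mult_distrib)
  have z: "AE x in lebesgue. w x = 0 \<longrightarrow> c * f x = 0" using i(2) by eventually_elim auto
  show "c *\<^sub>C F \<in> L2w w"
    unfolding f(2) fclass_of_maps(1)[OF f(1)] mem_L2w_iff[OF cf] e using i(1) z by simp
  show "sqnorm w (c *\<^sub>C F) = (cmod c)\<^sup>2 * sqnorm w F"
    unfolding f(2) fclass_of_maps(1)[OF f(1)] sqnorm_of[OF cf] sqnorm_of[OF f(1)] e by simp
qed

lemma csubspace_L2w:
  assumes "lmeas w"
  shows "csubspace (L2w w)"
  unfolding csubspace_def
  using add_L2w(1)[OF assms] scaleC_L2w(1) by (auto simp: zero_fclass_eq mem_L2w_iff)

lemma integrable_wprod:
  assumes w: "lmeas w" and f: "lmeas f" "fclass_of f \<in> L2w w" and g: "lmeas g" "fclass_of g \<in> L2w w"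
  shows "integrable lebesgue (\<lambda>x. f x * cnj (g x) * complex_of_real (w x))"
proof (rule Bochner_Integration.integrable_bound)
  show "integrable lebesgue (\<lambda>x. (cmod (f x))\<^sup>2 * \<bar>w x\<bar> + (cmod (g x))\<^sup>2 * \<bar>w x\<bar>)"
    using f g by (simp add: mem_L2w_iff)
  show "lmeas (\<lambda>x. f x * cnj (g x) * complex_of_real (w x))" using w f(1) g(1) by measurable
  show "AE x in lebesgue. norm (f x * cnj (g x) * complex_of_real (w x)) \<le>
      norm ((cmod (f x))\<^sup>2 * \<bar>w x\<bar> + (cmod (g x))\<^sup>2 * \<bar>w x\<bar>)"
  proof (intro AE_I2)
    fix x
    have "2 * (cmod (f x) * cmod (g x)) \<le> (cmod (f x))\<^sup>2 + (cmod (g x))\<^sup>2"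
      using sum_squares_bound[of "cmod (f x)" "cmod (g x)"] by simp
    moreover have "0 \<le> cmod (f x) * cmod (g x)" by simp
    ultimately have "cmod (f x) * cmod (g x) \<le> (cmod (f x))\<^sup>2 + (cmod (g x))\<^sup>2" by linarith
    then have "cmod (f x) * cmod (g x) * \<bar>w x\<bar> \<le> ((cmod (f x))\<^sup>2 + (cmod (g x))\<^sup>2) * \<bar>w x\<bar>"
      by (rule mult_right_mono) simp
    then show "norm (f x * cnj (g x) * complex_of_real (w x)) \<le>
      norm ((cmod (f x))\<^sup>2 * \<bar>w x\<bar> + (cmod (g x))\<^sup>2 * \<bar>w x\<bar>)"
      by (simp add: norm_mult algebra_simps)
  qed
qed

lemma symmetric_sesquilinear_wprod:
  assumes w: "lmeas w"
  shows "symmetric_sesquilinear (Form (L2w w) (wprod w))"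
  unfolding symmetric_sesquilinear_def form.sel
proof (intro conjI ballI allI)
  show "csubspace (L2w w)" by (rule csubspace_L2w[OF w])
next
  fix F G K assume *: "F \<in> L2w w" "G \<in> L2w w" "K \<in> L2w w"
  obtain f where f: "lmeas f" "F = fclass_of f" by (rule fclass_cases)
  obtain g where g: "lmeas g" "G = fclass_of g" by (rule fclass_cases)
  obtain k where k: "lmeas k" "K = fclass_of k" by (rule fclass_cases)
  have fg: "lmeas (\<lambda>x. f x + g x)" using f g by measurable
  note i = integrable_wprod[OF w f(1) _ k(1)] integrable_wprod[OF w g(1) _ k(1)]
  show "wprod w (F + G) K = wprod w F K + wprod w G K"
    using i * by (simp add: f g k fclass_of_ops wprod_of fg distrib_right)
next
  fix c F G assume *: "F \<in> L2w w" "G \<in> L2w w"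
  obtain f where f: "lmeas f" "F = fclass_of f" by (rule fclass_cases)
  obtain g where g: "lmeas g" "G = fclass_of g" by (rule fclass_cases)
  have cf: "lmeas (\<lambda>x. c * f x)" using f by measurable
  show "wprod w (c *\<^sub>C F) G = c * wprod w F G"
    unfolding f(2) g(2) fclass_of_maps(1)[OF f(1)] wprod_of[OF cf g(1)] wprod_of[OF f(1) g(1)]
    by (simp add: mult.assoc)
next
  fix F G assume *: "F \<in> L2w w" "G \<in> L2w w"
  obtain f where f: "lmeas f" "F = fclass_of f" by (rule fclass_cases)
  obtain g where g: "lmeas g" "G = fclass_of g" by (rule fclass_cases)
  have "(\<lambda>x. g x * cnj (f x) * complex_of_real (w x)) = (\<lambda>x. cnj (f x * cnj (g x) * complex_of_real (w x)))"
    by (simp add: fun_eq_iff mult_ac)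
  then show "wprod w G F = cnj (wprod w F G)"
    unfolding f(2) g(2) wprod_of[OF g(1) f(1)] wprod_of[OF f(1) g(1)] by (simp only: Bochner_Integration.integral_cnj)
qed


section \<open>Completeness\<close>

text \<open>
  The argument of Riesz and Fischer.  Along a subsequence with
  \<open>\<integral> |x\<^sub>k\<^sub>+\<^sub>1 - x\<^sub>k|\<^sup>2 |w| \<le> 4\<^sup>-\<^sup>k\<close> the series of the functions \<open>2\<^sup>k |x\<^sub>k\<^sub>+\<^sub>1 - x\<^sub>k|\<^sup>2 |w|\<close> has a finite integral, so
  almost everywhere its terms are bounded and the increments are \<open>O(2\<^sup>-\<^sup>k\<^sup>/\<^sup>2)\<close>.  Fatou's
  lemma then yields convergence to the pointwise limit in the weighted norm.
\<close>
lemma L2w_complete: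
  fixes x :: "nat \<Rightarrow> real \<Rightarrow> complex"
  assumes w: "lmeas w" and x: "\<And>n. lmeas (x n)" "\<And>n. fclass_of (x n) \<in> L2w w"
    and Cauchy: "\<And>e. e > 0 \<Longrightarrow>
      \<exists>N. \<forall>m\<ge>N. \<forall>n\<ge>N. (LINT t|lebesgue. (cmod (x m t - x n t))\<^sup>2 * \<bar>w t\<bar>) < e"
  obtains y where "lmeas y" "fclass_of y \<in> L2w w"
    "(\<lambda>n. LINT t|lebesgue. (cmod (x n t - y t))\<^sup>2 * \<bar>w t\<bar>) \<longlonglongrightarrow> 0"
proof -
  note [measurable] = w x(1)
  define D where "D m n t = (cmod (x m t - x n t))\<^sup>2 * \<bar>w t\<bar>" for m n t
  have D_int: "integrable lebesgue (D m n)" for m n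
  proof -
    have "fclass_of (x m) - fclass_of (x n) \<in> L2w w"
      by (rule csubspaceD(5)[OF csubspace_L2w[OF w] x(2) x(2)])
    then show ?thesis
      by (simp add: D_def[abs_def] fclass_of_ops x mem_L2w_iff)
  qed
  have D_nonneg: "0 \<le> D m n t" for m n t by (simp add: D_def)
  have D_nn: "(\<integral>\<^sup>+ t. ennreal (D m n t) \<partial>lebesgue) = ennreal (LINT t|lebesgue. D m n t)" for m n
    by (rule nn_integral_eq_integral[OF D_int]) (simp add: D_nonneg)
  have "\<exists>N. \<forall>m\<ge>N. \<forall>n\<ge>N. (LINT t|lebesgue. D m n t) < (1/4) ^ k" for k
    unfolding D_def by (rule Cauchy) simp
  then obtain N where N: "\<And>k m n. m \<ge> N k \<Longrightarrow> n \<ge> N k \<Longrightarrow> (LINT t|lebesgue. D m n t) < (1/4) ^ k"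
    by metis
  \<comment> \<open>The sum makes \<open>s\<close> monotone and at least \<open>N\<close>; the summand \<open>k\<close> forces it to infinity.\<close>
  define s where "s k = (\<Sum>i\<le>k. N i) + k" for k
  have s: "N k \<le> s k" "s k \<le> s (Suc k)" "k \<le> s k" for k
  proof -
    have "N k \<le> (\<Sum>i\<le>k. N i)" by (rule member_le_sum) auto
    then show "N k \<le> s k" by (simp add: s_def)
  qed (simp_all add: s_def)
  have Dk: "(LINT t|lebesgue. D (s (Suc k)) (s k) t) \<le> (1/4) ^ k" for k
    using N[OF order_trans[OF s(1,2)] s(1)] by (rule less_imp_le)
  define E where "E k t = 2 ^ k * D (s (Suc k)) (s k) t" for k t
  have E_meas [measurable]: "lmeas (E k)" for k unfolding E_def[abs_def] D_def by measurable
  have E_nn: "(\<integral>\<^sup>+ t. ennreal (E k t) \<partial>lebesgue) \<le> ennreal ((1/2) ^ k)" for k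
  proof -
    have "(\<integral>\<^sup>+ t. ennreal (E k t) \<partial>lebesgue) = ennreal (LINT t|lebesgue. E k t)"
      unfolding E_def by (rule nn_integral_eq_integral) (simp_all add: D_int D_nonneg)
    also have "(LINT t|lebesgue. E k t) = 2 ^ k * (LINT t|lebesgue. D (s (Suc k)) (s k) t)"
      unfolding E_def by simp
    also have "\<dots> \<le> 2 ^ k * (1/4) ^ k" by (intro mult_left_mono Dk) simp
    also have "\<dots> = (1/2) ^ k" by (simp add: power_mult_distrib[symmetric])
    finally show ?thesis by (simp add: ennreal_leI)
  qed
  have "(\<integral>\<^sup>+ t. (\<Sum>k. ennreal (E k t)) \<partial>lebesgue) = (\<Sum>k. \<integral>\<^sup>+ t. ennreal (E k t) \<partial>lebesgue)"
    by (rule nn_integral_suminf) measurable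
  also have "\<dots> \<le> (\<Sum>k. ennreal ((1/2) ^ k))"
    by (intro suminf_le E_nn) auto
  also have "\<dots> = ennreal (\<Sum>k. (1/2) ^ k)"
    by (rule suminf_ennreal2) (auto intro: summable_geometric)
  finally have "(\<integral>\<^sup>+ t. (\<Sum>k. ennreal (E k t)) \<partial>lebesgue) \<noteq> \<infinity>"
    by (auto simp: top_unique)
  then have "AE t in lebesgue. (\<Sum>k. ennreal (E k t)) \<noteq> \<infinity>"
    by (intro nn_integral_PInf_AE) measurable
  then have conv: "AE t in lebesgue. w t \<noteq> 0 \<longrightarrow> convergent (\<lambda>k. x (s k) t)"
  proof eventually_elim
    case (elim t)
    show ?case
    proof
      assume wt: "w t \<noteq> 0"
      have "summable (\<lambda>k. E k t)"
        using elim by (intro summable_suminf_not_top) (auto simp: E_def D_nonneg)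
      then have "Bseq (\<lambda>k. E k t)" by (intro convergent_imp_Bseq) (auto dest: summable_LIMSEQ_zero simp: convergent_def)
      then obtain B where B: "\<And>k. \<bar>E k t\<bar> \<le> B" "B > 0" by (auto simp: Bseq_def)
      have "norm (x (s (Suc k)) t - x (s k) t) \<le> sqrt (B / \<bar>w t\<bar>) * (1 / sqrt 2) ^ k" for k
      proof -
        have "2 ^ k * ((cmod (x (s (Suc k)) t - x (s k) t))\<^sup>2 * \<bar>w t\<bar>) \<le> B"
          using B(1)[of k] by (simp add: E_def D_def)
        then have "(cmod (x (s (Suc k)) t - x (s k) t))\<^sup>2 \<le> B / \<bar>w t\<bar> * (1 / 2 ^ k)"
          using wt by (simp add: field_simps)
        then have "sqrt ((cmod (x (s (Suc k)) t - x (s k) t))\<^sup>2) \<le> sqrt (B / \<bar>w t\<bar> * (1 / 2 ^ k))"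
          by (rule real_sqrt_le_mono)
        also have "\<dots> = sqrt (B / \<bar>w t\<bar>) * (1 / sqrt 2) ^ k"
          by (simp only: real_sqrt_mult real_sqrt_divide real_sqrt_power real_sqrt_one power_one_over)
        finally show ?thesis by simp
      qed
      moreover have "summable (\<lambda>k. sqrt (B / \<bar>w t\<bar>) * (1 / sqrt 2) ^ k)"
        by (intro summable_mult summable_geometric) simp
      ultimately have "summable (\<lambda>k. x (s (Suc k)) t - x (s k) t)"
        by (rule summable_comparison_test'[rotated, where N = 0])
      then have "convergent (\<lambda>n. x (s 0) t + (\<Sum>k<n. x (s (Suc k)) t - x (s k) t))"
        by (intro convergent_add convergent_const) (simp add: summable_iff_convergent)
      then show "convergent (\<lambda>k. x (s k) t)"
        by (simp add: sum_lessThan_telescope[of "\<lambda>k. x (s k) t"])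
    qed
  qed
  \<comment> \<open>Where \<open>w\<close> vanishes nothing is known about convergence, and the limit must be \<open>0\<close> there.\<close>
  define z where "z k t = (if w t = 0 then 0 else x (s k) t)" for k t
  have z_meas [measurable]: "lmeas (z k)" for k unfolding z_def[abs_def] by measurable
  define y where "y t = lim (\<lambda>k. z k t)" for t
  have y_meas [measurable]: "lmeas y" unfolding y_def[abs_def] by measurable
  have y0: "y t = 0" if "w t = 0" for t using that by (simp add: y_def z_def)
  have y_lim: "AE t in lebesgue. (\<lambda>k. z k t) \<longlonglongrightarrow> y t"
    using conv
  proof eventually_elim
    case (elim t)
    then show ?case
      by (cases "w t = 0") (simp_all add: y_def z_def convergent_LIMSEQ_iff)
  qed
  have bound: "(\<integral>\<^sup>+ t. ennreal ((cmod (x n t - y t))\<^sup>2 * \<bar>w t\<bar>) \<partial>lebesgue) \<le> ennreal e"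
    if n: "n \<ge> M" and M: "\<And>m n. m \<ge> M \<Longrightarrow> n \<ge> M \<Longrightarrow> (LINT t|lebesgue. D m n t) < e" for n M e
  proof -
    have "(\<integral>\<^sup>+ t. ennreal ((cmod (x n t - y t))\<^sup>2 * \<bar>w t\<bar>) \<partial>lebesgue) =
        (\<integral>\<^sup>+ t. liminf (\<lambda>k. ennreal ((cmod (x n t - z k t))\<^sup>2 * \<bar>w t\<bar>)) \<partial>lebesgue)"
    proof (rule nn_integral_cong_AE)
      show "AE t in lebesgue. ennreal ((cmod (x n t - y t))\<^sup>2 * \<bar>w t\<bar>) =
          liminf (\<lambda>k. ennreal ((cmod (x n t - z k t))\<^sup>2 * \<bar>w t\<bar>))"
        using y_lim
      proof eventually_elim
        case (elim t)
        have "(\<lambda>k. ennreal ((cmod (x n t - z k t))\<^sup>2 * \<bar>w t\<bar>)) \<longlonglongrightarrow>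
            ennreal ((cmod (x n t - y t))\<^sup>2 * \<bar>w t\<bar>)"
          by (intro tendsto_ennrealI tendsto_intros elim)
        from lim_imp_Liminf[OF _ this] show ?case by simp
      qed
    qed
    also have "\<dots> \<le> liminf (\<lambda>k. \<integral>\<^sup>+ t. ennreal ((cmod (x n t - z k t))\<^sup>2 * \<bar>w t\<bar>) \<partial>lebesgue)"
      by (rule nn_integral_liminf) measurable
    also have "\<dots> \<le> ennreal e"
    proof (rule Liminf_le)
      show "\<forall>\<^sub>F k in sequentially. (\<integral>\<^sup>+ t. ennreal ((cmod (x n t - z k t))\<^sup>2 * \<bar>w t\<bar>) \<partial>lebesgue) \<le> ennreal e"
        using eventually_ge_at_top[of M]
      proof eventually_elim
        case (elim k)
        have "(\<integral>\<^sup>+ t. ennreal ((cmod (x n t - z k t))\<^sup>2 * \<bar>w t\<bar>) \<partial>lebesgue) = (\<integral>\<^sup>+ t. ennreal (D n (s k) t) \<partial>lebesgue)"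
          by (intro nn_integral_cong) (simp add: z_def D_def)
        also have "\<dots> \<le> ennreal e"
          unfolding D_nn using M[OF n, of "s k"] elim s(3)[of k] by (intro ennreal_leI) simp
        finally show ?case .
      qed
    qed simp
    finally show ?thesis .
  qed
  have int: "integrable lebesgue (\<lambda>t. (cmod (x n t - y t))\<^sup>2 * \<bar>w t\<bar>)"
      "(LINT t|lebesgue. (cmod (x n t - y t))\<^sup>2 * \<bar>w t\<bar>) \<le> e"
    if "n \<ge> M" "\<And>m n. m \<ge> M \<Longrightarrow> n \<ge> M \<Longrightarrow> (LINT t|lebesgue. D m n t) < e" "0 \<le> e" for n M e
  proof -
    have b: "(\<integral>\<^sup>+ t. ennreal ((cmod (x n t - y t))\<^sup>2 * \<bar>w t\<bar>) \<partial>lebesgue) \<le> ennreal e"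
      by (rule bound[OF that(1)]) (rule that(2))
    show i: "integrable lebesgue (\<lambda>t. (cmod (x n t - y t))\<^sup>2 * \<bar>w t\<bar>)"
    proof (rule integrableI_nonneg)
      show "(\<integral>\<^sup>+ t. ennreal ((cmod (x n t - y t))\<^sup>2 * \<bar>w t\<bar>) \<partial>lebesgue) < \<infinity>"
        using b by (auto intro: le_less_trans)
    qed auto
    have "ennreal (LINT t|lebesgue. (cmod (x n t - y t))\<^sup>2 * \<bar>w t\<bar>) \<le> ennreal e"
      using b by (subst (asm) nn_integral_eq_integral[OF i]) auto
    then show "(LINT t|lebesgue. (cmod (x n t - y t))\<^sup>2 * \<bar>w t\<bar>) \<le> e"
      using that(3) by simp
  qed
  obtain M where M: "\<And>m n. m \<ge> M \<Longrightarrow> n \<ge> M \<Longrightarrow> (LINT t|lebesgue. D m n t) < 1"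
    using Cauchy[of 1] unfolding D_def by auto
  have "fclass_of (\<lambda>t. x M t - y t) \<in> L2w w"
  proof -
    have "AE t in lebesgue. w t = 0 \<longrightarrow> x M t = 0"
      using x(2)[of M] by (simp add: mem_L2w_iff[OF x(1)])
    then have "AE t in lebesgue. w t = 0 \<longrightarrow> x M t - y t = 0"
      by eventually_elim (simp add: y0)
    then show ?thesis using int(1)[OF order_refl M] by (simp add: mem_L2w_iff)
  qed
  from csubspaceD(5)[OF csubspace_L2w[OF w] x(2)[of M] this]
  have "fclass_of y \<in> L2w w" by (simp add: fclass_of_ops)
  moreover have "(\<lambda>n. LINT t|lebesgue. (cmod (x n t - y t))\<^sup>2 * \<bar>w t\<bar>) \<longlonglongrightarrow> 0"
  proof (rule LIMSEQ_I)
    fix e :: real assume e: "e > 0"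
    then obtain M where M: "\<And>m n. m \<ge> M \<Longrightarrow> n \<ge> M \<Longrightarrow> (LINT t|lebesgue. D m n t) < e / 2"
      using Cauchy[of "e / 2"] unfolding D_def by auto
    have "norm ((LINT t|lebesgue. (cmod (x n t - y t))\<^sup>2 * \<bar>w t\<bar>) - 0) < e" if "n \<ge> M" for n
      using int(2)[OF that M] e by simp
    then show "\<exists>M. \<forall>n\<ge>M. norm ((LINT t|lebesgue. (cmod (x n t - y t))\<^sup>2 * \<bar>w t\<bar>) - 0) < e" by blast
  qed
  ultimately show thesis using that y_meas by blast
qed

lemma wprod_abs_weight:
  assumes "AE x in lebesgue. 0 \<le> w x"
  shows "wprod (\<lambda>x. \<bar>w x\<bar>) F G = wprod w F G"
proof -
  obtain f where f: "lmeas f" "F = fclass_of f" by (rule fclass_cases)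
  obtain g where g: "lmeas g" "G = fclass_of g" by (rule fclass_cases)
  have "AE x in lebesgue. f x * cnj (g x) * complex_of_real \<bar>w x\<bar> = f x * cnj (g x) * complex_of_real (w x)"
    using assms by eventually_elim simp
  then show ?thesis
    unfolding f(2) g(2) wprod_of[OF f(1) g(1)] by (rule AE_eq_integrable_lebesgue(2))
qed

lemma hnorm_L2w:
  assumes "AE x in lebesgue. 0 \<le> w x"
  shows "hnorm (Form D (wprod w)) F = sqrt (sqnorm w F)"
  by (simp add: hnorm_def sqnorm_def wprod_abs_weight[OF assms])

lemma sqnorm_eq_0:
  assumes w: "lmeas w" and F: "F \<in> L2w w" "sqnorm w F = 0"
  shows "F = 0"
proof -
  obtain f where f: "lmeas f" "F = fclass_of f" by (rule fclass_cases)
  have i: "integrable lebesgue (\<lambda>x. (cmod (f x))\<^sup>2 * \<bar>w x\<bar>)" and z: "AE x in lebesgue. w x = 0 \<longrightarrow> f x = 0"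
    using F f by (simp_all add: mem_L2w_iff)
  have "AE x in lebesgue. (cmod (f x))\<^sup>2 * \<bar>w x\<bar> = 0"
    using F(2) integral_nonneg_eq_0_iff_AE[OF i] by (simp add: f sqnorm_of)
  with z have "AE x in lebesgue. f x = 0" by eventually_elim auto
  then show ?thesis by (simp add: f zero_fclass_eq fclass_of_eq_iff)
qed

lemma hilbert_space_L2w:
  assumes w: "lmeas w" and nonneg: "AE x in lebesgue. 0 \<le> w x"
  shows "hilbert_space (Form (L2w w) (wprod w))"
  unfolding hilbert_space_def
proof (intro conjI ballI impI allI)
  show "symmetric_sesquilinear (Form (L2w w) (wprod w))" by (rule symmetric_sesquilinear_wprod[OF w])
next
  fix F assume F: "F \<in> form_dom (Form (L2w w) (wprod w))" "F \<noteq> 0"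
  then have "sqnorm w F \<noteq> 0" using sqnorm_eq_0[OF w] by auto
  with sqnorm_nonneg[of w F] show "0 < Re (form_val (Form (L2w w) (wprod w)) F F)"
    by (simp add: sqnorm_def wprod_abs_weight[OF nonneg])
next
  fix X :: "nat \<Rightarrow> fclass"
  assume X: "(\<forall>n. X n \<in> form_dom (Form (L2w w) (wprod w))) \<and>
    (\<forall>e>0. \<exists>N. \<forall>m\<ge>N. \<forall>n\<ge>N. hnorm (Form (L2w w) (wprod w)) (X m - X n) < e)"
  have "\<forall>n. \<exists>f. lmeas f \<and> X n = fclass_of f" by (metis fclass_cases)
  then obtain x where x: "\<And>n. lmeas (x n)" "\<And>n. X n = fclass_of (x n)" by metis
  have hn: "hnorm (Form (L2w w) (wprod w)) (fclass_of f - fclass_of g) =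
      sqrt (LINT t|lebesgue. (cmod (f t - g t))\<^sup>2 * \<bar>w t\<bar>)" if "lmeas f" "lmeas g" for f g
    using that by (simp add: hnorm_L2w[OF nonneg] fclass_of_ops sqnorm_of)
  obtain y where y: "lmeas y" "fclass_of y \<in> L2w w"
    "(\<lambda>n. LINT t|lebesgue. (cmod (x n t - y t))\<^sup>2 * \<bar>w t\<bar>) \<longlonglongrightarrow> 0"
  proof (rule L2w_complete[OF w x(1)])
    show "fclass_of (x n) \<in> L2w w" for n using X x(2) by auto
    show "\<exists>N. \<forall>m\<ge>N. \<forall>n\<ge>N. (LINT t|lebesgue. (cmod (x m t - x n t))\<^sup>2 * \<bar>w t\<bar>) < e" if "e > 0" for e
    proof -
      have "sqrt e > 0" using that by simp
      then obtain N where "\<And>m n. m \<ge> N \<Longrightarrow> n \<ge> N \<Longrightarrow> hnorm (Form (L2w w) (wprod w)) (X m - X n) < sqrt e"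
        using X by blast
      then show ?thesis by (auto simp: x(2) hn[OF x(1) x(1)])
    qed
  qed auto
  have "(\<lambda>n. hnorm (Form (L2w w) (wprod w)) (X n - fclass_of y)) \<longlonglongrightarrow> 0"
    using tendsto_real_sqrt[OF y(3)] by (simp add: x(2) hn[OF x(1) y(1)])
  with y(2) show "\<exists>u\<in>form_dom (Form (L2w w) (wprod w)). (\<lambda>n. hnorm (Form (L2w w) (wprod w)) (X n - u)) \<longlonglongrightarrow> 0"
    by auto
qed

text \<open>
  Dominated convergence, for restrictions to sets that eventually contain every point.
\<close>
lemma restriction_tendsto:
  assumes w: "lmeas w" and S: "\<And>n. S n \<in> sets lebesgue" "\<And>x. eventually (\<lambda>n. x \<in> S n) sequentially"
    and F: "F \<in> L2w w"
  shows "(\<lambda>n. sqnorm w (F - mult_by (indicat_real (S n)) F)) \<longlonglongrightarrow> 0"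
proof -
  obtain f where f: "lmeas f" "F = fclass_of f" by (rule fclass_cases)
  note [measurable] = w f(1) S(1)
  have ind [measurable]: "lmeas (indicat_real (S n))" for n using S(1) by simp
  have i: "integrable lebesgue (\<lambda>x. (cmod (f x))\<^sup>2 * \<bar>w x\<bar>)" using F f by (simp add: mem_L2w_iff)
  have "sqnorm w (F - mult_by (indicat_real (S n)) F) =
      (LINT x|lebesgue. (cmod (f x - complex_of_real (indicat_real (S n) x) * f x))\<^sup>2 * \<bar>w x\<bar>)" for n
  proof -
    have 1: "lmeas (\<lambda>x. complex_of_real (indicat_real (S n) x) * f x)" by measurable
    then have 2: "lmeas (\<lambda>x. f x - complex_of_real (indicat_real (S n) x) * f x)" by measurable
    show ?thesis
      by (simp only: f(2) fclass_of_maps(3)[OF f(1) ind] fclass_of_ops(2)[OF f(1) 1] sqnorm_of[OF 2])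
  qed
  moreover have "(\<lambda>n. LINT x|lebesgue. (cmod (f x - complex_of_real (indicat_real (S n) x) * f x))\<^sup>2 * \<bar>w x\<bar>)
      \<longlonglongrightarrow> integral\<^sup>L lebesgue (\<lambda>x::real. 0::real)"
  proof (rule integral_dominated_convergence[where w = "\<lambda>x. (cmod (f x))\<^sup>2 * \<bar>w x\<bar>"])
    show "integrable lebesgue (\<lambda>x. (cmod (f x))\<^sup>2 * \<bar>w x\<bar>)" by (rule i)
    show "AE x in lebesgue. (\<lambda>n. (cmod (f x - complex_of_real (indicat_real (S n) x) * f x))\<^sup>2 * \<bar>w x\<bar>) \<longlonglongrightarrow> 0"
    proof (intro AE_I2 tendsto_eventually)
      fix x
      show "\<forall>\<^sub>F n in sequentially. (cmod (f x - complex_of_real (indicat_real (S n) x) * f x))\<^sup>2 * \<bar>w x\<bar> = 0"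
        using S(2)[of x] by eventually_elim simp
    qed
    show "AE x in lebesgue. norm ((cmod (f x - complex_of_real (indicat_real (S n) x) * f x))\<^sup>2 * \<bar>w x\<bar>)
        \<le> (cmod (f x))\<^sup>2 * \<bar>w x\<bar>" for n
      by (intro AE_I2) (simp add: indicator_def)
  qed measurable
  ultimately show ?thesis by simp
qed

section \<open>Multiplication operators\<close>

lemma mult_by_simps:
  assumes m: "lmeas m"
  shows "mult_by m (F + G) = mult_by m F + mult_by m G"
    "mult_by m (F - G) = mult_by m F - mult_by m G"
    "mult_by m (c *\<^sub>C F) = c *\<^sub>C mult_by m F"
    "lmeas n \<Longrightarrow> mult_by m (mult_by n F) = mult_by (\<lambda>x. m x * n x) F"
proof -
  obtain f where f: "lmeas f" "F = fclass_of f" by (rule fclass_cases)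
  obtain g where g: "lmeas g" "G = fclass_of g" by (rule fclass_cases)
  note [measurable] = m f(1) g(1)
  have M: "lmeas (\<lambda>x. complex_of_real (m x) * f x)" "lmeas (\<lambda>x. complex_of_real (m x) * g x)"
    "lmeas (\<lambda>x. f x + g x)" "lmeas (\<lambda>x. f x - g x)" "lmeas (\<lambda>x. c * f x)" by measurable
  show "mult_by m (F + G) = mult_by m F + mult_by m G"
    by (simp add: f g fclass_of_maps fclass_of_ops M m distrib_left)
  show "mult_by m (F - G) = mult_by m F - mult_by m G"
    by (simp add: f g fclass_of_maps fclass_of_ops M m right_diff_distrib)
  show "mult_by m (c *\<^sub>C F) = c *\<^sub>C mult_by m F"
    by (simp add: f fclass_of_maps fclass_of_ops M m mult_ac)
  show "mult_by m (mult_by n F) = mult_by (\<lambda>x. m x * n x) F" if n: "lmeas n"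
  proof -
    note [measurable] = n
    have "lmeas (\<lambda>x. complex_of_real (n x) * f x)" "lmeas (\<lambda>x. m x * n x)" by measurable
    then show ?thesis by (simp add: f fclass_of_maps n m mult_ac)
  qed
qed

lemma mult_by_id:
  assumes m: "lmeas m" and one: "AE x in lebesgue. m x = 1"
  shows "mult_by m F = F"
proof -
  obtain f where f: "lmeas f" "F = fclass_of f" by (rule fclass_cases)
  note [measurable] = m f(1)
  have M: "lmeas (\<lambda>x. complex_of_real (m x) * f x)" by measurable
  have "AE x in lebesgue. complex_of_real (m x) * f x = f x"
    using one by eventually_elim auto
  then show ?thesis by (simp add: f fclass_of_maps m M fclass_of_eq_iff)
qed

lemma lmeas_ident: "lmeas (\<lambda>x. x)"
  by (rule measurable_completion) simp

lemma mult_x_eq: "mult_x F = mult_by (\<lambda>x. x) F"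
proof -
  obtain f where f: "lmeas f" "F = fclass_of f" by (rule fclass_cases)
  then show ?thesis by (simp add: fclass_of_maps lmeas_ident)
qed

lemma wprod_mult_by:
  assumes m: "lmeas m"
  shows "wprod w (mult_by m F) G = wprod (\<lambda>x. m x * w x) F G"
    "wprod w F (mult_by m G) = wprod (\<lambda>x. m x * w x) F G"
proof -
  obtain f where f: "lmeas f" "F = fclass_of f" by (rule fclass_cases)
  obtain g where g: "lmeas g" "G = fclass_of g" by (rule fclass_cases)
  note [measurable] = m f(1) g(1)
  have M: "lmeas (\<lambda>x. complex_of_real (m x) * f x)" "lmeas (\<lambda>x. complex_of_real (m x) * g x)" by measurable
  show "wprod w (mult_by m F) G = wprod (\<lambda>x. m x * w x) F G"
    "wprod w F (mult_by m G) = wprod (\<lambda>x. m x * w x) F G"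
    unfolding f(2) g(2) fclass_of_maps(3)[OF f(1) m] fclass_of_maps(3)[OF g(1) m]
      wprod_of[OF M(1) g(1)] wprod_of[OF f(1) g(1)] wprod_of[OF f(1) M(2)]
    by (simp_all add: mult_ac)
qed

lemma wprod_cong_weight:
  assumes "AE x in lebesgue. w x = w' x"
  shows "wprod w F G = wprod w' F G"
proof -
  obtain f where f: "lmeas f" "F = fclass_of f" by (rule fclass_cases)
  obtain g where g: "lmeas g" "G = fclass_of g" by (rule fclass_cases)
  have "AE x in lebesgue. f x * cnj (g x) * complex_of_real (w x) = f x * cnj (g x) * complex_of_real (w' x)"
    using assms by eventually_elim simp
  then show ?thesis
    unfolding f(2) g(2) wprod_of[OF f(1) g(1)] by (rule AE_eq_integrable_lebesgue(2))
qed

lemma sqnorm_mult_by: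
  assumes m: "lmeas m"
  shows "sqnorm w (mult_by m F) = sqnorm (\<lambda>x. (m x)\<^sup>2 * w x) F"
  unfolding sqnorm_def wprod_mult_by[OF m]
  by (rule arg_cong[OF wprod_cong_weight]) (simp add: abs_mult power2_eq_square mult_ac)

lemma sqnorm_cong_weight:
  assumes "AE x in lebesgue. \<bar>w x\<bar> = \<bar>w' x\<bar>"
  shows "sqnorm w F = sqnorm w' F"
  unfolding sqnorm_def by (rule arg_cong[OF wprod_cong_weight[OF assms]])

lemma L2w_mono:
  assumes "lmeas w'" "F \<in> L2w w" "AE x in lebesgue. \<bar>w' x\<bar> \<le> C * \<bar>w x\<bar>"
    and "AE x in lebesgue. w' x = 0 \<longrightarrow> w x = 0"
  shows "F \<in> L2w w'" "sqnorm w' F \<le> C * sqnorm w F"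
proof -
  have one: "mult_by (\<lambda>x. 1) F = F" by (rule mult_by_id) simp_all
  show "F \<in> L2w w'" "sqnorm w' F \<le> C * sqnorm w F"
    using mult_by_L2w[where m = "\<lambda>x. 1", OF _ assms(1,2)] assms(3,4) one by simp_all
qed

lemma L2w_cong:
  assumes w: "lmeas w" "lmeas w'"
    and le: "AE x in lebesgue. \<bar>w' x\<bar> \<le> C * \<bar>w x\<bar>" "AE x in lebesgue. \<bar>w x\<bar> \<le> C' * \<bar>w' x\<bar>"
  shows "L2w w = L2w w'"
proof -
  have "AE x in lebesgue. w' x = 0 \<longrightarrow> w x = 0" using le(2) by eventually_elim auto
  moreover have "AE x in lebesgue. w x = 0 \<longrightarrow> w' x = 0" using le(1) by eventually_elim auto
  ultimately show ?thesis using L2w_mono(1)[OF w(2) _ le(1)] L2w_mono(1)[OF w(1) _ le(2)] by blast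
qed

text \<open>
  If \<open>V\<close> belongs to the domain of the adjoint and \<open>W\<close> is its image there, then testing with the
  restriction \<open>U\<close> of \<open>m V - W\<close> to a set on which \<open>m\<close> is bounded gives \<open>\<integral> |U|\<^sup>2 w = 0\<close>; these sets exhaust the
  line, so \<open>W = m V\<close>.
\<close>
lemma self_adjoint_mult_by:
  assumes w: "lmeas w" and nonneg: "AE x in lebesgue. 0 \<le> w x" and m: "lmeas m"
  shows "self_adjoint (Form (L2w w) (wprod w)) (Operator {F \<in> L2w w. mult_by m F \<in> L2w w} (mult_by m))"
proof -
  let ?D = "{F \<in> L2w w. mult_by m F \<in> L2w w}"
  note C = csubspaceD[OF csubspace_L2w[OF w]]
  define S where "S n = {x. \<bar>m x\<bar> \<le> real n}" for n
  have S: "S n \<in> sets lebesgue" for n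
  proof -
    have "(\<lambda>x. \<bar>m x\<bar>) \<in> borel_measurable lebesgue" using m by measurable
    then have "{x \<in> space lebesgue. \<bar>m x\<bar> \<le> real n} \<in> sets lebesgue" by measurable
    then show ?thesis by (simp add: S_def)
  qed
  have ev: "eventually (\<lambda>n. x \<in> S n) sequentially" for x
  proof -
    obtain N where "\<bar>m x\<bar> \<le> real N" using real_arch_simple by blast
    then show ?thesis unfolding S_def by (auto simp: eventually_sequentially intro!: exI[of _ N])
  qed
  have ind: "lmeas (indicat_real (S n))" for n using S by simp
  have cut_dom: "mult_by (indicat_real (S n)) F \<in> ?D" if F: "F \<in> L2w w" for n F
  proof (intro CollectI conjI)
    show "mult_by (indicat_real (S n)) F \<in> L2w w"
      by (rule mult_by_L2w(1)[OF ind w F, where C = 1]) (auto simp: indicator_def)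
    have "mult_by (\<lambda>x. m x * indicat_real (S n) x) F \<in> L2w w"
    proof (rule mult_by_L2w(1)[OF _ w F, where C = "(real n)\<^sup>2"])
      show "lmeas (\<lambda>x. m x * indicat_real (S n) x)" using m ind by measurable
      show "AE x in lebesgue. (m x * indicat_real (S n) x)\<^sup>2 * \<bar>w x\<bar> \<le> (real n)\<^sup>2 * \<bar>w x\<bar>"
        by (intro AE_I2 mult_right_mono) (auto simp: S_def indicator_def abs_le_square_iff[symmetric])
    qed simp
    then show "mult_by m (mult_by (indicat_real (S n)) F) \<in> L2w w"
      by (simp add: mult_by_simps(4)[OF m ind])
  qed
  have lin: "linear_operator (Form (L2w w) (wprod w)) (Operator ?D (mult_by m))"
    unfolding linear_operator_def csubspace_def operator.sel form.sel
    using C mult_by_simps(1,3)[OF m] mult_by_simps(3)[OF m, of 0 0] by auto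
  have dense: "dense_wrt (hnorm (Form (L2w w) (wprod w))) ?D (L2w w)"
    unfolding dense_wrt_def
  proof (intro conjI ballI allI impI)
    fix F :: fclass and e :: real assume F: "F \<in> L2w w" and e: "e > 0"
    have "\<forall>\<^sub>F n in sequentially. sqnorm w (F - mult_by (indicat_real (S n)) F) < e\<^sup>2"
      by (rule order_tendstoD(2)[OF restriction_tendsto[OF w S ev F]]) (use e in simp)
    then obtain n where "sqnorm w (F - mult_by (indicat_real (S n)) F) < e\<^sup>2"
      by (auto simp: eventually_sequentially)
    then have "hnorm (Form (L2w w) (wprod w)) (F - mult_by (indicat_real (S n)) F) < e"
      using e by (simp add: hnorm_L2w[OF nonneg] real_sqrt_less_iff real_less_lsqrt sqnorm_nonneg)
    then show "\<exists>v\<in>?D. hnorm (Form (L2w w) (wprod w)) (F - v) < e"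
      using cut_dom[OF F] by blast
  qed auto
  have adj: "(\<forall>u\<in>?D. wprod w (mult_by m u) V = wprod w u W) \<longleftrightarrow> V \<in> ?D \<and> W = mult_by m V"
    if V: "V \<in> L2w w" and W: "W \<in> L2w w" for V W
  proof
    assume "V \<in> ?D \<and> W = mult_by m V"
    then show "\<forall>u\<in>?D. wprod w (mult_by m u) V = wprod w u W"
      by (simp add: wprod_mult_by[OF m])
  next
    assume *: "\<forall>u\<in>?D. wprod w (mult_by m u) V = wprod w u W"
    obtain f where f: "lmeas f" "V = fclass_of f" by (rule fclass_cases)
    obtain g where g: "lmeas g" "W = fclass_of g" by (rule fclass_cases)
    note [measurable] = m w f(1) g(1) ind
    have z: "AE x in lebesgue. w x = 0 \<longrightarrow> f x = 0" "AE x in lebesgue. w x = 0 \<longrightarrow> g x = 0"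
      using V W f g by (simp_all add: mem_L2w_iff)
    have mV: "lmeas (\<lambda>x. complex_of_real (m x) * f x)" by measurable
    have "AE x in lebesgue. \<forall>n. x \<in> S n \<longrightarrow> complex_of_real (m x) * f x = g x"
    proof (subst AE_all_countable, intro allI)
      fix n
      let ?i = "indicat_real (S n)"
      define U where "U = mult_by ?i (mult_by m V - W)"
      \<comment> \<open>In this form \<open>U\<close> is seen to be square integrable, although \<open>m V\<close> need not be.\<close>
      have U_alt: "U = mult_by m (mult_by ?i V) - mult_by ?i W"
        unfolding U_def mult_by_simps(2)[OF ind] mult_by_simps(4)[OF ind m] mult_by_simps(4)[OF m ind]
        by (simp add: mult.commute)
      have UL: "U \<in> L2w w" unfolding U_alt using cut_dom[OF V, of n] cut_dom[OF W, of n] C(5) by simp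
      have iU: "mult_by ?i U = U"
      proof -
        have "(\<lambda>x. ?i x * ?i x) = ?i" by (auto simp: indicator_def)
        then show ?thesis unfolding U_def by (simp add: mult_by_simps(4)[OF ind ind])
      qed
      have UD: "U \<in> ?D" using cut_dom[OF UL, of n] iU by simp
      have "wprod w U (mult_by m (mult_by ?i V)) = wprod w (mult_by ?i (mult_by m U)) V"
        by (simp add: wprod_mult_by[OF m] wprod_mult_by[OF ind] mult_ac)
      also have "mult_by ?i (mult_by m U) = mult_by m (mult_by ?i U)"
        by (simp add: mult_by_simps(4)[OF ind m] mult_by_simps(4)[OF m ind] mult.commute)
      also have "wprod w (mult_by m (mult_by ?i U)) V = wprod w U W" using * UD iU by simp
      also have "\<dots> = wprod w U (mult_by ?i W)"
        using wprod_mult_by[OF ind[of n], of w U W] iU by simp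
      finally have "wprod w U U = 0"
        unfolding U_alt[THEN arg_cong[of _ _ "wprod w U"]]
        using sesquilinear_simps(3)[OF symmetric_sesquilinear_wprod[OF w], of U "mult_by m (mult_by ?i V)" "mult_by ?i W"]
          UL cut_dom[OF V, of n] cut_dom[OF W, of n] by simp
      then have "sqnorm w U = 0" by (simp add: sqnorm_def wprod_abs_weight[OF nonneg])
      then have "U = 0" by (rule sqnorm_eq_0[OF w UL])
      moreover have "U = fclass_of (\<lambda>x. complex_of_real (?i x) * (complex_of_real (m x) * f x - g x))"
        by (simp add: U_def f g fclass_of_maps m ind fclass_of_ops mV)
      ultimately have "AE x in lebesgue. complex_of_real (?i x) * (complex_of_real (m x) * f x - g x) = 0"
        by (simp add: zero_fclass_eq fclass_of_eq_iff)
      then show "AE x in lebesgue. x \<in> S n \<longrightarrow> complex_of_real (m x) * f x = g x"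
        by eventually_elim (auto simp: indicator_def)
    qed
    then have "AE x in lebesgue. complex_of_real (m x) * f x = g x"
    proof eventually_elim
      case (elim x)
      from ev[of x] obtain n where "x \<in> S n" by (auto simp: eventually_sequentially)
      with elim show ?case by blast
    qed
    then have "mult_by m V = W" by (simp add: f g fclass_of_maps m fclass_of_eq_iff mV)
    with V W show "V \<in> ?D \<and> W = mult_by m V" by simp
  qed
  show ?thesis
    unfolding self_adjoint_def operator.sel form.sel using lin dense adj by simp
qed

section \<open>Even and odd parts and power weights\<close>

lemma parity_parts_reflect:
  "even_part F = (1/2) *\<^sub>C (F + reflect F)" "odd_part F = (1/2) *\<^sub>C (F - reflect F)"
  "lmeas m \<Longrightarrow> (\<And>x. m (- x) = m x) \<Longrightarrow> reflect (mult_by m F) = mult_by m (reflect F)"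
proof -
  obtain f where f: "lmeas f" "F = fclass_of f" by (rule fclass_cases)
  note R = measurable_reflect_lebesgue[OF f(1)]
  note [measurable] = f(1) R
  have M: "lmeas (\<lambda>x. f x + f (- x))" "lmeas (\<lambda>x. f x - f (- x))"
    by measurable
  show "even_part F = (1/2) *\<^sub>C (F + reflect F)" "odd_part F = (1/2) *\<^sub>C (F - reflect F)"
    by (simp_all add: f fclass_of_maps fclass_of_ops M R)
  show "reflect (mult_by m F) = mult_by m (reflect F)" if m: "lmeas m" "\<And>x. m (- x) = m x"
  proof -
    note [measurable] = m(1)
    have "lmeas (\<lambda>x. complex_of_real (m x) * f x)" by measurable
    then show ?thesis by (simp add: f fclass_of_maps m R)
  qed
qed

lemma reflect_L2w:
  assumes w: "AE x in lebesgue. \<bar>w (- x)\<bar> = \<bar>w x\<bar>" and F: "F \<in> L2w w"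
  shows "reflect F \<in> L2w w" "sqnorm w (reflect F) = sqnorm w F"
proof -
  obtain f where f: "lmeas f" "F = fclass_of f" by (rule fclass_cases)
  note R = measurable_reflect_lebesgue[OF f(1)]
  have i: "integrable lebesgue (\<lambda>x. (cmod (f x))\<^sup>2 * \<bar>w x\<bar>)" and z: "AE x in lebesgue. w x = 0 \<longrightarrow> f x = 0"
    using F f by (simp_all add: mem_L2w_iff)
  have ae: "AE x in lebesgue. (cmod (f (- x)))\<^sup>2 * \<bar>w x\<bar> = (cmod (f (- x)))\<^sup>2 * \<bar>w (- x)\<bar>"
    using w by eventually_elim simp
  have "integrable lebesgue (\<lambda>x. (cmod (f (- x)))\<^sup>2 * \<bar>w (- x)\<bar>)"
    using lebesgue_integrable_real_affine_iff[of "-1" "\<lambda>x. (cmod (f x))\<^sup>2 * \<bar>w x\<bar>" 0] i by simp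
  then have "integrable lebesgue (\<lambda>x. (cmod (f (- x)))\<^sup>2 * \<bar>w x\<bar>)"
    using AE_eq_integrable_lebesgue(1)[OF ae] by simp
  moreover have "AE x in lebesgue. w x = 0 \<longrightarrow> f (- x) = 0"
    using AE_reflect_lebesgue[OF z] w by eventually_elim auto
  ultimately show "reflect F \<in> L2w w" by (simp add: f fclass_of_maps mem_L2w_iff R)
  have "(LINT x|lebesgue. (cmod (f (- x)))\<^sup>2 * \<bar>w x\<bar>) = (LINT x|lebesgue. (cmod (f x))\<^sup>2 * \<bar>w x\<bar>)"
    using lebesgue_integral_real_affine[of "-1" "\<lambda>x. (cmod (f x))\<^sup>2 * \<bar>w x\<bar>" 0]
      AE_eq_integrable_lebesgue(2)[OF ae] by simp
  then show "sqnorm w (reflect F) = sqnorm w F" by (simp add: f fclass_of_maps sqnorm_of R)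
qed

definition pmult :: "real \<Rightarrow> fclass \<Rightarrow> fclass" where
  "pmult t = mult_by (\<lambda>x. \<bar>x\<bar> powr t)"

text \<open>
  In absolute value and up to bounded factors, all weights of the model are of this form: \<open>r_minus\<close>, \<open>r\<close> and \<open>r_plus\<close> have the
  exponents \<open>-1\<close>, \<open>0\<close> and \<open>1\<close>, \<open>omega\<close> has \<open>\<alpha>/2\<close> and \<open>eta\<close> has \<open>-\<alpha>/2\<close>.
\<close>
definition pweight :: "(real \<Rightarrow> real) \<Rightarrow> real \<Rightarrow> real \<Rightarrow> real" where
  "pweight r s x = \<bar>x\<bar> powr s * \<bar>r x\<bar>"

text \<open>
  For \<open>s = \<alpha>/4\<close> this map redistributes a factor \<open>|x|\<^sup>s\<close> between the even and the odd part so that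
  both parts of the image are subject to the same weight \<open>|r|\<close>.
\<close>
definition balance :: "real \<Rightarrow> fclass \<Rightarrow> fclass" where
  "balance s F = pmult (- s) (even_part F) + pmult s (odd_part F)"

lemma AE_nonzero: "AE x::real in lebesgue. x \<noteq> 0"
proof (rule AE_I[of _ _ "{0}"])
  show "emeasure lebesgue {0::real} = 0" by simp
qed auto

lemma lmeas_powr: "lmeas (\<lambda>x. \<bar>x\<bar> powr t)"
  by (rule measurable_completion) measurable

lemma pmult_simps:
  "pmult t (F + G) = pmult t F + pmult t G"
  "pmult t (F - G) = pmult t F - pmult t G"
  "pmult t (c *\<^sub>C F) = c *\<^sub>C pmult t F"
  "pmult t (pmult s F) = pmult (t + s) F"
  "pmult 0 F = F"
  "pmult 1 (pmult 1 F) = mult_x (mult_x F)"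
proof -
  show "pmult t (F + G) = pmult t F + pmult t G" "pmult t (F - G) = pmult t F - pmult t G"
    "pmult t (c *\<^sub>C F) = c *\<^sub>C pmult t F" "pmult t (pmult s F) = pmult (t + s) F"
    by (simp_all add: pmult_def mult_by_simps lmeas_powr powr_add)
  show "pmult 0 F = F"
    unfolding pmult_def by (rule mult_by_id[OF lmeas_powr]) (use AE_nonzero in \<open>eventually_elim, simp\<close>)
  have "(\<lambda>x::real. x * x) = (\<lambda>x. \<bar>x\<bar> powr 1 * \<bar>x\<bar> powr 1)" by (auto simp: abs_mult_self_eq)
  then show "pmult 1 (pmult 1 F) = mult_x (mult_x F)"
    unfolding pmult_def mult_x_eq mult_by_simps(4)[OF lmeas_powr lmeas_powr]
      mult_by_simps(4)[OF lmeas_ident lmeas_ident] by simp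
qed

lemma parity_parts:
  "even_part F + odd_part F = F"
  "even_part (even_part F) = even_part F" "odd_part (odd_part F) = odd_part F"
  "even_part (odd_part F) = 0" "odd_part (even_part F) = 0"
  "even_part (F + G) = even_part F + even_part G" "odd_part (F + G) = odd_part F + odd_part G"
  "even_part (c *\<^sub>C F) = c *\<^sub>C even_part F" "odd_part (c *\<^sub>C F) = c *\<^sub>C odd_part F"
proof -
  obtain f where f: "lmeas f" "F = fclass_of f" by (rule fclass_cases)
  obtain g where g: "lmeas g" "G = fclass_of g" by (rule fclass_cases)
  note R = measurable_reflect_lebesgue[OF f(1)] measurable_reflect_lebesgue[OF g(1)]
  note [measurable] = f(1) g(1) R
  have M: "lmeas (\<lambda>x. f x + g x)" "lmeas (\<lambda>x. c * f x)" "lmeas (\<lambda>x. (f x + f (- x)) / 2)"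
     "lmeas (\<lambda>x. (f x - f (- x)) / 2)" "lmeas (\<lambda>x. (g x + g (- x)) / 2)"
     "lmeas (\<lambda>x. (g x - g (- x)) / 2)"
    by measurable
  note S = f g fclass_of_maps fclass_of_ops M zero_fclass_eq
  show "even_part F + odd_part F = F"
    by (simp add: S, rule arg_cong[of _ _ fclass_of], rule ext, simp add: field_simps)
  show "even_part (even_part F) = even_part F" "odd_part (odd_part F) = odd_part F"
    "even_part (odd_part F) = 0" "odd_part (even_part F) = 0"
    by (simp add: S, rule arg_cong[of _ _ fclass_of], rule ext, simp add: field_simps)+
  show "even_part (F + G) = even_part F + even_part G" "odd_part (F + G) = odd_part F + odd_part G"
    by (simp add: S, rule arg_cong[of _ _ fclass_of], rule ext, simp add: field_simps)+
  show "even_part (c *\<^sub>C F) = c *\<^sub>C even_part F" "odd_part (c *\<^sub>C F) = c *\<^sub>C odd_part F"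
    by (simp add: S, rule arg_cong[of _ _ fclass_of], rule ext, simp add: field_simps)+
qed

lemma parity_parts_mult_by:
  assumes "lmeas m" "\<And>x. m (- x) = m x"
  shows "even_part (mult_by m F) = mult_by m (even_part F)" "odd_part (mult_by m F) = mult_by m (odd_part F)"
  using assms by (simp_all add: parity_parts_reflect mult_by_simps)

lemma parity_parts_pmult:
  "even_part (pmult t F) = pmult t (even_part F)" "odd_part (pmult t F) = pmult t (odd_part F)"
  unfolding pmult_def by (rule parity_parts_mult_by; simp add: lmeas_powr)+

lemma pmult_zero: "pmult t 0 = 0"
  using pmult_simps(3)[of t 0 0] by simp

text \<open>
  The maps \<open>balance s\<close> form a one-parameter group; in particular they are invertible.
\<close>
lemma balance_simps:
  "even_part (balance s F) = pmult (- s) (even_part F)"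
  "odd_part (balance s F) = pmult s (odd_part F)"
  "balance s (balance t F) = balance (s + t) F"
  "balance 0 F = F"
  "balance s (F + G) = balance s F + balance s G"
  "balance s (c *\<^sub>C F) = c *\<^sub>C balance s F"
proof -
  show eo: "even_part (balance s F) = pmult (- s) (even_part F)" "odd_part (balance s F) = pmult s (odd_part F)"
    for s F
    by (simp_all add: balance_def parity_parts parity_parts_pmult pmult_zero)
  show "balance s (balance t F) = balance (s + t) F"
    by (subst balance_def) (simp add: eo pmult_simps, simp add: balance_def add.commute)
  show "balance 0 F = F" by (simp add: balance_def pmult_simps parity_parts)
  show "balance s (F + G) = balance s F + balance s G" "balance s (c *\<^sub>C F) = c *\<^sub>C balance s F"
    by (simp_all add: balance_def parity_parts pmult_simps scaleC_add_right)
qed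

text \<open>
  In particular \<open>balance\<close> commutes with cutting off at \<open>|x| = n\<close>, so density statements in
  the spaces with equal weights carry over.
\<close>
lemma balance_mult_by:
  assumes "lmeas m" "\<And>x. m (- x) = m x"
  shows "balance s (mult_by m F) = mult_by m (balance s F)"
  unfolding balance_def parity_parts_mult_by[OF assms]
  by (simp add: pmult_def mult_by_simps lmeas_powr assms(1) mult.commute)

lemma pmult_L2w_iff:
  assumes r: "lmeas r"
  shows "pmult t F \<in> L2w (pweight r s) \<longleftrightarrow> F \<in> L2w (pweight r (s + 2 * t))"
    and "sqnorm (pweight r s) (pmult t F) = sqnorm (pweight r (s + 2 * t)) F"
proof -
  have w: "lmeas (pweight r s)" for s
    unfolding pweight_def[abs_def] using r lmeas_powr[of s] by measurable
  have e: "(\<bar>x\<bar> powr t)\<^sup>2 * pweight r s x = pweight r (s + 2 * t) x" for t s x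
  proof -
    have "\<bar>x\<bar> powr (s + 2 * t) = (\<bar>x\<bar> powr t)\<^sup>2 * \<bar>x\<bar> powr s"
      unfolding power2_eq_square by (simp only: powr_add[symmetric]) (simp add: algebra_simps)
    then show ?thesis by (simp add: pweight_def)
  qed
  have up: "pmult t F \<in> L2w (pweight r s)" if "F \<in> L2w (pweight r (s + 2 * t))" for t s F
    unfolding pmult_def
  proof (rule mult_by_L2w(1)[OF lmeas_powr w that, where C = 1])
    show "AE x in lebesgue. (\<bar>x\<bar> powr t)\<^sup>2 * \<bar>pweight r s x\<bar> \<le> 1 * \<bar>pweight r (s + 2 * t) x\<bar>"
      by (simp add: e[symmetric] abs_mult)
    show "AE x in lebesgue. pweight r s x = 0 \<longrightarrow> pweight r (s + 2 * t) x = 0 \<or> \<bar>x\<bar> powr t = 0"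
      by (simp add: e[symmetric])
  qed
  show "pmult t F \<in> L2w (pweight r s) \<longleftrightarrow> F \<in> L2w (pweight r (s + 2 * t))"
    using up[of F s t] up[of "pmult t F" "s + 2 * t" "- t"] by (auto simp: pmult_simps)
  show "sqnorm (pweight r s) (pmult t F) = sqnorm (pweight r (s + 2 * t)) F"
    unfolding pmult_def sqnorm_mult_by[OF lmeas_powr] by (simp add: e)
qed

section \<open>Comparison of the weights of the model\<close>

locale model =
  fixes r :: "real \<Rightarrow> real" and eps :: real
  assumes admissible: "admissible_weight r eps"

lemma (in model) eps_pos: "0 < eps"
  using admissible by (simp add: admissible_weight_def)

lemma (in model) r_lmeas: "lmeas r"
proof (rule borel_measurable_LIMSEQ_metric)
  show "lmeas (\<lambda>x. indicat_real {- real n..real n} x *\<^sub>R r x)" for n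
  proof -
    have "r absolutely_integrable_on {- real n..real n}"
      using admissible by (simp add: admissible_weight_def)
    then show ?thesis unfolding set_integrable_def by (rule borel_measurable_integrable)
  qed
  show "(\<lambda>n. indicat_real {- real n..real n} x *\<^sub>R r x) \<longlonglongrightarrow> r x" for x
  proof (rule tendsto_eventually)
    obtain N where "\<bar>x\<bar> \<le> real N" using real_arch_simple by blast
    then show "\<forall>\<^sub>F n in sequentially. indicat_real {- real n..real n} x *\<^sub>R r x = r x"
      by (auto simp: eventually_sequentially indicator_def intro!: exI[of _ N])
  qed
qed

lemma (in model) AE_odd: "AE x in lebesgue. r (- x) = - r x"
  using admissible by (simp add: admissible_weight_def)

lemma (in model) AE_sign:
  "AE x in lebesgue. \<bar>x\<bar> \<le> eps \<and> r x = 0 \<or> eps < \<bar>x\<bar> \<and> r x \<noteq> 0 \<and> r x = sgn x * \<bar>r x\<bar>"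
proof -
  have a: "AE x in lebesgue. \<bar>x\<bar> \<le> eps \<longrightarrow> r x = 0" "AE x in lebesgue. eps < \<bar>x\<bar> \<longrightarrow> 0 < x * r x"
    using admissible by (simp_all add: admissible_weight_def)
  from a show ?thesis
  proof eventually_elim
    case (elim x)
    show ?case
    proof (cases "\<bar>x\<bar> \<le> eps")
      case False
      with elim have "0 < x * r x" by simp
      then have "r x \<noteq> 0 \<and> r x = sgn x * \<bar>r x\<bar>"
        by (auto simp: zero_less_mult_iff sgn_if)
      with False show ?thesis by simp
    qed (use elim in simp)
  qed
qed

lemma (in model) pweight_lmeas: "lmeas (pweight r s)"
  unfolding pweight_def[abs_def] using r_lmeas lmeas_powr[of s] by measurable

lemma (in model) pweight_nonneg: "0 \<le> pweight r s x"
  by (simp add: pweight_def)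

lemma (in model) pweight_even: "AE x in lebesgue. \<bar>pweight r s (- x)\<bar> = \<bar>pweight r s x\<bar>"
  using AE_odd by eventually_elim (simp add: pweight_def)

lemma (in model) powr_le_powr:
  assumes "eps < \<bar>x\<bar>" "p \<le> q"
  shows "\<bar>x\<bar> powr p \<le> eps powr (p - q) * \<bar>x\<bar> powr q"
proof -
  have "\<bar>x\<bar> powr p = \<bar>x\<bar> powr (p - q) * \<bar>x\<bar> powr q" by (simp add: powr_add[symmetric])
  also have "\<dots> \<le> eps powr (p - q) * \<bar>x\<bar> powr q"
    using assms eps_pos by (intro mult_right_mono powr_mono2') auto
  finally show ?thesis .
qed

text \<open>
  Because the weights live on \<open>|x| > \<epsilon>\<close>, lowering the exponent costs only a constant.
\<close>
lemma (in model) L2w_pweight_mono: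
  assumes "F \<in> L2w (pweight r q)" "p \<le> q"
  shows "F \<in> L2w (pweight r p)" "sqnorm (pweight r p) F \<le> eps powr (p - q) * sqnorm (pweight r q) F"
proof -
  have 1: "AE x in lebesgue. \<bar>pweight r p x\<bar> \<le> eps powr (p - q) * \<bar>pweight r q x\<bar>"
    using AE_sign
  proof eventually_elim
    case (elim x)
    then show ?case
      using mult_right_mono[OF powr_le_powr[OF _ assms(2), of x], of "\<bar>r x\<bar>"]
      by (auto simp: pweight_def mult_ac)
  qed
  have 2: "AE x in lebesgue. pweight r p x = 0 \<longrightarrow> pweight r q x = 0"
    by (simp add: pweight_def)
  show "F \<in> L2w (pweight r p)" "sqnorm (pweight r p) F \<le> eps powr (p - q) * sqnorm (pweight r q) F"
    using L2w_mono[OF pweight_lmeas assms(1) 1 2] by auto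
qed

lemma (in model) parts_L2w_pweight:
  assumes "F \<in> L2w (pweight r s)"
  shows "even_part F \<in> L2w (pweight r s)" "odd_part F \<in> L2w (pweight r s)"
    "sqnorm (pweight r s) (even_part F) \<le> sqnorm (pweight r s) F"
    "sqnorm (pweight r s) (odd_part F) \<le> sqnorm (pweight r s) F"
proof -
  note C = csubspaceD[OF csubspace_L2w[OF pweight_lmeas]]
  note R = reflect_L2w[OF pweight_even assms]
  have d: "F - reflect F = F + (- reflect F)" by simp
  have mR: "- reflect F \<in> L2w (pweight r s)" "sqnorm (pweight r s) (- reflect F) = sqnorm (pweight r s) F"
    using scaleC_L2w[OF R(1), of "-1"] R(2) by simp_all
  note P = add_L2w[OF pweight_lmeas assms R(1)] and M = add_L2w[OF pweight_lmeas assms mR(1)]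
  show "even_part F \<in> L2w (pweight r s)" "odd_part F \<in> L2w (pweight r s)"
    "sqnorm (pweight r s) (even_part F) \<le> sqnorm (pweight r s) F"
    "sqnorm (pweight r s) (odd_part F) \<le> sqnorm (pweight r s) F"
    unfolding parity_parts_reflect(1,2)
    using scaleC_L2w[OF P(1), of "1/2"] scaleC_L2w[OF M(1)[folded d], of "1/2"] P(2) M(2)[folded d] R(2) mR(2)
    by (simp_all add: power2_eq_square norm_divide)
qed

lemma (in model) L2w_r: "L2w r = L2w (pweight r 0)"
proof (rule L2w_cong[OF r_lmeas pweight_lmeas, where C = 1 and C' = 1])
  show "AE x in lebesgue. \<bar>pweight r 0 x\<bar> \<le> 1 * \<bar>r x\<bar>" "AE x in lebesgue. \<bar>r x\<bar> \<le> 1 * \<bar>pweight r 0 x\<bar>"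
    using AE_nonzero by (eventually_elim, simp add: pweight_def)+
qed

lemma (in model) abs_weights: "\<bar>r_minus r x\<bar> = pweight r (-1) x" "\<bar>r_plus r x\<bar> = pweight r 1 x"
  "\<bar>omega r \<alpha> x\<bar> = pweight r (\<alpha> / 2) x"
  by (simp_all add: r_minus_def r_plus_def omega_def pweight_def abs_mult powr_minus divide_simps powr_half_sqrt_powr)

lemma L2w_abs: "L2w w = L2w (\<lambda>x. \<bar>w x\<bar>)"
proof (rule set_eqI)
  fix F :: fclass
  obtain f where "lmeas f" "F = fclass_of f" by (rule fclass_cases)
  then show "F \<in> L2w w \<longleftrightarrow> F \<in> L2w (\<lambda>x. \<bar>w x\<bar>)" by (simp add: mem_L2w_iff)
qed

lemma (in model) L2w_r_minus: "L2w (r_minus r) = L2w (pweight r (-1))"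
  and L2w_r_plus: "L2w (r_plus r) = L2w (pweight r 1)"
  and L2w_omega: "L2w (omega r \<alpha>) = L2w (pweight r (\<alpha> / 2))"
  using L2w_abs[of "r_minus r"] L2w_abs[of "r_plus r"] L2w_abs[of "omega r \<alpha>"] by (simp_all add: abs_weights)

text \<open>
  Rationalizing, \<open>sqrt (y + 1) - sqrt y = 1 / (sqrt (y + 1) + sqrt y)\<close>, and for \<open>y = |x|\<^sup>\<alpha>\<close> bounded away from \<open>0\<close>
  the denominator is comparable to \<open>sqrt y\<close>.
\<close>
lemma (in model) L2w_eta:
  assumes "0 \<le> \<alpha>"
  shows "L2w (eta r \<alpha>) = L2w (pweight r (- \<alpha> / 2))"
proof -
  \<comment> \<open>The supremum of \<open>(sqrt (y + 1) + sqrt y) / sqrt y\<close> over \<open>y \<ge> \<epsilon>\<^sup>\<alpha>\<close>.\<close>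
  define c where "c = 1 + sqrt (1 + eps powr (- \<alpha>))"
  have recip: "1 / b \<le> c * (1 / a)" if "a \<le> c * b" "0 < a" "0 < b" for a b
    using that by (simp add: field_simps)
  have *: "AE x in lebesgue. \<bar>eta r \<alpha> x\<bar> \<le> \<bar>pweight r (- \<alpha> / 2) x\<bar> \<and> \<bar>pweight r (- \<alpha> / 2) x\<bar> \<le> c * \<bar>eta r \<alpha> x\<bar>"
    using AE_sign
  proof eventually_elim
    case (elim x)
    show ?case
    proof (cases "r x = 0")
      case False
      with elim have x: "eps < \<bar>x\<bar>" by auto
      define y where "y = \<bar>x\<bar> powr \<alpha>"
      have y: "0 < y" using x eps_pos by (simp add: y_def)
      have ey: "1 / y \<le> eps powr (- \<alpha>)"
        using powr_mono2'[of \<alpha> eps "\<bar>x\<bar>"] x eps_pos assms powr_mono2'[of "- \<alpha>" eps "\<bar>x\<bar>"]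
        by (simp add: y_def powr_minus divide_simps)
      have q: "\<bar>x\<bar> powr (- \<alpha> / 2) = 1 / sqrt y"
        by (simp add: y_def powr_half_sqrt_powr[symmetric] powr_minus divide_simps)
      have pos: "0 < sqrt y" "0 < sqrt (y + 1)" using y by auto
      have "(sqrt (y + 1) - sqrt y) * (sqrt (y + 1) + sqrt y) = 1"
        using y by (simp add: algebra_simps)
      then have diff: "sqrt (y + 1) - sqrt y = 1 / (sqrt (y + 1) + sqrt y)"
        using add_pos_pos[OF pos(2,1)] by (simp add: eq_divide_eq)
      have up: "1 / (sqrt (y + 1) + sqrt y) \<le> 1 / sqrt y"
        using pos by (intro divide_left_mono mult_pos_pos add_pos_pos) auto
      have "sqrt (y + 1) + sqrt y = (1 + sqrt (1 + 1 / y)) * sqrt y"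
        using y by (simp add: distrib_right real_sqrt_mult[symmetric] add.commute)
      also have "\<dots> \<le> c * sqrt y"
        unfolding c_def using ey pos by (intro mult_right_mono add_left_mono real_sqrt_le_mono) auto
      finally have "sqrt (y + 1) + sqrt y \<le> c * sqrt y" .
      then have lo: "1 / sqrt y \<le> c * (1 / (sqrt (y + 1) + sqrt y))"
        using pos add_pos_pos[OF pos(2,1)] by (intro recip)
      have eta: "\<bar>eta r \<alpha> x\<bar> = 1 / (sqrt (y + 1) + sqrt y) * \<bar>r x\<bar>"
        unfolding eta_def y_def[symmetric] diff using pos by (simp add: abs_mult)
      have pw: "\<bar>pweight r (- \<alpha> / 2) x\<bar> = 1 / sqrt y * \<bar>r x\<bar>"
        unfolding pweight_def q using pos by (simp add: abs_mult)
      show ?thesis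
        unfolding eta pw using mult_right_mono[OF up, of "\<bar>r x\<bar>"] mult_right_mono[OF lo, of "\<bar>r x\<bar>"]
        by (simp add: mult.assoc)
    qed (simp add: eta_def pweight_def)
  qed
  have "lmeas (eta r \<alpha>)"
    unfolding eta_def[abs_def] using r_lmeas lmeas_powr[of \<alpha>] by measurable
  moreover have "AE x in lebesgue. \<bar>pweight r (- \<alpha> / 2) x\<bar> \<le> c * \<bar>eta r \<alpha> x\<bar>"
    using * by eventually_elim simp
  moreover have "AE x in lebesgue. \<bar>eta r \<alpha> x\<bar> \<le> 1 * \<bar>pweight r (- \<alpha> / 2) x\<bar>"
    using * by eventually_elim simp
  ultimately show ?thesis by (intro L2w_cong[OF _ pweight_lmeas])
qed

section \<open>Domains and values of the forms\<close>

lemma symmetric_sesquilinear_operator_form: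
  assumes H: "hilbert_space H" and T: "self_adjoint H T"
  shows "symmetric_sesquilinear (operator_form H T)"
proof -
  note L = linear_operatorD[OF self_adjoint_linear[OF T]]
  note S = symmetric_sesquilinearD[OF hilbert_spaceD(1)[OF H]]
  show ?thesis
    unfolding symmetric_sesquilinear_def operator_form_def form.sel
  proof (intro conjI ballI allI)
    show "csubspace (op_dom T)" by (rule L(1))
  next
    fix u v w assume "u \<in> op_dom T" "v \<in> op_dom T" "w \<in> op_dom T"
    then show "form_val H (op_app T (u + v)) w = form_val H (op_app T u) w + form_val H (op_app T v) w"
      using L S(2)[of "op_app T u" "op_app T v" w] by simp
  next
    fix c u v assume "u \<in> op_dom T" "v \<in> op_dom T"
    then show "form_val H (op_app T (c *\<^sub>C u)) v = c * form_val H (op_app T u) v"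
      using L S(3)[of "op_app T u" v c] by simp
  next
    fix u v assume uv: "u \<in> op_dom T" "v \<in> op_dom T"
    have "form_val H (op_app T v) u = form_val H v (op_app T u)"
      by (rule self_adjoint_symmetric[OF T uv(2,1)])
    also have "\<dots> = cnj (form_val H (op_app T u) v)"
      by (rule S(4)[OF L(3)[OF uv(1)] L(2)[OF uv(2)]])
    finally show "form_val H (op_app T v) u = cnj (form_val H (op_app T u) v)" .
  qed
qed

lemma shifted_form_0: "shifted_form H s 0 = s"
  by (cases s) (simp add: shifted_form_def)

lemma wprod_on_tendsto:
  assumes f: "lmeas f" and g: "lmeas g"
    and int: "integrable lebesgue (\<lambda>x. f x * cnj (g x) * complex_of_real (w x))"
  shows "(\<lambda>k. wprod_on {- real k..real k} w (fclass_of f) (fclass_of g))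
    \<longlonglongrightarrow> wprod w (fclass_of f) (fclass_of g)"
proof -
  let ?h = "\<lambda>x. f x * cnj (g x) * complex_of_real (w x)"
  have m: "lmeas ?h" using int by (rule borel_measurable_integrable)
  have "(\<lambda>k. LINT x|lebesgue. indicat_real {- real k..real k} x *\<^sub>R ?h x) \<longlonglongrightarrow> integral\<^sup>L lebesgue ?h"
  proof (rule integral_dominated_convergence[where w = "\<lambda>x. norm (?h x)"])
    show "integrable lebesgue (\<lambda>x. norm (?h x))" using int by (rule integrable_norm)
    show "lmeas ?h" by (rule m)
    show "lmeas (\<lambda>x. indicat_real {- real k..real k} x *\<^sub>R ?h x)" for k
      by (intro borel_measurable_scaleR borel_measurable_indicator m) simp
    show "AE x in lebesgue. (\<lambda>k. indicat_real {- real k..real k} x *\<^sub>R ?h x) \<longlonglongrightarrow> ?h x"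
    proof (intro AE_I2 tendsto_eventually)
      fix x :: real
      obtain N where "\<bar>x\<bar> \<le> real N" using real_arch_simple by blast
      then show "\<forall>\<^sub>F k in sequentially. indicat_real {- real k..real k} x *\<^sub>R ?h x = ?h x"
        by (auto simp: eventually_sequentially indicator_def intro!: exI[of _ N])
    qed
    show "AE x in lebesgue. norm (indicat_real {- real k..real k} x *\<^sub>R ?h x) \<le> norm (?h x)" for k
      by (intro AE_I2) (simp add: indicator_def)
  qed
  then show ?thesis by (simp add: wprod_on_of f g set_lebesgue_integral_def)
qed

text \<open>
  An integral depends only on the even part of the integrand.
\<close>
lemma integral_symmetrize:
  fixes h1 h2 :: "real \<Rightarrow> complex"
  assumes i: "integrable lebesgue h1" "integrable lebesgue h2"
    and eq: "AE x in lebesgue. h1 x + h1 (- x) = h2 x + h2 (- x)"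
  shows "integral\<^sup>L lebesgue h1 = integral\<^sup>L lebesgue h2"
proof -
  have *: "(LINT x|lebesgue. h x + h (- x)) = 2 * integral\<^sup>L lebesgue h" if h: "integrable lebesgue h"
    for h :: "real \<Rightarrow> complex"
  proof -
    have "integrable lebesgue (\<lambda>x. h (- x))"
      using lebesgue_integrable_real_affine_iff[of "-1" h 0] h by simp
    moreover have "(LINT x|lebesgue. h (- x)) = integral\<^sup>L lebesgue h"
      using lebesgue_integral_real_affine[of "-1" h 0] by simp
    ultimately show ?thesis using h by simp
  qed
  have "(LINT x|lebesgue. h1 x + h1 (- x)) = (LINT x|lebesgue. h2 x + h2 (- x))"
    by (rule AE_eq_integrable_lebesgue(2)[OF eq])
  then show ?thesis by (simp add: *[OF i(1)] *[OF i(2)])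
qed

lemma balance_of:
  assumes f: "lmeas f"
  shows "lmeas (\<lambda>x. complex_of_real (\<bar>x\<bar> powr (- s)) * ((f x + f (- x)) / 2)
      + complex_of_real (\<bar>x\<bar> powr s) * ((f x - f (- x)) / 2))"
    and "balance s (fclass_of f) = fclass_of (\<lambda>x. complex_of_real (\<bar>x\<bar> powr (- s)) * ((f x + f (- x)) / 2)
      + complex_of_real (\<bar>x\<bar> powr s) * ((f x - f (- x)) / 2))"
proof -
  note [measurable] = f measurable_reflect_lebesgue[OF f] lmeas_powr
  have M: "lmeas (\<lambda>x. (f x + f (- x)) / 2)" "lmeas (\<lambda>x. (f x - f (- x)) / 2)" by measurable
  note [measurable] = M
  have N: "lmeas (\<lambda>x. complex_of_real (\<bar>x\<bar> powr (- s)) * ((f x + f (- x)) / 2))"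
    "lmeas (\<lambda>x. complex_of_real (\<bar>x\<bar> powr s) * ((f x - f (- x)) / 2))" by measurable
  show "lmeas (\<lambda>x. complex_of_real (\<bar>x\<bar> powr (- s)) * ((f x + f (- x)) / 2)
      + complex_of_real (\<bar>x\<bar> powr s) * ((f x - f (- x)) / 2))" using N by measurable
  show "balance s (fclass_of f) = fclass_of (\<lambda>x. complex_of_real (\<bar>x\<bar> powr (- s)) * ((f x + f (- x)) / 2)
      + complex_of_real (\<bar>x\<bar> powr s) * ((f x - f (- x)) / 2))"
    unfolding balance_def pmult_def fclass_of_maps(5,6)[OF f] fclass_of_maps(3)[OF M(1) lmeas_powr]
      fclass_of_maps(3)[OF M(2) lmeas_powr] fclass_of_ops[OF N] by (rule refl)
qed

text \<open>
  The symmetrization of \<open>f g\<^sup>* r\<close> with odd \<open>r\<close>, where \<open>p = f x\<close>, \<open>p' = f (-x)\<close> and similarly for \<open>g\<close>,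
  contains only products of an even and an odd part.  If the even parts are scaled by \<open>a\<close> and the odd
  parts by \<open>b = 1/a\<close>, these products do not change.
\<close>
lemma balance_cross_terms:
  fixes p p' q q' :: complex
  assumes "a * b = (1::real)"
  shows "p * cnj q - p' * cnj q' =
    (of_real a * ((p + p') / 2) + of_real b * ((p - p') / 2)) * cnj (of_real a * ((q + q') / 2) + of_real b * ((q - q') / 2))
    - (of_real a * ((p' + p) / 2) + of_real b * ((p' - p) / 2)) * cnj (of_real a * ((q' + q) / 2) + of_real b * ((q' - q) / 2))"
proof -
  define u v U V where "u = (p + p') / 2" "v = (p - p') / 2" "U = cnj ((q + q') / 2)" "V = cnj ((q - q') / 2)"
  have e: "p = u + v" "p' = u - v" "cnj q = U + V" "cnj q' = U - V"
    "(p' + p) / 2 = u" "(p' - p) / 2 = - v" "cnj ((q' + q) / 2) = U" "cnj ((q' - q) / 2) = - V"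
    by (simp_all add: u_v_U_V_def field_simps)
  have ab: "complex_of_real a * complex_of_real b = 1"
    using assms by (metis of_real_1 of_real_mult)
  have "(of_real a * u + of_real b * v) * (of_real a * U + of_real b * V) -
      (of_real a * u + of_real b * (- v)) * (of_real a * U + of_real b * (- V)) =
      2 * (complex_of_real a * complex_of_real b) * (u * V + v * U)"
    by (simp add: algebra_simps)
  also have "\<dots> = p * cnj q - p' * cnj q'"
    unfolding ab e(1-4) by (simp add: algebra_simps)
  finally show ?thesis
    unfolding complex_cnj_add complex_cnj_mult complex_cnj_complex_of_real u_v_U_V_def[symmetric] e(5-8)
    by (simp only:)
qed

lemma (in model) r_minus_lmeas: "lmeas (r_minus r)"
  unfolding r_minus_def[abs_def] using r_lmeas lmeas_ident by measurable

lemma (in model) r_minus_nonneg: "AE x in lebesgue. 0 \<le> r_minus r x"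
  using AE_sign
proof eventually_elim
  case (elim x)
  then show ?case
    by (auto simp: r_minus_def zero_le_divide_iff sgn_if split: if_splits)
qed

lemma (in model) model_hilbert: "hilbert_space (model_space r)"
  unfolding model_space_def by (rule hilbert_space_L2w[OF r_minus_lmeas r_minus_nonneg])

lemma (in model) model_hnorm: "hnorm (model_space r) F = sqrt (sqnorm (pweight r (-1)) F)"
proof -
  have "AE x in lebesgue. \<bar>r_minus r x\<bar> = \<bar>pweight r (-1) x\<bar>"
    by (simp add: abs_weights(1) pweight_nonneg)
  then show ?thesis
    unfolding model_space_def hnorm_L2w[OF r_minus_nonneg] by (simp add: sqnorm_cong_weight)
qed

lemma (in model) model_dom: "form_dom (model_space r) = L2w (pweight r (-1))"
  by (simp add: model_space_def L2w_r_minus)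

text \<open>
  The two conditions on the even and the odd part of \<open>F\<close> become one condition on its image, because the
  weight \<open>|r|\<close> is even.  That \<open>F\<close> lies in the ambient Hilbert space then follows from \<open>\<alpha>/2 \<le> 1\<close>.
\<close>
lemma (in model) dom_t_alpha:
  assumes a: "0 \<le> \<alpha>" "\<alpha> \<le> 2"
  shows "form_dom (form_t_alpha r \<alpha>) = {F. balance (\<alpha> / 4) F \<in> L2w (pweight r 0)}"
proof (rule set_eqI)
  fix F
  note C = csubspaceD[OF csubspace_L2w[OF pweight_lmeas]]
  let ?e = "pmult (- (\<alpha> / 4)) (even_part F)" and ?o = "pmult (\<alpha> / 4) (odd_part F)"
  have e: "?e \<in> L2w (pweight r 0) \<longleftrightarrow> even_part F \<in> L2w (eta r \<alpha>)"
    using pmult_L2w_iff(1)[OF r_lmeas, of "- (\<alpha> / 4)" "even_part F" 0] by (simp add: L2w_eta[OF a(1)])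
  have o: "?o \<in> L2w (pweight r 0) \<longleftrightarrow> odd_part F \<in> L2w (omega r \<alpha>)"
    using pmult_L2w_iff(1)[OF r_lmeas, of "\<alpha> / 4" "odd_part F" 0] by (simp add: L2w_omega)
  show "F \<in> form_dom (form_t_alpha r \<alpha>) \<longleftrightarrow> F \<in> {F. balance (\<alpha> / 4) F \<in> L2w (pweight r 0)}"
  proof
    assume "F \<in> form_dom (form_t_alpha r \<alpha>)"
    then show "F \<in> {F. balance (\<alpha> / 4) F \<in> L2w (pweight r 0)}"
      using e o C(2) by (auto simp: form_t_alpha_def balance_def)
  next
    assume "F \<in> {F. balance (\<alpha> / 4) F \<in> L2w (pweight r 0)}"
    then have eo: "?e \<in> L2w (pweight r 0)" "?o \<in> L2w (pweight r 0)"
      using parts_L2w_pweight(1,2)[of "balance (\<alpha> / 4) F" 0] by (simp_all add: balance_simps)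
    then have "even_part F \<in> L2w (pweight r (- \<alpha> / 2))" "odd_part F \<in> L2w (pweight r (\<alpha> / 2))"
      using e o by (simp_all add: L2w_eta[OF a(1)] L2w_omega)
    then have "even_part F \<in> L2w (pweight r (-1))" "odd_part F \<in> L2w (pweight r (-1))"
      using a by (auto intro: L2w_pweight_mono(1))
    then have "F \<in> L2w (pweight r (-1))"
      using C(2)[of "even_part F" _ "odd_part F"] by (simp add: parity_parts(1))
    with eo e o show "F \<in> form_dom (form_t_alpha r \<alpha>)"
      by (simp add: form_t_alpha_def L2w_r_minus)
  qed
qed

lemma (in model) dom_t_alpha_sub:
  "F \<in> form_dom (form_t_alpha r \<alpha>) \<Longrightarrow> F \<in> L2w (pweight r (-1))"
  by (simp add: form_t_alpha_def L2w_r_minus)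

text \<open>
  Over \<open>[-k,k]\<close> the integrands \<open>f g\<^sup>* r\<close> before and after balancing have the same even part, hence
  the same integral.  The balanced one is integrable over the whole line, which also shows that the
  limit exists.
\<close>
lemma (in model) t_alpha_val:
  assumes a: "0 \<le> \<alpha>" "\<alpha> \<le> 2"
    and FG: "F \<in> form_dom (form_t_alpha r \<alpha>)" "G \<in> form_dom (form_t_alpha r \<alpha>)"
  shows "form_val (form_t_alpha r \<alpha>) F G = wprod r (balance (\<alpha> / 4) F) (balance (\<alpha> / 4) G)"
proof -
  define s where "s = \<alpha> / 4"
  obtain f where f: "lmeas f" "F = fclass_of f" by (rule fclass_cases)
  obtain g where g: "lmeas g" "G = fclass_of g" by (rule fclass_cases)
  define b where "b f x = complex_of_real (\<bar>x\<bar> powr (- s)) * ((f x + f (- x)) / 2)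
      + complex_of_real (\<bar>x\<bar> powr s) * ((f x - f (- x)) / 2)" for f :: "real \<Rightarrow> complex" and x
  have bm: "lmeas (b f)" "lmeas (b g)" and b: "balance s F = fclass_of (b f)" "balance s G = fclass_of (b g)"
    using balance_of f g by (simp_all add: b_def[abs_def])
  have bL: "fclass_of (b f) \<in> L2w r" "fclass_of (b g) \<in> L2w r"
    using FG dom_t_alpha[OF a] by (simp_all add: b[symmetric] L2w_r s_def)
  have FGH: "fclass_of f \<in> L2w (r_minus r)" "fclass_of g \<in> L2w (r_minus r)"
    using FG by (simp_all add: form_t_alpha_def f g)
  let ?h1 = "\<lambda>x. f x * cnj (g x) * complex_of_real (r x)"
  let ?h2 = "\<lambda>x. b f x * cnj (b g x) * complex_of_real (r x)"
  have i2: "integrable lebesgue ?h2" by (rule integrable_wprod[OF r_lmeas bm(1) bL(1) bm(2) bL(2)])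
  note i1 = integrable_wprod[OF r_minus_lmeas f(1) FGH(1) g(1) FGH(2)]
  have sym: "AE x in lebesgue. ?h1 x + ?h1 (- x) = ?h2 x + ?h2 (- x)"
    using AE_odd AE_nonzero
  proof eventually_elim
    case (elim x)
    have "\<bar>x\<bar> powr (- s) * \<bar>x\<bar> powr s = 1" using elim by (simp add: powr_add[symmetric])
    from balance_cross_terms[OF this, of "f x" "g x" "f (- x)" "g (- x)"]
    have "f x * cnj (g x) - f (- x) * cnj (g (- x)) = b f x * cnj (b g x) - b f (- x) * cnj (b g (- x))"
      by (simp only: b_def minus_minus abs_minus_cancel)
    then have "(f x * cnj (g x) - f (- x) * cnj (g (- x))) * complex_of_real (r x) =
        (b f x * cnj (b g x) - b f (- x) * cnj (b g (- x))) * complex_of_real (r x)" by (simp only:)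
    then show ?case using elim by (simp add: left_diff_distrib)
  qed
  have "wprod_on {- real k..real k} r (fclass_of f) (fclass_of g) =
      wprod_on {- real k..real k} r (fclass_of (b f)) (fclass_of (b g))" for k
    unfolding wprod_on_of[OF f(1) g(1)] wprod_on_of[OF bm] set_lebesgue_integral_def
  proof (rule integral_symmetrize)
    let ?i = "indicat_real {- real k..real k}"
    show "integrable lebesgue (\<lambda>x. ?i x *\<^sub>R ?h2 x)"
      by (rule integrable_mult_indicator[OF _ i2]) simp
    show "integrable lebesgue (\<lambda>x. ?i x *\<^sub>R ?h1 x)"
    proof (rule Bochner_Integration.integrable_bound)
      show "integrable lebesgue (\<lambda>x. real k *\<^sub>R (f x * cnj (g x) * complex_of_real (r_minus r x)))"
        using i1 by (rule integrable_scaleR_right)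
      note [measurable] = f(1) g(1) r_lmeas
      have "lmeas ?h1" by measurable
      then show "lmeas (\<lambda>x. ?i x *\<^sub>R ?h1 x)" by (intro borel_measurable_scaleR borel_measurable_indicator) simp_all
      show "AE x in lebesgue. norm (?i x *\<^sub>R ?h1 x) \<le> norm (real k *\<^sub>R (f x * cnj (g x) * complex_of_real (r_minus r x)))"
        using AE_nonzero
      proof eventually_elim
        case (elim x)
        have "\<bar>r x\<bar> = \<bar>x\<bar> * \<bar>r_minus r x\<bar>" using elim by (simp add: r_minus_def abs_divide)
        then have "\<bar>r x\<bar> \<le> real k * \<bar>r_minus r x\<bar>" if "\<bar>x\<bar> \<le> real k"
          using that by (simp add: mult_right_mono)
        then have "cmod (f x) * cmod (g x) * (?i x * \<bar>r x\<bar>) \<le> cmod (f x) * cmod (g x) * (real k * \<bar>r_minus r x\<bar>)"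
          by (intro mult_left_mono) (auto simp: indicator_def abs_le_iff)
        then show ?case by (simp add: norm_mult mult_ac)
      qed
    qed
    show "AE x in lebesgue. ?i x *\<^sub>R ?h1 x + ?i (- x) *\<^sub>R ?h1 (- x) = ?i x *\<^sub>R ?h2 x + ?i (- x) *\<^sub>R ?h2 (- x)"
      using sym
    proof eventually_elim
      case (elim x)
      have "?i (- x) = ?i x" by (auto simp: indicator_def)
      with elim show ?case by (simp only: scaleR_add_right[symmetric])
    qed
  qed
  moreover have "(\<lambda>k. wprod_on {- real k..real k} r (fclass_of (b f)) (fclass_of (b g)))
      \<longlonglongrightarrow> wprod r (fclass_of (b f)) (fclass_of (b g))"
    by (rule wprod_on_tendsto[OF bm i2])
  ultimately show ?thesis
    by (simp add: form_t_alpha_def f(2)[symmetric] g(2)[symmetric] b[symmetric] s_def[symmetric] limI)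
qed

text \<open>
  If one argument is in the domain of \<open>T\<close>, the integrand \<open>f g\<^sup>* r = (x f) g\<^sup>* (r/x)\<close> is integrable
  by itself, so the truncated integrals converge to its integral.
\<close>
lemma (in model) t_alpha_val_operator:
  assumes F: "F \<in> L2w (pweight r 1)" and G: "G \<in> L2w (pweight r (-1))"
  shows "form_val (form_t_alpha r \<alpha>) F G = wprod (r_minus r) (mult_x F) G"
proof -
  obtain f where f: "lmeas f" "F = fclass_of f" by (rule fclass_cases)
  obtain g where g: "lmeas g" "G = fclass_of g" by (rule fclass_cases)
  note [measurable] = f(1) lmeas_ident
  have xf: "lmeas (\<lambda>x. complex_of_real x * f x)" by measurable
  have "mult_x F \<in> L2w (r_minus r)"
    unfolding mult_x_eq
  proof (rule mult_by_L2w(1)[OF lmeas_ident r_minus_lmeas F, where C = 1])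
    show "AE x in lebesgue. x\<^sup>2 * \<bar>r_minus r x\<bar> \<le> 1 * \<bar>pweight r 1 x\<bar>"
      using AE_nonzero
    proof eventually_elim
      case (elim x)
      have "x\<^sup>2 = \<bar>x\<bar> powr 2" using elim by simp
      then have k: "x\<^sup>2 * \<bar>x\<bar> powr (-1) = \<bar>x\<bar> powr 1" by (simp only: powr_add[symmetric]) simp
      have "x\<^sup>2 * \<bar>r_minus r x\<bar> = (x\<^sup>2 * \<bar>x\<bar> powr (-1)) * \<bar>r x\<bar>"
        by (simp only: abs_weights(1) pweight_def mult.assoc)
      then show ?case unfolding k by (simp add: pweight_def abs_mult)
    qed
    show "AE x in lebesgue. r_minus r x = 0 \<longrightarrow> pweight r 1 x = 0 \<or> x = 0"
      by (simp add: r_minus_def pweight_def)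
  qed
  then have i: "integrable lebesgue (\<lambda>x. complex_of_real x * f x * cnj (g x) * complex_of_real (r_minus r x))"
    using integrable_wprod[OF r_minus_lmeas xf _ g(1)] G by (simp add: f g fclass_of_maps L2w_r_minus)
  have eq: "AE x in lebesgue. complex_of_real x * f x * cnj (g x) * complex_of_real (r_minus r x) =
      f x * cnj (g x) * complex_of_real (r x)"
    using AE_nonzero by eventually_elim (simp add: r_minus_def)
  have "integrable lebesgue (\<lambda>x. f x * cnj (g x) * complex_of_real (r x))"
    using i AE_eq_integrable_lebesgue(1)[OF eq] by simp
  from wprod_on_tendsto[OF f(1) g(1) this]
  have "form_val (form_t_alpha r \<alpha>) F G = wprod r F G"
    by (simp add: form_t_alpha_def f g limI)
  also have "\<dots> = wprod (r_minus r) (mult_x F) G"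
    unfolding mult_x_eq wprod_mult_by[OF lmeas_ident]
  proof (rule wprod_cong_weight)
    show "AE x in lebesgue. r x = x * r_minus r x"
      using AE_nonzero by eventually_elim (simp add: r_minus_def)
  qed
  finally show ?thesis .
qed

text \<open>
  At \<open>\<alpha> = 0\<close> balancing is the identity.
\<close>
lemma (in model) form_t_alpha_0: "form_eq (form_t_alpha r 0) (form_t r)"
  unfolding form_eq_def
proof (intro conjI ballI)
  show "form_dom (form_t_alpha r 0) = form_dom (form_t r)"
    using dom_t_alpha[of 0] by (simp add: balance_simps form_t_def L2w_r)
  fix F G assume "F \<in> form_dom (form_t_alpha r 0)" "G \<in> form_dom (form_t_alpha r 0)"
  then show "form_val (form_t_alpha r 0) F G = form_val (form_t r) F G"
    using t_alpha_val[of 0 F G] by (simp add: balance_simps form_t_def)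
qed

section \<open>Closures with gap point zero\<close>

lemma (in model) balance_bounded:
  assumes G: "G \<in> L2w (pweight r q)" and p: "p + 2 * \<bar>s\<bar> \<le> q"
  shows "balance s G \<in> L2w (pweight r p)"
    and "sqnorm (pweight r p) (balance s G) \<le>
      2 * (eps powr (p - 2 * s - q) + eps powr (p + 2 * s - q)) * sqnorm (pweight r q) G"
proof -
  note parts = parts_L2w_pweight[OF G]
  have le: "p + 2 * (- s) \<le> q" "p + 2 * s \<le> q" using p by linarith+
  note e = L2w_pweight_mono[OF parts(1) le(1)] and o = L2w_pweight_mono[OF parts(2) le(2)]
  have eL: "pmult (- s) (even_part G) \<in> L2w (pweight r p)" and oL: "pmult s (odd_part G) \<in> L2w (pweight r p)"
    using e(1) o(1) by (simp_all only: pmult_L2w_iff(1)[OF r_lmeas])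
  note A = add_L2w[OF pweight_lmeas eL oL]
  show "balance s G \<in> L2w (pweight r p)" unfolding balance_def by (rule A(1))
  let ?N = "sqnorm (pweight r q) G"
  have "sqnorm (pweight r p) (pmult (- s) (even_part G)) \<le> eps powr (p - 2 * s - q) * ?N"
    using order_trans[OF e(2) mult_left_mono[OF parts(3), of "eps powr (p + 2 * (- s) - q)"]]
    by (simp add: pmult_L2w_iff(2)[OF r_lmeas])
  moreover have "sqnorm (pweight r p) (pmult s (odd_part G)) \<le> eps powr (p + 2 * s - q) * ?N"
    using order_trans[OF o(2) mult_left_mono[OF parts(4), of "eps powr (p + 2 * s - q)"]]
    by (simp add: pmult_L2w_iff(2)[OF r_lmeas])
  ultimately show "sqnorm (pweight r p) (balance s G) \<le>
      2 * (eps powr (p - 2 * s - q) + eps powr (p + 2 * s - q)) * ?N"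
    using A(2) unfolding balance_def by (simp add: algebra_simps)
qed

definition cutoff :: "nat \<Rightarrow> fclass \<Rightarrow> fclass" where
  "cutoff n = mult_by (indicat_real {- real n..real n})"

lemma lmeas_cutoff: "lmeas (indicat_real {- real n..real n})"
  by (rule borel_measurable_indicator) simp

lemma (in model) cutoff_L2w:
  assumes G: "G \<in> L2w (pweight r p)"
  shows "cutoff n G \<in> L2w (pweight r q)"
proof (cases "q \<le> p")
  case True
  have "cutoff n G \<in> L2w (pweight r p)"
    unfolding cutoff_def
    by (rule mult_by_L2w(1)[OF lmeas_cutoff pweight_lmeas G, where C = 1]) (auto simp: indicator_def)
  then show ?thesis using True by (rule L2w_pweight_mono(1))
next
  case False
  show ?thesis
    unfolding cutoff_def
  proof (rule mult_by_L2w(1)[OF lmeas_cutoff pweight_lmeas G, where C = "real n powr (q - p)"])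
    show "AE x in lebesgue. pweight r q x = 0 \<longrightarrow> pweight r p x = 0 \<or> indicat_real {- real n..real n} x = 0"
      by (simp add: pweight_def)
    have "\<bar>x\<bar> powr q * \<bar>r x\<bar> \<le> real n powr (q - p) * (\<bar>x\<bar> powr p * \<bar>r x\<bar>)" if "\<bar>x\<bar> \<le> real n" for x
    proof -
      have "\<bar>x\<bar> powr q = \<bar>x\<bar> powr (q - p) * \<bar>x\<bar> powr p" by (simp add: powr_add[symmetric])
      also have "\<dots> \<le> real n powr (q - p) * \<bar>x\<bar> powr p"
        using that False by (intro mult_right_mono powr_mono2) auto
      finally have "\<bar>x\<bar> powr q * \<bar>r x\<bar> \<le> real n powr (q - p) * \<bar>x\<bar> powr p * \<bar>r x\<bar>"
        by (rule mult_right_mono) simp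
      then show ?thesis by (simp add: mult.assoc)
    qed
    then show "AE x in lebesgue. (indicat_real {- real n..real n} x)\<^sup>2 * \<bar>pweight r q x\<bar> \<le> real n powr (q - p) * \<bar>pweight r p x\<bar>"
      by (intro AE_I2) (auto simp: indicator_def pweight_def abs_mult abs_le_iff)
  qed
qed

lemma (in model) cutoff_sqnorm_tendsto:
  assumes "F \<in> L2w (pweight r s)"
  shows "(\<lambda>n. sqnorm (pweight r s) (F - cutoff n F)) \<longlonglongrightarrow> 0"
  unfolding cutoff_def
proof (rule restriction_tendsto[OF pweight_lmeas _ _ assms])
  fix x :: real
  obtain N where "\<bar>x\<bar> \<le> real N" using real_arch_simple by blast
  then show "\<forall>\<^sub>F n in sequentially. x \<in> {- real n..real n}"
    by (auto simp: eventually_sequentially intro!: exI[of _ N])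
qed simp

lemma balance_cutoff: "balance s (cutoff n F) = cutoff n (balance s F)"
  unfolding cutoff_def by (rule balance_mult_by[OF lmeas_cutoff]) (auto simp: indicator_def)

lemma balance_diff: "balance s (F - G) = balance s F - balance s G"
proof -
  have "F - G = F + (-1) *\<^sub>C G" by simp
  then show ?thesis using balance_simps(5)[of s F "(-1) *\<^sub>C G"] balance_simps(6)[of s "-1" G] by simp
qed

lemma (in model) csubspace_dom_t_alpha:
  assumes a: "0 \<le> \<alpha>" "\<alpha> \<le> 2"
  shows "csubspace (form_dom (form_t_alpha r \<alpha>))"
  unfolding dom_t_alpha[OF a] csubspace_def
  using csubspaceD(1-3)[OF csubspace_L2w[OF pweight_lmeas]] balance_simps(6)[of _ 0 0]
  by (auto simp: balance_simps)

lemma (in model) balance_bij: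
  assumes a: "0 \<le> \<alpha>" "\<alpha> \<le> 2"
  shows "bij_betw (balance (\<alpha> / 4)) (form_dom (form_t_alpha r \<alpha>)) (L2w (pweight r 0))"
  by (rule bij_betw_byWitness[where f' = "balance (- (\<alpha> / 4))"])
    (auto simp: dom_t_alpha[OF a] balance_simps)

lemma (in model) symmetric_sesquilinear_t_alpha:
  assumes a: "0 \<le> \<alpha>" "\<alpha> \<le> 2"
  shows "symmetric_sesquilinear (form_t_alpha r \<alpha>)"
proof -
  have "symmetric_sesquilinear (Form (form_dom (form_t_alpha r \<alpha>)) (form_val (form_t_alpha r \<alpha>)))"
  proof (rule symmetric_sesquilinear_pullback[where U = "balance (\<alpha> / 4)", OF symmetric_sesquilinear_wprod[OF r_lmeas]])
    show "csubspace (form_dom (form_t_alpha r \<alpha>))" by (rule csubspace_dom_t_alpha[OF a])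
  qed (auto simp: dom_t_alpha[OF a] balance_simps t_alpha_val[OF a] L2w_r)
  then show ?thesis by simp
qed

lemma lmeas_sgn: "lmeas (sgn :: real \<Rightarrow> real)"
  by (rule measurable_completion) measurable

text \<open>
  In \<open>L\<^sup>2\<^sub>r\<close>, with the form \<open>\<integral> f g\<^sup>* r\<close>, multiplication by \<open>sgn\<close> is a fundamental symmetry and the norm is
  that of the weight \<open>|r|\<close>.  Both are pulled back along \<open>balance (\<alpha>/4)\<close>.
\<close>
lemma (in model) krein_t_alpha:
  assumes a: "0 \<le> \<alpha>" "\<alpha> \<le> 2"
  obtains P M where "krein_decomposition (form_t_alpha r \<alpha>) P M"
    "\<And>F. F \<in> form_dom (form_t_alpha r \<alpha>) \<Longrightarrow>
      krein_norm (form_t_alpha r \<alpha>) P M F = sqrt (sqnorm (pweight r 0) (balance (\<alpha> / 4) F))"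
proof -
  let ?K = "form_t_alpha r \<alpha>" and ?U = "balance (\<alpha> / 4)" and ?V = "balance (- (\<alpha> / 4))"
  note dom = dom_t_alpha[OF a]
  define J where "J F = ?V (mult_by sgn (?U F))" for F
  have UJ: "?U (J F) = mult_by sgn (?U F)" for F by (simp add: J_def balance_simps)
  have sgn_L2w: "mult_by sgn F \<in> L2w (pweight r 0)" if "F \<in> L2w (pweight r 0)" for F
    by (rule mult_by_L2w(1)[OF lmeas_sgn pweight_lmeas that, where C = 1]) (auto simp: sgn_if)
  have sgn_sgn: "mult_by sgn (mult_by sgn F) = F" for F
    unfolding mult_by_simps(4)[OF lmeas_sgn lmeas_sgn]
  proof (rule mult_by_id)
    show "lmeas (\<lambda>x::real. sgn x * sgn x)" using lmeas_sgn by measurable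
    show "AE x::real in lebesgue. sgn x * sgn x = 1" using AE_nonzero by eventually_elim (simp add: sgn_if)
  qed
  have JD: "J F \<in> form_dom ?K" if "F \<in> form_dom ?K" for F
    using that sgn_L2w by (simp add: dom UJ)
  have val: "form_val ?K (J F) G = wprod (pweight r 0) (?U F) (?U G)"
    if "F \<in> form_dom ?K" "G \<in> form_dom ?K" for F G
  proof -
    \<comment> \<open>This equality is why \<open>sgn\<close> makes the form positive.\<close>
    have "AE x in lebesgue. sgn x * r x = pweight r 0 x"
      using AE_sign AE_nonzero by eventually_elim (auto simp: pweight_def sgn_if split: if_splits)
    then show ?thesis
      unfolding t_alpha_val[OF a JD[OF that(1)] that(2)] UJ wprod_mult_by[OF lmeas_sgn]
      by (rule wprod_cong_weight)
  qed
  have nn: "AE x in lebesgue. 0 \<le> pweight r 0 x" by (simp add: pweight_nonneg)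
  note pull = hilbert_space_pullback[where U = ?U and f = "\<lambda>u v. form_val ?K (J u) v",
      OF hilbert_space_L2w[OF pweight_lmeas nn] csubspace_dom_t_alpha[OF a], simplified,
      OF balance_bij[OF a] balance_simps(5,6) val]
  note K = krein_of_symmetry[where J = J, OF symmetric_sesquilinear_t_alpha[OF a] JD _ _ _ pull(1)]
  have J_lin: "J (F + G) = J F + J G" "J (c *\<^sub>C F) = c *\<^sub>C J F" "J (J F) = F" for F G c
    by (simp_all add: J_def balance_simps mult_by_simps(1,3)[OF lmeas_sgn] sgn_sgn)
  show thesis
    by (rule that[OF K(1) trans[OF K(2)]]) (simp_all add: J_lin pull(2) hnorm_L2w[OF nn])
qed

lemma (in model) dom_T_subset:
  assumes a: "0 \<le> \<alpha>" "\<alpha> \<le> 2"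
  shows "L2w (pweight r 1) \<subseteq> form_dom (form_t_alpha r \<alpha>)"
  using balance_bounded(1)[of _ 1 0 "\<alpha> / 4"] a by (auto simp: dom_t_alpha[OF a])

lemma (in model) gap_point_t_alpha:
  assumes a: "0 \<le> \<alpha>" "\<alpha> \<le> 2"
  shows "gap_point (model_space r) (form_t_alpha r \<alpha>) 0"
proof -
  obtain P M where PM: "krein_decomposition (form_t_alpha r \<alpha>) P M"
    "\<And>F. F \<in> form_dom (form_t_alpha r \<alpha>) \<Longrightarrow>
      krein_norm (form_t_alpha r \<alpha>) P M F = sqrt (sqnorm (pweight r 0) (balance (\<alpha> / 4) F))"
    using krein_t_alpha[OF a] by blast
  \<comment> \<open>The constant of \<open>balance_bounded\<close> for the exponents \<open>p = -1\<close> and \<open>q = 0\<close> and the inverse map.\<close>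
  define C where "C = 2 * (eps powr (-1 - 2 * - (\<alpha> / 4) - 0) + eps powr (-1 + 2 * - (\<alpha> / 4) - 0))"
  have bound: "hnorm (model_space r) F \<le> sqrt C * krein_norm (form_t_alpha r \<alpha>) P M F"
    if F: "F \<in> form_dom (form_t_alpha r \<alpha>)" for F
  proof -
    have "balance (\<alpha> / 4) F \<in> L2w (pweight r 0)" using F by (simp add: dom_t_alpha[OF a])
    from balance_bounded(2)[OF this, of "-1" "- (\<alpha> / 4)"] a
    have "sqnorm (pweight r (-1)) F \<le> C * sqnorm (pweight r 0) (balance (\<alpha> / 4) F)"
      unfolding C_def by (simp add: balance_simps)
    then have "sqrt (sqnorm (pweight r (-1)) F) \<le> sqrt (C * sqnorm (pweight r 0) (balance (\<alpha> / 4) F))"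
      by (rule real_sqrt_le_mono)
    then show ?thesis by (simp add: model_hnorm PM(2)[OF F] real_sqrt_mult)
  qed
  have sub: "form_dom (form_t_alpha r \<alpha>) \<subseteq> form_dom (model_space r)"
    using dom_t_alpha_sub by (auto simp: model_dom)
  show ?thesis
    unfolding gap_point_def shifted_form_0 krein_space_def krein_continuously_embedded_def
    using symmetric_sesquilinear_t_alpha[OF a] PM(1) sub bound by blast
qed

lemma (in model) pmult_self_adjoint:
  assumes "0 \<le> t"
  shows "self_adjoint (model_space r) (Operator (L2w (pweight r (2 * t - 1))) (pmult t))"
proof -
  have "{F \<in> L2w (r_minus r). mult_by (\<lambda>x. \<bar>x\<bar> powr t) F \<in> L2w (r_minus r)} = L2w (pweight r (2 * t - 1))"
    using pmult_L2w_iff(1)[OF r_lmeas, of t _ "-1"] L2w_pweight_mono(1)[of _ "2 * t - 1" "-1"] assms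
    by (auto simp: L2w_r_minus pmult_def[symmetric])
  then show ?thesis
    using self_adjoint_mult_by[OF r_minus_lmeas r_minus_nonneg lmeas_powr[of t]]
    by (simp add: model_space_def pmult_def)
qed

lemma (in model) mult_x_L2w_iff:
  "mult_x F \<in> L2w (pweight r s) \<longleftrightarrow> F \<in> L2w (pweight r (s + 2))"
  "sqnorm (pweight r s) (mult_x F) = sqnorm (pweight r (s + 2)) F"
proof -
  have sgn_L2w: "mult_by sgn F \<in> L2w (pweight r s)" if "F \<in> L2w (pweight r s)" for F s
    by (rule mult_by_L2w(1)[OF lmeas_sgn pweight_lmeas that, where C = 1]) (auto simp: sgn_if)
  have x: "mult_x F = mult_by sgn (pmult 1 F)" "pmult 1 F = mult_by sgn (mult_x F)" for F
  proof -
    have "(\<lambda>x::real. x) = (\<lambda>x. sgn x * \<bar>x\<bar> powr 1)" by (simp add: fun_eq_iff sgn_mult_abs)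
    then show "mult_x F = mult_by sgn (pmult 1 F)"
      by (simp only: mult_x_eq pmult_def mult_by_simps(4)[OF lmeas_sgn lmeas_powr])
    have "(\<lambda>x::real. \<bar>x\<bar> powr 1) = (\<lambda>x. sgn x * x)" by (auto simp: fun_eq_iff sgn_if)
    then show "pmult 1 F = mult_by sgn (mult_x F)"
      by (simp only: mult_x_eq pmult_def mult_by_simps(4)[OF lmeas_sgn lmeas_ident])
  qed
  have "mult_x F \<in> L2w (pweight r s) \<longleftrightarrow> pmult 1 F \<in> L2w (pweight r s)"
    using x[of F] sgn_L2w by metis
  then show "mult_x F \<in> L2w (pweight r s) \<longleftrightarrow> F \<in> L2w (pweight r (s + 2))"
    using pmult_L2w_iff(1)[OF r_lmeas, of 1 F s] by simp
  have "sqnorm (pweight r s) (mult_x F) = sqnorm (pweight r s) (pmult 1 F)"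
    unfolding mult_x_eq pmult_def sqnorm_mult_by[OF lmeas_ident] sqnorm_mult_by[OF lmeas_powr] by simp
  then show "sqnorm (pweight r s) (mult_x F) = sqnorm (pweight r (s + 2)) F"
    by (simp add: pmult_L2w_iff(2)[OF r_lmeas])
qed

lemma (in model) model_operator_self_adjoint: "self_adjoint (model_space r) (model_operator r)"
proof -
  have "{F \<in> L2w (r_minus r). mult_by (\<lambda>x. x) F \<in> L2w (r_minus r)} = L2w (r_plus r)"
    using mult_x_L2w_iff(1)[of _ "-1"] L2w_pweight_mono(1)[of _ 1 "-1"]
    by (auto simp: L2w_r_minus L2w_r_plus mult_x_eq[symmetric])
  moreover have "mult_by (\<lambda>x. x) = mult_x" by (simp add: fun_eq_iff mult_x_eq)
  ultimately show ?thesis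
    using self_adjoint_mult_by[OF r_minus_lmeas r_minus_nonneg lmeas_ident]
    by (simp add: model_space_def model_operator_def)
qed

lemma (in model) model_operator_boundedly_invertible:
  "boundedly_invertible (model_space r) (model_operator r)"
proof -
  have inv: "lmeas (\<lambda>x::real. inverse x)" using lmeas_ident by measurable
  have ae: "AE x::real in lebesgue. inverse x * x = 1" "AE x::real in lebesgue. x * inverse x = 1"
    using AE_nonzero by (eventually_elim, simp)+
  have one: "mult_by inverse (mult_x F) = F" "mult_x (mult_by inverse F) = F" for F
    unfolding mult_x_eq mult_by_simps(4)[OF inv lmeas_ident] mult_by_simps(4)[OF lmeas_ident inv]
    by (rule mult_by_id[OF borel_measurable_times[OF inv lmeas_ident] ae(1)],
        rule mult_by_id[OF borel_measurable_times[OF lmeas_ident inv] ae(2)])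
  have "bij_betw mult_x (L2w (pweight r 1)) (L2w (pweight r (-1)))"
  proof (rule bij_betw_byWitness[where f' = "mult_by inverse"])
    show "mult_x ` L2w (pweight r 1) \<subseteq> L2w (pweight r (-1))" using mult_x_L2w_iff(1)[of _ "-1"] by auto
    show "mult_by inverse ` L2w (pweight r (-1)) \<subseteq> L2w (pweight r 1)"
      using mult_x_L2w_iff(1)[of "mult_by inverse _" "-1"] by (auto simp: one)
  qed (simp_all add: one)
  moreover have "hnorm (model_space r) F \<le> sqrt (eps powr (-1 - 1)) * hnorm (model_space r) (mult_x F)"
    if F: "F \<in> L2w (pweight r 1)" for F
    using real_sqrt_le_mono[OF L2w_pweight_mono(2)[OF F, of "-1"]]
    by (simp add: model_hnorm mult_x_L2w_iff(2) real_sqrt_mult)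
  ultimately show ?thesis
    unfolding boundedly_invertible_def model_dom by (auto simp: model_operator_def L2w_r_plus)
qed

lemma (in model) dense_in_model:
  assumes "L2w (pweight r 1) \<subseteq> D" "D \<subseteq> L2w (pweight r (-1))"
  shows "dense_wrt (hnorm (model_space r)) D (form_dom (model_space r))"
  unfolding dense_wrt_def model_dom
proof (intro conjI ballI allI impI)
  fix F :: fclass and e :: real assume F: "F \<in> L2w (pweight r (-1))" and e: "e > 0"
  have "\<forall>\<^sub>F n in sequentially. sqnorm (pweight r (-1)) (F - cutoff n F) < e\<^sup>2"
    by (rule order_tendstoD(2)[OF cutoff_sqnorm_tendsto[OF F]]) (use e in simp)
  then obtain n where "sqnorm (pweight r (-1)) (F - cutoff n F) < e\<^sup>2"
    by (auto simp: eventually_sequentially)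
  then have "hnorm (model_space r) (F - cutoff n F) < e"
    using e by (simp add: model_hnorm real_less_lsqrt sqnorm_nonneg)
  then show "\<exists>v\<in>D. hnorm (model_space r) (F - v) < e"
    using cutoff_L2w[OF F] assms(1) by blast
qed (use assms in auto)

lemma (in model) form_in_t_alpha:
  assumes a: "0 \<le> \<alpha>" "\<alpha> \<le> 2"
  shows "form_in (model_space r) (form_t_alpha r \<alpha>)"
  unfolding form_in_def
  using model_hilbert symmetric_sesquilinear_t_alpha[OF a] dense_in_model[OF dom_T_subset[OF a]] dom_t_alpha_sub
  by blast

text \<open>
  Cutting off at \<open>|x| = n\<close> leads from the domain of the form into that of \<open>T\<close>.  The Krein norm of the
  error is, after balancing, the error of the same cutoff in \<open>L\<^sup>2\<^sub>|\<^sub>r\<^sub>|\<close>.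
\<close>
lemma (in model) closure_t_alpha:
  assumes a: "0 \<le> \<alpha>" "\<alpha> \<le> 2"
  shows "closure_with_gap_point (model_space r) (form_t_alpha r \<alpha>)
    (operator_form (model_space r) (model_operator r)) 0"
proof -
  let ?s0 = "operator_form (model_space r) (model_operator r)" and ?K = "form_t_alpha r \<alpha>"
  have dom0: "form_dom ?s0 = L2w (pweight r 1)"
    by (simp add: operator_form_def model_operator_def L2w_r_plus)
  have sub: "L2w (pweight r 1) \<subseteq> L2w (pweight r (-1))" using L2w_pweight_mono(1) by auto
  have "form_in (model_space r) ?s0"
    unfolding form_in_def dom0
    using model_hilbert symmetric_sesquilinear_operator_form[OF model_hilbert model_operator_self_adjoint]
      dense_in_model[OF order_refl sub] by blast
  moreover have "closed_form (model_space r) ?K"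
    unfolding closed_form_def using form_in_t_alpha[OF a] gap_point_t_alpha[OF a] by blast
  moreover have "form_extends ?K ?s0"
    unfolding form_extends_def dom0
    using dom_T_subset[OF a] sub t_alpha_val_operator
    by (auto simp: operator_form_def model_operator_def model_space_def)
  moreover note gap_point_t_alpha[OF a]
  moreover have "krein_dense (form_dom ?s0) (shifted_form (model_space r) ?K 0)"
  proof -
    obtain P M where PM: "krein_decomposition ?K P M"
      "\<And>F. F \<in> form_dom ?K \<Longrightarrow> krein_norm ?K P M F = sqrt (sqnorm (pweight r 0) (balance (\<alpha> / 4) F))"
      using krein_t_alpha[OF a] by blast
    have "dense_wrt (krein_norm ?K P M) (L2w (pweight r 1)) (form_dom ?K)"
      unfolding dense_wrt_def
    proof (intro conjI ballI allI impI)
      show "L2w (pweight r 1) \<subseteq> form_dom ?K" by (rule dom_T_subset[OF a])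
      fix F :: fclass and e :: real assume F: "F \<in> form_dom ?K" and e: "e > 0"
      define G where "G = balance (\<alpha> / 4) F"
      have G: "G \<in> L2w (pweight r 0)" using F by (simp add: dom_t_alpha[OF a] G_def)
      have "\<forall>\<^sub>F n in sequentially. sqnorm (pweight r 0) (G - cutoff n G) < e\<^sup>2"
        by (rule order_tendstoD(2)[OF cutoff_sqnorm_tendsto[OF G]]) (use e in simp)
      then obtain n where n: "sqnorm (pweight r 0) (G - cutoff n G) < e\<^sup>2"
        by (auto simp: eventually_sequentially)
      have c1: "cutoff n F \<in> L2w (pweight r 1)" by (rule cutoff_L2w[OF dom_t_alpha_sub[OF F]])
      have "F - cutoff n F \<in> form_dom ?K"
        using csubspaceD(5)[OF csubspace_dom_t_alpha[OF a] F] dom_T_subset[OF a] c1 by blast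
      then have "krein_norm ?K P M (F - cutoff n F) = sqrt (sqnorm (pweight r 0) (G - cutoff n G))"
        by (simp add: PM(2) balance_diff balance_cutoff G_def)
      also have "\<dots> < e" using n e by (simp add: real_less_lsqrt sqnorm_nonneg)
      finally show "\<exists>v\<in>L2w (pweight r 1). krein_norm ?K P M (F - v) < e" using c1 by blast
    qed
    then show ?thesis unfolding krein_dense_def shifted_form_0 dom0 using PM(1) by blast
  qed
  ultimately show ?thesis unfolding closure_with_gap_point_def by blast
qed

lemma (in model) represents_t_alpha:
  assumes a: "0 \<le> \<alpha>" "\<alpha> \<le> 2"
  shows "represents (model_space r) (form_t_alpha r \<alpha>) (model_operator r)"
  unfolding represents_def
  using model_operator_self_adjoint dom_T_subset[OF a] t_alpha_val_operator[OF _ dom_t_alpha_sub]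
  by (auto simp: model_operator_def L2w_r_plus model_space_def)

section \<open>Regularity\<close>

text \<open>
  Used with \<open>t = 1\<close> for \<open>|T|\<close> as a root of \<open>T\<^sup>2\<close>, and with \<open>t = 1/2\<close> for the root of \<open>|T|\<close>.
\<close>
lemma (in model) pmult_nonneg_sqrt:
  assumes t: "0 \<le> t" and A: "op_dom A = {F \<in> L2w (pweight r (2 * t - 1)). pmult t F \<in> L2w (pweight r (2 * t - 1))}"
    and app: "\<And>F. op_app A F = pmult t (pmult t F)"
  shows "nonneg_sqrt (model_space r) A (Operator (L2w (pweight r (2 * t - 1))) (pmult t))"
  unfolding nonneg_sqrt_def
proof (intro conjI ballI)
  show "self_adjoint (model_space r) (Operator (L2w (pweight r (2 * t - 1))) (pmult t))"
    by (rule pmult_self_adjoint[OF t])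
  show "op_eq (op_square (Operator (L2w (pweight r (2 * t - 1))) (pmult t))) A"
    by (simp add: op_eq_def op_square_def A app)
next
  fix F
  let ?m = "\<lambda>x. \<bar>x\<bar> powr t"
  have "AE x in lebesgue. 0 \<le> ?m x * r_minus r x"
    using r_minus_nonneg by eventually_elim simp
  from wprod_abs_weight[OF this]
  have "Re (wprod (\<lambda>x. ?m x * r_minus r x) F F) = sqnorm (\<lambda>x. ?m x * r_minus r x) F"
    by (simp add: sqnorm_def)
  then show "0 \<le> Re (form_val (model_space r) (op_app (Operator (L2w (pweight r (2 * t - 1))) (pmult t)) F) F)"
    by (simp add: model_space_def pmult_def wprod_mult_by[OF lmeas_powr] sqnorm_nonneg)
qed

text \<open>
  The operators of multiplication by \<open>|x|\<close> and by \<open>|x|\<^sup>1\<^sup>/\<^sup>2\<close> are the required roots, and the latter has the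
  domain \<open>L\<^sup>2\<^sub>r\<close>.
\<close>
lemma (in model) regular_t_0: "regular_form (model_space r) (form_t_alpha r 0)"
proof -
  let ?A = "Operator (L2w (pweight r (2 * 1 - 1))) (pmult 1)"
  let ?B = "Operator (L2w (pweight r (2 * (1/2) - 1))) (pmult (1/2))"
  have "closed_form (model_space r) (form_t_alpha r 0)"
    using closure_t_alpha[of 0] by (simp add: closure_with_gap_point_def)
  moreover have "represents (model_space r) (form_t_alpha r 0) (model_operator r)"
    by (rule represents_t_alpha) simp_all
  moreover have "abs_of_self_adjoint (model_space r) (model_operator r) ?A"
    unfolding abs_of_self_adjoint_def
    by (rule pmult_nonneg_sqrt)
      (auto simp: op_square_def model_operator_def L2w_r_plus pmult_L2w_iff(1)[OF r_lmeas] mult_x_L2w_iff(1) pmult_simps(6))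
  moreover have "nonneg_sqrt (model_space r) ?A ?B"
    by (rule pmult_nonneg_sqrt)
      (auto simp: pmult_L2w_iff(1)[OF r_lmeas] pmult_simps intro: L2w_pweight_mono(1))
  moreover have "form_dom (form_t_alpha r 0) = op_dom ?B"
    using dom_t_alpha[of 0] by (simp add: balance_simps)
  ultimately show ?thesis unfolding regular_form_def by blast
qed

lemma (in model) smooth_vectors_model:
  "smooth_vectors (model_operator r) = {F. \<forall>n::nat. F \<in> L2w (pweight r (1 + 2 * real n))}"
proof -
  have "(mult_x ^^ n) F \<in> L2w (pweight r s) \<longleftrightarrow> F \<in> L2w (pweight r (s + 2 * real n))" for n F s
    by (induction n arbitrary: s) (simp_all add: mult_x_L2w_iff(1) algebra_simps)
  then show ?thesis by (simp add: smooth_vectors_def model_operator_def L2w_r_plus)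
qed

text \<open>
  Whatever roots \<open>A = |T|\<close> and \<open>B = A\<^sup>1\<^sup>/\<^sup>2\<close> are chosen, the Heinz type inequality with
  \<open>R = |x|\<^sup>1\<^sup>/\<^sup>2\<close> bounds \<open>\<parallel>B u\<parallel>\<close> by the norm of \<open>L\<^sup>2\<^sub>|\<^sub>r\<^sub>|\<close> for smooth \<open>u\<close>.  Cutoffs of an element of \<open>L\<^sup>2\<^sub>r\<close> are
  smooth, their images under \<open>B\<close> form a Cauchy sequence, and \<open>B\<close> is closed.
\<close>
lemma (in model) L2w_r_subset_sqrt_abs:
  assumes A: "abs_of_self_adjoint (model_space r) (model_operator r) A"
    and B: "nonneg_sqrt (model_space r) A B"
  shows "L2w (pweight r 0) \<subseteq> op_dom B"
proof
  fix F assume F: "F \<in> L2w (pweight r 0)"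
  let ?H = "model_space r" and ?D = "smooth_vectors (model_operator r)"
  have saB: "self_adjoint ?H B" using B by (simp add: nonneg_sqrt_def)
  have smooth: "pmult t G \<in> ?D" if "G \<in> ?D" "t \<le> 1" for G t
  proof -
    have "G \<in> L2w (pweight r (1 + 2 * real n + 2 * t))" for n
    proof (rule L2w_pweight_mono(1))
      show "G \<in> L2w (pweight r (1 + 2 * real (Suc n)))" using that(1) unfolding smooth_vectors_model by blast
      show "1 + 2 * real n + 2 * t \<le> 1 + 2 * real (Suc n)" using that(2) by simp
    qed
    then show ?thesis by (simp add: smooth_vectors_model pmult_L2w_iff(1)[OF r_lmeas])
  qed
  have low: "hnorm ?H G \<le> sqrt (eps powr (-1)) * hnorm ?H (pmult (1/2) G)" if "G \<in> ?D" for G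
  proof -
    have "G \<in> L2w (pweight r (1 + 2 * real 0))" using that unfolding smooth_vectors_model by blast
    then have "G \<in> L2w (pweight r 0)" by (rule L2w_pweight_mono(1)) simp
    from real_sqrt_le_mono[OF L2w_pweight_mono(2)[OF this, of "-1"]]
    show ?thesis by (simp add: model_hnorm pmult_L2w_iff(2)[OF r_lmeas] real_sqrt_mult[symmetric])
  qed
  have sym: "form_val ?H (pmult (1/2) G) K = form_val ?H G (pmult (1/2) K)" for G K
    by (simp add: model_space_def pmult_def wprod_mult_by[OF lmeas_powr])
  have sq: "hnorm ?H (pmult (1/2) (pmult (1/2) G)) = hnorm ?H (op_app (model_operator r) G)" for G
    by (simp add: model_hnorm model_operator_def pmult_simps mult_x_L2w_iff(2) pmult_L2w_iff(2)[OF r_lmeas])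
  have B_bound: "G \<in> op_dom B" "hnorm ?H (op_app B G) \<le> sqrt (sqnorm (pweight r 0) G)" if "G \<in> ?D" for G
  proof -
    note * = sqrt_abs_norm_le[OF model_hilbert model_operator_self_adjoint A B,
        where R = "pmult (1/2)" and R' = "pmult (- (1/2))", OF smooth smooth _ _ sym sq low that]
    show "G \<in> op_dom B" by (rule *(1)) (simp_all add: pmult_simps)
    have "hnorm ?H (op_app B G) \<le> hnorm ?H (pmult (1/2) G)" by (rule *(2)) (simp_all add: pmult_simps)
    then show "hnorm ?H (op_app B G) \<le> sqrt (sqnorm (pweight r 0) G)"
      by (simp add: model_hnorm pmult_L2w_iff(2)[OF r_lmeas])
  qed
  note C0 = csubspaceD[OF csubspace_L2w[OF pweight_lmeas[of 0]]]
  have F1: "F \<in> L2w (pweight r (-1))" by (rule L2w_pweight_mono(1)[OF F]) simp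
  have cD: "cutoff n F \<in> ?D" for n
    using cutoff_L2w[OF F] by (simp add: smooth_vectors_model)
  have cdiff: "cutoff m F - cutoff n F \<in> ?D" for m n
    using cD csubspaceD(5)[OF csubspace_L2w[OF pweight_lmeas]] by (simp add: smooth_vectors_model)
  show "F \<in> op_dom B"
  proof (rule self_adjoint_closed[OF model_hilbert saB B_bound(1)[OF cD]])
    show "F \<in> form_dom ?H" using F1 by (simp add: model_dom)
    have "(\<lambda>n. sqrt (sqnorm (pweight r (-1)) (F - cutoff n F))) \<longlonglongrightarrow> sqrt 0"
      by (intro tendsto_real_sqrt cutoff_sqnorm_tendsto F1)
    moreover have "sqnorm w (cutoff n F - F) = sqnorm w (F - cutoff n F)" for w n
    proof -
      obtain f where f: "lmeas f" "F = fclass_of f" by (rule fclass_cases)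
      obtain g where g: "lmeas g" "cutoff n F = fclass_of g" by (rule fclass_cases)
      note [measurable] = f(1) g(1)
      have "lmeas (\<lambda>x. f x - g x)" "lmeas (\<lambda>x. g x - f x)" by measurable
      then show ?thesis unfolding g(2) unfolding f(2)
        by (simp add: fclass_of_ops f(1) g(1) sqnorm_of norm_minus_commute)
    qed
    ultimately show "(\<lambda>n. hnorm ?H (cutoff n F - F)) \<longlonglongrightarrow> 0" by (simp add: model_hnorm)
    fix e :: real assume e: "e > 0"
    have "\<forall>\<^sub>F n in sequentially. sqnorm (pweight r 0) (F - cutoff n F) < e\<^sup>2 / 4"
      by (rule order_tendstoD(2)[OF cutoff_sqnorm_tendsto[OF F]]) (use e in simp)
    then obtain N where N: "\<And>n. n \<ge> N \<Longrightarrow> sqnorm (pweight r 0) (F - cutoff n F) < e\<^sup>2 / 4"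
      by (auto simp: eventually_sequentially)
    have "hnorm ?H (op_app B (cutoff m F) - op_app B (cutoff n F)) < e" if "m \<ge> N" "n \<ge> N" for m n
    proof -
      let ?d = "\<lambda>n. F - cutoff n F"
      have d: "?d n \<in> L2w (pweight r 0)" for n by (rule C0(5)[OF F cutoff_L2w[OF F]])
      have m1: "(-1) *\<^sub>C ?d m \<in> L2w (pweight r 0)"
        "sqnorm (pweight r 0) ((-1) *\<^sub>C ?d m) = sqnorm (pweight r 0) (?d m)"
        using scaleC_L2w[OF d[of m], of "-1"] by simp_all
      have "cutoff m F - cutoff n F = ?d n + (-1) *\<^sub>C ?d m" by simp
      then have "sqnorm (pweight r 0) (cutoff m F - cutoff n F) \<le>
          2 * sqnorm (pweight r 0) (?d n) + 2 * sqnorm (pweight r 0) (?d m)"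
        using add_L2w(2)[OF pweight_lmeas d[of n] m1(1)] m1(2) by simp
      also have "\<dots> < e\<^sup>2" using N[OF that(1)] N[OF that(2)] by simp
      finally have "sqrt (sqnorm (pweight r 0) (cutoff m F - cutoff n F)) < e"
        using e by (simp add: real_less_lsqrt sqnorm_nonneg)
      moreover have "op_app B (cutoff m F) - op_app B (cutoff n F) = op_app B (cutoff m F - cutoff n F)"
        using linear_operatorD(6)[OF self_adjoint_linear[OF saB] B_bound(1)[OF cD] B_bound(1)[OF cD]] by simp
      ultimately show ?thesis using B_bound(2)[OF cdiff, of m n] by simp
    qed
    then show "\<exists>N. \<forall>m\<ge>N. \<forall>n\<ge>N. hnorm ?H (op_app B (cutoff m F) - op_app B (cutoff n F)) < e" by blast
  qed
qed

section \<open>Functions that separate the domains\<close>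

text \<open>
  For \<open>p \<ge> -1\<close> the integral dominates that of \<open>1/x\<close> over \<open>[e + 1, b]\<close>, which is unbounded in \<open>b\<close>.
\<close>
lemma integrable_powr_outside:
  assumes e: "0 < e"
  shows "integrable lebesgue (\<lambda>x::real. if \<bar>x\<bar> \<le> e then 0 else \<bar>x\<bar> powr p) \<longleftrightarrow> p < -1"
proof
  assume p: "p < -1"
  have "(\<lambda>x. x powr p) absolutely_integrable_on {e..}"
    using has_integral_powr_to_inf[OF p e]
    by (intro nonnegative_absolutely_integrable_1) (auto simp: integrable_on_def)
  then have i: "integrable lebesgue (\<lambda>x. indicat_real {e..} x *\<^sub>R x powr p)"
    by (simp add: set_integrable_def)
  then have i': "integrable lebesgue (\<lambda>x. indicat_real {e..} (- x) *\<^sub>R (- x) powr p)"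
    using lebesgue_integrable_real_affine_iff[of "-1" "\<lambda>x. indicat_real {e..} x *\<^sub>R x powr p" 0] by simp
  show "integrable lebesgue (\<lambda>x::real. if \<bar>x\<bar> \<le> e then 0 else \<bar>x\<bar> powr p)"
  proof (rule Bochner_Integration.integrable_bound[OF Bochner_Integration.integrable_add[OF i i']])
    show "lmeas (\<lambda>x::real. if \<bar>x\<bar> \<le> e then 0 else \<bar>x\<bar> powr p)"
      by (rule measurable_completion) measurable
    show "AE x in lebesgue. norm (if \<bar>x\<bar> \<le> e then 0 else \<bar>x\<bar> powr p) \<le>
      norm (indicat_real {e..} x *\<^sub>R x powr p + indicat_real {e..} (- x) *\<^sub>R (- x) powr p)"
    proof (intro AE_I2)
      fix x :: real
      consider "\<bar>x\<bar> \<le> e" | "e < x" | "x < - e" by linarith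
      then show "norm (if \<bar>x\<bar> \<le> e then 0 else \<bar>x\<bar> powr p) \<le>
        norm (indicat_real {e..} x *\<^sub>R x powr p + indicat_real {e..} (- x) *\<^sub>R (- x) powr p)"
        using e by cases simp_all
    qed
  qed
next
  assume i: "integrable lebesgue (\<lambda>x::real. if \<bar>x\<bar> \<le> e then 0 else \<bar>x\<bar> powr p)"
  let ?I = "integral\<^sup>L lebesgue (\<lambda>x::real. if \<bar>x\<bar> \<le> e then 0 else \<bar>x\<bar> powr p)"
  show "p < -1"
  proof (rule ccontr)
    assume "\<not> p < -1"
    then have p: "-1 \<le> p" by simp
    define a where "a = e + 1"
    have a: "1 < a" "e < a" using e by (simp_all add: a_def)
    have "ln b - ln a \<le> ?I" if b: "a \<le> b" for b
    proof -
      have "(inverse has_integral (ln b - ln a)) {a..b}"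
        using a b
        by (intro fundamental_theorem_of_calculus)
          (auto intro!: derivative_eq_intros simp: divide_inverse simp flip: has_real_derivative_iff_has_vector_derivative)
      then have "inverse integrable_on {a..b}" "integral {a..b} inverse = ln b - ln a"
        by (rule has_integral_integrable, rule integral_unique)
      moreover from this(1) have "inverse absolutely_integrable_on {a..b}"
        by (rule nonnegative_absolutely_integrable_1) (use a in simp)
      ultimately have "inverse absolutely_integrable_on {a..b}" "integral {a..b} inverse = ln b - ln a"
        by blast+
      then have j: "integrable lebesgue (\<lambda>x. indicat_real {a..b} x *\<^sub>R inverse x)"
        "(LINT x|lebesgue. indicat_real {a..b} x *\<^sub>R inverse x) = ln b - ln a"
        using set_lebesgue_integral_eq_integral(2)[of "{a..b}" inverse]
        by (simp_all add: set_integrable_def set_lebesgue_integral_def)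
      have "(LINT x|lebesgue. indicat_real {a..b} x *\<^sub>R inverse x) \<le> ?I"
      proof (rule integral_mono[OF j(1) i])
        fix x :: real
        have "inverse x \<le> x powr p" if "a \<le> x"
          using powr_mono[OF p, of x] that a by (simp add: powr_minus)
        then show "indicat_real {a..b} x *\<^sub>R inverse x \<le> (if \<bar>x\<bar> \<le> e then 0 else \<bar>x\<bar> powr p)"
          using a by (auto simp: indicator_def)
      qed
      then show ?thesis by (simp only: j(2))
    qed
    moreover have "a \<le> exp (ln a + (\<bar>?I\<bar> + 1))"
    proof -
      have "exp (ln a) \<le> exp (ln a + (\<bar>?I\<bar> + 1))" by (simp only: exp_le_cancel_iff)
      then show ?thesis using a by (simp only: exp_ln)
    qed
    ultimately have "ln (exp (ln a + (\<bar>?I\<bar> + 1))) - ln a \<le> ?I" by blast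
    then show False by (simp only: ln_exp)
  qed
qed

lemma (in model) in_L2w_power_decay:
  assumes h: "lmeas h" and zero: "\<And>x. \<bar>x\<bar> \<le> eps \<Longrightarrow> h x = 0"
    and decay: "AE x in lebesgue. eps < \<bar>x\<bar> \<longrightarrow> (cmod (h x))\<^sup>2 * \<bar>r x\<bar> = \<bar>x\<bar> powr q"
  shows "fclass_of h \<in> L2w (pweight r s) \<longleftrightarrow> q + s < -1"
proof -
  have ae: "AE x in lebesgue. (cmod (h x))\<^sup>2 * \<bar>pweight r s x\<bar> = (if \<bar>x\<bar> \<le> eps then 0 else \<bar>x\<bar> powr (q + s))"
    using decay
  proof eventually_elim
    case (elim x)
    show ?case
    proof (cases "\<bar>x\<bar> \<le> eps")
      case False
      then have "(cmod (h x))\<^sup>2 * \<bar>r x\<bar> * \<bar>x\<bar> powr s = \<bar>x\<bar> powr q * \<bar>x\<bar> powr s" using elim by simp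
      with False show ?thesis by (simp add: pweight_def abs_mult powr_add mult_ac)
    qed (simp add: zero)
  qed
  have "AE x in lebesgue. pweight r s x = 0 \<longrightarrow> h x = 0"
    using AE_sign
    by eventually_elim (use eps_pos in \<open>auto simp: pweight_def zero\<close>)
  then show ?thesis
    using AE_eq_integrable_lebesgue(1)[OF ae] integrable_powr_outside[OF eps_pos, of "q + s"]
    by (simp add: mem_L2w_iff h)
qed

lemma (in model) lmeas_fg: "lmeas (f_fun r eps \<tau>)" "lmeas (g_fun r eps \<tau>)"
proof -
  note [measurable] = r_lmeas lmeas_powr lmeas_sgn
  have S: "{x \<in> space lebesgue. \<bar>x::real\<bar> \<le> eps} \<in> sets lebesgue"
  proof -
    have "{x \<in> space lebesgue. \<bar>x::real\<bar> \<le> eps} = {- eps..eps}" by auto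
    then show ?thesis by simp
  qed
  have h: "lmeas (\<lambda>x. complex_of_real (sgn x / (sqrt \<bar>r x\<bar> * \<bar>x\<bar> powr ((\<tau> + 2) / 4))))"
    "lmeas (\<lambda>x. complex_of_real (1 / (sqrt \<bar>r x\<bar> * \<bar>x\<bar> powr ((2 - \<tau>) / 4))))"
    by measurable
  show "lmeas (f_fun r eps \<tau>)"
    unfolding f_fun_def[abs_def] by (rule measurable_If[OF borel_measurable_const h(1) S])
  show "lmeas (g_fun r eps \<tau>)"
    unfolding g_fun_def[abs_def] by (rule measurable_If[OF borel_measurable_const h(2) S])
qed

text \<open>
  The factor \<open>1 / sqrt |r|\<close> cancels the weight, and what remains is the integrability of a power
  of \<open>|x|\<close> near infinity.
\<close>
lemma (in model) fg_in_L2w_iff: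
  "fclass_of (f_fun r eps \<tau>) \<in> L2w (pweight r s) \<longleftrightarrow> s < \<tau> / 2"
  "fclass_of (g_fun r eps \<tau>) \<in> L2w (pweight r s) \<longleftrightarrow> s < - \<tau> / 2"
proof -
  have sq: "(c / (sqrt \<bar>\<rho>\<bar> * y powr t))\<^sup>2 * \<bar>\<rho>\<bar> = y powr (- 2 * t)"
    if "\<rho> \<noteq> 0" "0 < y" "c\<^sup>2 = 1" for c \<rho> y t :: real
  proof -
    have "y powr (- 2 * t) = 1 / (y powr t)\<^sup>2"
      using that(2) by (simp add: powr_minus_divide powr_power mult.commute)
    then show ?thesis using that by (simp add: power_divide power_mult_distrib)
  qed
  have "fclass_of (f_fun r eps \<tau>) \<in> L2w (pweight r s) \<longleftrightarrow> - 2 * ((\<tau> + 2) / 4) + s < -1"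
  proof (rule in_L2w_power_decay[OF lmeas_fg(1)])
    show "AE x in lebesgue. eps < \<bar>x\<bar> \<longrightarrow> (cmod (f_fun r eps \<tau> x))\<^sup>2 * \<bar>r x\<bar> = \<bar>x\<bar> powr (- 2 * ((\<tau> + 2) / 4))"
      using AE_sign
    proof eventually_elim
      case (elim x)
      have "(sgn x)\<^sup>2 = 1" if "eps < \<bar>x\<bar>" using that eps_pos by (auto simp: sgn_if)
      moreover have "(cmod (f_fun r eps \<tau> x))\<^sup>2 = (sgn x / (sqrt \<bar>r x\<bar> * \<bar>x\<bar> powr ((\<tau> + 2) / 4)))\<^sup>2"
        if "eps < \<bar>x\<bar>"
      proof -
        have "f_fun r eps \<tau> x = complex_of_real (sgn x / (sqrt \<bar>r x\<bar> * \<bar>x\<bar> powr ((\<tau> + 2) / 4)))"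
          using that by (simp add: f_fun_def)
        then show ?thesis by (simp only: norm_of_real power2_abs)
      qed
      ultimately show ?case
        using sq[of "r x" "\<bar>x\<bar>" "sgn x" "(\<tau> + 2) / 4"] elim eps_pos by auto
    qed
  qed (simp add: f_fun_def)
  then show "fclass_of (f_fun r eps \<tau>) \<in> L2w (pweight r s) \<longleftrightarrow> s < \<tau> / 2"
    by (simp add: field_simps)
  have "fclass_of (g_fun r eps \<tau>) \<in> L2w (pweight r s) \<longleftrightarrow> - 2 * ((2 - \<tau>) / 4) + s < -1"
  proof (rule in_L2w_power_decay[OF lmeas_fg(2)])
    show "AE x in lebesgue. eps < \<bar>x\<bar> \<longrightarrow> (cmod (g_fun r eps \<tau> x))\<^sup>2 * \<bar>r x\<bar> = \<bar>x\<bar> powr (- 2 * ((2 - \<tau>) / 4))"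
      using AE_sign
    proof eventually_elim
      case (elim x)
      then show ?case
        using sq[of "r x" "\<bar>x\<bar>" 1 "(2 - \<tau>) / 4"] eps_pos
        by (auto simp: g_fun_def simp del: of_real_divide of_real_mult)
    qed
  qed (simp add: g_fun_def)
  then show "fclass_of (g_fun r eps \<tau>) \<in> L2w (pweight r s) \<longleftrightarrow> s < - \<tau> / 2"
    by (simp add: field_simps) linarith
qed

lemma (in model) fg_parity:
  "odd_part (fclass_of (f_fun r eps \<tau>)) = fclass_of (f_fun r eps \<tau>)"
  "even_part (fclass_of (f_fun r eps \<tau>)) = 0"
  "even_part (fclass_of (g_fun r eps \<tau>)) = fclass_of (g_fun r eps \<tau>)"
  "odd_part (fclass_of (g_fun r eps \<tau>)) = 0"
proof -
  have f: "AE x in lebesgue. f_fun r eps \<tau> (- x) = - f_fun r eps \<tau> x"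
    using AE_odd by eventually_elim (simp add: f_fun_def)
  have g: "AE x in lebesgue. g_fun r eps \<tau> (- x) = g_fun r eps \<tau> x"
    using AE_odd by eventually_elim (simp add: g_fun_def)
  have "reflect (fclass_of (f_fun r eps \<tau>)) = fclass_of (\<lambda>x. (-1) * f_fun r eps \<tau> x)"
    "reflect (fclass_of (g_fun r eps \<tau>)) = fclass_of (g_fun r eps \<tau>)"
    using f g lmeas_fg by (simp_all add: fclass_of_maps fclass_of_eq_iff measurable_reflect_lebesgue)
  then have R: "reflect (fclass_of (f_fun r eps \<tau>)) = - fclass_of (f_fun r eps \<tau>)"
    "reflect (fclass_of (g_fun r eps \<tau>)) = fclass_of (g_fun r eps \<tau>)"
    using fclass_of_maps(1)[OF lmeas_fg(1), of "-1" \<tau>] by simp_all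
  show "odd_part (fclass_of (f_fun r eps \<tau>)) = fclass_of (f_fun r eps \<tau>)"
    "even_part (fclass_of (f_fun r eps \<tau>)) = 0"
    "even_part (fclass_of (g_fun r eps \<tau>)) = fclass_of (g_fun r eps \<tau>)"
    "odd_part (fclass_of (g_fun r eps \<tau>)) = 0"
    by (simp_all add: parity_parts_reflect(1,2) R scaleC_add_right scaleC_half)
qed

text \<open>
  The function \<open>f\<^sub>\<alpha>\<close> is odd and \<open>g\<^sub>0\<close> is even, so only one of the two conditions on the parts matters
  for each of them; both sit at the borderline density \<open>1/|x|\<close> for the space that they miss.
\<close>
lemma (in model) separating_functions:
  assumes a: "0 < \<alpha>" "\<alpha> \<le> 2"
  shows "fclass_of (f_fun r eps \<alpha>) \<in> form_dom (form_t_alpha r 0) - form_dom (form_t_alpha r \<alpha>)"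
    and "fclass_of (g_fun r eps 0) \<in> form_dom (form_t_alpha r \<alpha>) - form_dom (form_t_alpha r 0)"
proof -
  have d0: "form_dom (form_t_alpha r 0) = L2w (pweight r 0)"
    using dom_t_alpha[of 0] by (simp add: balance_simps)
  have da: "form_dom (form_t_alpha r \<alpha>) = {F. balance (\<alpha> / 4) F \<in> L2w (pweight r 0)}"
    by (rule dom_t_alpha) (use a in simp_all)
  show "fclass_of (f_fun r eps \<alpha>) \<in> form_dom (form_t_alpha r 0) - form_dom (form_t_alpha r \<alpha>)"
    "fclass_of (g_fun r eps 0) \<in> form_dom (form_t_alpha r \<alpha>) - form_dom (form_t_alpha r 0)"
    using a unfolding d0 da
    by (simp_all add: balance_def fg_parity pmult_zero pmult_L2w_iff(1)[OF r_lmeas] fg_in_L2w_iff)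
qed

section \<open>Failure of regularity\<close>

text \<open>
  The representing operator is \<open>T\<close>, so regularity would place all of \<open>L\<^sup>2\<^sub>r\<close>, and thus \<open>f\<^sub>\<alpha>\<close>, in the domain
  of \<open>t\<^sub>\<alpha>\<close>.
\<close>
lemma (in model) not_regular_t_alpha:
  assumes a: "0 < \<alpha>" "\<alpha> \<le> 2"
  shows "\<not> regular_form (model_space r) (form_t_alpha r \<alpha>)"
proof
  assume "regular_form (model_space r) (form_t_alpha r \<alpha>)"
  then obtain T A B where T: "represents (model_space r) (form_t_alpha r \<alpha>) T"
    and A: "abs_of_self_adjoint (model_space r) T A" and B: "nonneg_sqrt (model_space r) A B"
    and dom: "form_dom (form_t_alpha r \<alpha>) = op_dom B"
    unfolding regular_form_def by blast
  have a': "0 \<le> \<alpha>" "\<alpha> \<le> 2" using a by simp_all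
  have "op_eq T (model_operator r)"
    by (rule represents_op_eq[OF hilbert_spaceD(1)[OF model_hilbert] symmetric_sesquilinear_t_alpha[OF a'] T represents_t_alpha[OF a']])
  then have "op_eq (op_square T) (op_square (model_operator r))"
    by (auto simp: op_eq_def op_square_def)
  then have "abs_of_self_adjoint (model_space r) (model_operator r) A"
    using A by (auto simp: abs_of_self_adjoint_def nonneg_sqrt_def op_eq_def)
  from L2w_r_subset_sqrt_abs[OF this B] have "L2w (pweight r 0) \<subseteq> form_dom (form_t_alpha r \<alpha>)"
    by (simp add: dom)
  moreover have "form_dom (form_t_alpha r 0) = L2w (pweight r 0)"
    using dom_t_alpha[of 0] by (simp add: balance_simps)
  ultimately show False using separating_functions(1)[OF a] by blast
qed

lemma (in model) regularization_t_alpha: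
  assumes a: "0 \<le> \<alpha>" "\<alpha> \<le> 2"
  shows "regularization_of (model_space r) (form_t_alpha r 0) (form_t_alpha r \<alpha>)"
  unfolding regularization_of_def closure_of_form_def
  using model_operator_self_adjoint model_operator_boundedly_invertible closure_t_alpha[OF a]
    closure_t_alpha[of 0] regular_t_0 by auto

theorem corollary6p10:
  fixes r :: "real \<Rightarrow> real" and eps :: real
  assumes "admissible_weight r eps"
  shows "self_adjoint (model_space r) (model_operator r)
    \<and> (\<forall>\<alpha>\<in>{0..2}. closure_with_gap_point (model_space r) (form_t_alpha r \<alpha>)
          (operator_form (model_space r) (model_operator r)) 0)
    \<and> (\<forall>\<alpha>\<in>{0<..2}. \<not> regular_form (model_space r) (form_t_alpha r \<alpha>))
    \<and> (form_eq (form_t_alpha r 0) (form_t r)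
        \<and> regular_form (model_space r) (form_t_alpha r 0)
        \<and> (\<forall>\<alpha>\<in>{0<..2}.
             regularization_of (model_space r) (form_t_alpha r 0) (form_t_alpha r \<alpha>)))
    \<and> (\<forall>\<alpha>\<in>{0<..2}.
          fclass_of (f_fun r eps \<alpha>) \<in> form_dom (form_t_alpha r 0) - form_dom (form_t_alpha r \<alpha>)
        \<and> fclass_of (g_fun r eps 0) \<in> form_dom (form_t_alpha r \<alpha>) - form_dom (form_t_alpha r 0))"
proof -
  interpret model r eps by unfold_locales (rule assms)
  show ?thesis
  proof (intro conjI ballI)
    fix \<alpha> :: real assume "\<alpha> \<in> {0<..2}"
    then have a: "0 < \<alpha>" "\<alpha> \<le> 2" by auto
    show "\<not> regular_form (model_space r) (form_t_alpha r \<alpha>)" by (rule not_regular_t_alpha[OF a])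
    show "regularization_of (model_space r) (form_t_alpha r 0) (form_t_alpha r \<alpha>)"
      by (rule regularization_t_alpha) (use a in simp_all)
    show "fclass_of (f_fun r eps \<alpha>) \<in> form_dom (form_t_alpha r 0) - form_dom (form_t_alpha r \<alpha>)"
      by (rule separating_functions(1)[OF a])
    show "fclass_of (g_fun r eps 0) \<in> form_dom (form_t_alpha r \<alpha>) - form_dom (form_t_alpha r 0)"
      by (rule separating_functions(2)[OF a])
  next
    fix \<alpha> :: real assume "\<alpha> \<in> {0..2}"
    then show "closure_with_gap_point (model_space r) (form_t_alpha r \<alpha>)
          (operator_form (model_space r) (model_operator r)) 0"
      by (intro closure_t_alpha) auto
  qed (rule model_operator_self_adjoint form_t_alpha_0 regular_t_0)+
qed

end
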